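(* Let $L,\mu,C_f,L_{xy},L_{y^2}>0$. There exist positive constants $c_1,c_2,\tilde L_0,\tilde L,\phi_y,\phi_u$, depending only on $L,\mu,C_f,L_{xy},L_{y^2}$, such that the following holds. Consider the bilevel problem of the context, satisfying the following: for each $\xi\in\mathcal D_u$, $f(\cdot,\cdot;\xi)$ is (possibly non-convex) $L$-smooth (gradient $L$-Lipschitz jointly in $(x,y)$), and its gradient with respect to $y$ is bounded in norm by $C_f$; for each $\zeta\in\mathcal D_l$, $g(x,\cdot;\zeta)$ is $\mu$-strongly convex for every $x$, $g(\cdot,\cdot;\zeta)$ is $L$-smooth, and $\nabla_{xy}g(\cdot,\cdot;\zeta)$, $\nabla_{y^2}g(\cdot,\cdot;\zeta)$ are Lipschitz continuous with constants $L_{xy}$ and $L_{y^2}$; and there is $A$ with $\|\nabla f(x,y;\xi_i)-\nabla f(x,y)\|\le A$, $\|\nabla g(x,y;\zeta_j)-\nabla g(x,y)\|\le A$ and $\|\nabla^2 g(x,y;\zeta_j)-\nabla^2 g(x,y)\|\le A$ for all $(x,y)$, all $\xi_i\in\mathcal D_u$ and all $\zeta_j\in\mathcal D_l$. Let $(x_t,y_t,u_t)_{0\le t\le T}$ be generated by the without-replacement bilevel algorithm WiOR-BO described in the context, run for $T=R\times I$ total steps with learning rates $\eta_t=\eta$, $\gamma_t=c_1\eta$, $\rho_t=c_2\eta$, using an example order $\xi^\pi_t\in\mathcal D_u$, $\zeta^\pi_t\in\mathcal D_l$ for which, with some constants $\alpha$ and $C$, the following averaged-gradient bounds are satisfied: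 for any step $t$ and any interval length $s>0$ (with the interval inside the sequence), at the iterate $(x_t,y_t)$, $$\Big\|\frac1s\sum_{\tau=t}^{t+s-1}\nabla f(x_t,y_t;\xi^\pi_\tau)-\nabla f(x_t,y_t)\Big\|^2\le s^{-\alpha}C^2,$$ $$\Big\|\frac1s\sum_{\tau=t}^{t+s-1}\nabla g(x_t,y_t;\zeta^\pi_\tau)-\nabla g(x_t,y_t)\Big\|^2\le s^{-\alpha}C^2,$$ $$\Big\|\frac1s\sum_{\tau=t}^{t+s-1}\nabla^2 g(x_t,y_t;\zeta^\pi_\tau)-\nabla^2 g(x_t,y_t)\Big\|^2\le s^{-\alpha}C^2.$$ Then for any pair of positive integers $(E,k)$ with $T=E\times k$ and $\eta\le \frac{1}{k\tilde L_0}$, $$\frac1E\sum_{e=0}^{E-1}\|\nabla h(x_{ke})\|^2\le \frac{2\Delta}{kE\eta}+2\tilde L^2k^{-\alpha}C^2,$$ where $\Delta=h(x_0)-h^*+\phi_y\|y_0-y_{x_0}\|^2+\phi_u\|u_0-u_{x_0}\|^2$ is the initial sub-optimality and $h^*=\inf_x h(x)$.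
   Context: **Problem.** Finite datasets $\mathcal D_u=\{\xi_1,\dots,\xi_m\}$ and $\mathcal D_l=\{\zeta_1,\dots,\zeta_n\}$; $f(x,y)=\frac1m\sum_{i=1}^m f(x,y;\xi_i)$, $g(x,y)=\frac1n\sum_{j=1}^n g(x,y;\zeta_j)$ for $x\in\mathbb R^p$, $y\in\mathbb R^d$. Let $y_x=\arg\min_{y\in\mathbb R^d} g(x,y)$, $h(x)=f(x,y_x)$ (to be minimized over $x$), and $u_x=[\nabla_{y^2}g(x,y_x)]^{-1}\nabla_yf(x,y_x)$. Then $\nabla h(x)=\nabla_xf(x,y_x)-\nabla_{xy}g(x,y_x)u_x$, where $\nabla_{xy}g\in\mathbb R^{p\times d}$ and $\nabla_{y^2}g\in\mathbb R^{d\times d}$ are the second-order partial derivative blocks. It is assumed that $h^*>-\infty$. **Assumptions.** (A1) For each $\xi\in\mathcal D_u$, $f(\cdot,\cdot;\xi)$ is (possibly non-convex) $L$-smooth (gradient $L$-Lipschitz jointly in $(x,y)$), and its gradient with respect to $y$ is bounded in norm by $C_f$. (A2) For each $\zeta\in\mathcal D_l$, $g(x,\cdot;\zeta)$ is $\mu$-strongly convex for every $x$, $g(\cdot,\cdot;\zeta)$ is $L$-smooth, and $\nabla_{xy}g(\cdot,\cdot;\zeta)$, $\nabla_{y^2}g(\cdot,\cdot;\zeta)$ are Lipschitz continuous with constants $L_{xy}$ and $L_{y^2}$. (A3) There is $A$ with $\|\nabla f(x,y;\xi_i)-\nabla f(x,y)\|\le A$ for all $(x,y)$ and all $\xi_i\in\mathcal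 D_u$. (A4) With the same $A$, $\|\nabla g(x,y;\zeta_j)-\nabla g(x,y)\|\le A$ and $\|\nabla^2 g(x,y;\zeta_j)-\nabla^2 g(x,y)\|\le A$ for all $(x,y)$ and all $\zeta_j\in\mathcal D_l$. (A5) (for example sequences $\xi^\pi_t\in\mathcal D_u$, $\zeta^\pi_t\in\mathcal D_l$ with constants $\alpha,C$) For any step $t$ and any interval length $k>0$ (with the interval inside the sequence), at the iterate $(x_t,y_t)$: $\big\|\frac1k\sum_{\tau=t}^{t+k-1}\nabla f(x_t,y_t;\xi^\pi_\tau)-\nabla f(x_t,y_t)\big\|^2\le k^{-\alpha}C^2$, $\big\|\frac1k\sum_{\tau=t}^{t+k-1}\nabla g(x_t,y_t;\zeta^\pi_\tau)-\nabla g(x_t,y_t)\big\|^2\le k^{-\alpha}C^2$, $\big\|\frac1k\sum_{\tau=t}^{t+k-1}\nabla^2 g(x_t,y_t;\zeta^\pi_\tau)-\nabla^2 g(x_t,y_t)\big\|^2\le k^{-\alpha}C^2$. **Algorithm WiOR-BO.** Let $I=\mathrm{lcm}(m,n)$ and run $R$ epochs of $I$ steps; $T=RI$. An example order supplies $\xi^\pi_t\in\mathcal D_u$, $\zeta^\pi_t\in\mathcal D_l$ for each step $t=0,\dots,T-1$ (by default random reshuffling: in each epoch, the concatenation of $I/m$ random permutations of $\mathcal D_u$ and of $I/n$ random permutations of $\mathcal D_l$; other orders such as shuffle-once are also allowed). At the start of each epoch (steps $t$ divisible by $I$), $u_t$ is replaced by its Euclidean projection $\mathcal P_\iota(u_t)$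 onto the centered closed ball of radius $\iota=C_f/\mu$ ($u_t$ denotes the projected value). At each step $t$, simultaneously, $$y_{t+1}=y_t-\gamma_t\nabla_yg(x_t,y_t;\zeta^\pi_t),$$ $$u_{t+1}=u_t-\rho_t\big(\nabla_{y^2}g(x_t,y_t;\zeta^\pi_t)u_t-\nabla_yf(x_t,y_t;\xi^\pi_t)\big),$$ $$x_{t+1}=x_t-\eta_t\big(\nabla_xf(x_t,y_t;\xi^\pi_t)-\nabla_{xy}g(x_t,y_t;\zeta^\pi_t)u_t\big).$$ *)

theory Defs
  imports "HOL-Analysis.Analysis"
begin

section \<open>Euclidean spaces of all dimensions inside one type\<close>

text \<open>
  The constants of the theorem must not depend on the dimensions \<open>p\<close> and \<open>d\<close>, so \<open>p\<close> and \<open>d\<close> are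
  quantified inside a formula and cannot be type variables.  We therefore use one inner product
  space, the finitely supported real sequences, and take \<open>\<real>\<^sup>n\<close> to be its subspace \<open>Rn n\<close> of
  vectors supported on the first \<open>n\<close> coordinates.
\<close>

typedef rvec = "{v :: nat \<Rightarrow> real. finite {i. v i \<noteq> 0}}"
  morphisms coord Abs_rvec
  by (rule exI[of _ "\<lambda>_. 0"]) simp

setup_lifting type_definition_rvec

instantiation rvec :: real_vector
begin

lift_definition zero_rvec :: rvec is "\<lambda>_. 0" by simp

lift_definition plus_rvec :: "rvec \<Rightarrow> rvec \<Rightarrow> rvec" is "\<lambda>v w i. v i + w i"
proof -
  fix v w :: "nat \<Rightarrow> real"
  assume "finite {i. v i \<noteq> 0}" "finite {i. w i \<noteq> 0}"
  then show "finite {i. v i + w i \<noteq> 0}"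
    by (rule finite_subset[rotated, OF finite_UnI]) auto
qed

lift_definition uminus_rvec :: "rvec \<Rightarrow> rvec" is "\<lambda>v i. - v i" by simp

lift_definition minus_rvec :: "rvec \<Rightarrow> rvec \<Rightarrow> rvec" is "\<lambda>v w i. v i - w i"
proof -
  fix v w :: "nat \<Rightarrow> real"
  assume "finite {i. v i \<noteq> 0}" "finite {i. w i \<noteq> 0}"
  then show "finite {i. v i - w i \<noteq> 0}"
    by (rule finite_subset[rotated, OF finite_UnI]) auto
qed

lift_definition scaleR_rvec :: "real \<Rightarrow> rvec \<Rightarrow> rvec" is "\<lambda>r v i. r * v i"
  by (erule rev_finite_subset) auto

instance
  by standard (transfer, force simp: algebra_simps)+

end

lemma finite_supp_rvec: "finite {i. coord v i \<noteq> 0}"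
  using coord by blast

instantiation rvec :: real_inner
begin

definition inner_rvec :: "rvec \<Rightarrow> rvec \<Rightarrow> real"
  where "inner_rvec v w = (\<Sum>i | coord v i \<noteq> 0. coord v i * coord w i)"

definition norm_rvec :: "rvec \<Rightarrow> real"
  where "norm_rvec v = sqrt (inner v v)"

definition sgn_rvec :: "rvec \<Rightarrow> rvec"
  where "sgn_rvec v = v /\<^sub>R norm v"

definition dist_rvec :: "rvec \<Rightarrow> rvec \<Rightarrow> real"
  where "dist_rvec v w = norm (v - w)"

definition uniformity_rvec :: "(rvec \<times> rvec) filter"
  where "uniformity_rvec = (INF e\<in>{0<..}. principal {(v, w). dist v w < e})"

definition open_rvec :: "rvec set \<Rightarrow> bool"
  where "open_rvec U = (\<forall>v\<in>U. eventually (\<lambda>(v', w). v' = v \<longrightarrow> w \<in> U) uniformity)"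

lemma inner_rvec_superset:
  "finite I \<Longrightarrow> {i. coord v i \<noteq> 0} \<subseteq> I \<Longrightarrow> inner v w = (\<Sum>i\<in>I. coord v i * coord w i)"
  unfolding inner_rvec_def by (rule sum.mono_neutral_left) auto

instance
proof
  fix u v w :: rvec and r :: real and U :: "rvec set"
  let ?s = "\<lambda>v. {i. coord v i \<noteq> 0}"
  show "dist v w = norm (v - w)" by (rule dist_rvec_def)
  show "sgn v = v /\<^sub>R norm v" by (rule sgn_rvec_def)
  show "uniformity = (INF e\<in>{0<..}. principal {(v::rvec, w). dist v w < e})"
    by (rule uniformity_rvec_def)
  show "open U = (\<forall>v\<in>U. eventually (\<lambda>(v', w). v' = v \<longrightarrow> w \<in> U) uniformity)"
    by (rule open_rvec_def)
  show "norm v = sqrt (inner v v)" by (rule norm_rvec_def)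
  have fin: "finite (?s v \<union> ?s w)" by (simp add: finite_supp_rvec)
  show "inner v w = inner w v"
    using inner_rvec_superset[OF fin, of v w] inner_rvec_superset[OF fin, of w v]
    by (simp add: mult.commute)
  have "?s (v + w) \<subseteq> ?s v \<union> ?s w" by (auto simp: plus_rvec.rep_eq)
  then show "inner (v + w) u = inner v u + inner w u"
    by (simp add: inner_rvec_superset[OF fin] plus_rvec.rep_eq distrib_right sum.distrib)
  have "?s (r *\<^sub>R v) \<subseteq> ?s v" by (auto simp: scaleR_rvec.rep_eq)
  then show "inner (r *\<^sub>R v) u = r * inner v u"
    by (simp add: inner_rvec_superset[OF finite_supp_rvec[of v]] scaleR_rvec.rep_eq
        sum_distrib_left mult.assoc)
  show "0 \<le> inner v v" by (simp add: inner_rvec_def sum_nonneg)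
  show "(inner v v = 0) = (v = 0)"
    by (auto simp: inner_rvec_def sum_nonneg_eq_0_iff finite_supp_rvec zero_rvec.rep_eq
        coord_inject[symmetric] fun_eq_iff)
qed

end

definition Rn :: "nat \<Rightarrow> rvec set"
  where "Rn n = {v. \<forall>i\<ge>n. coord v i = 0}"

lemma inner_Rn: "v \<in> Rn n \<Longrightarrow> inner v w = (\<Sum>i<n. coord v i * coord w i)"
  by (rule inner_rvec_superset) (auto simp: Rn_def not_le[symmetric])

lemma bij_betw_Rn: "bij_betw (\<lambda>v. restrict (coord v) {..<n}) (Rn n) ({..<n} \<rightarrow>\<^sub>E UNIV)"
proof (rule bij_betwI')
  fix v w assume "v \<in> Rn n" "w \<in> Rn n"
  then show "(restrict (coord v) {..<n} = restrict (coord w) {..<n}) = (v = w)"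
    by (auto simp: Rn_def coord_inject[symmetric] fun_eq_iff restrict_def) (metis not_le)
next
  fix a :: "nat \<Rightarrow> real" assume a: "a \<in> {..<n} \<rightarrow>\<^sub>E UNIV"
  have "finite {i. (if i < n then a i else 0) \<noteq> 0}"
    by (rule finite_subset[of _ "{..<n}"]) auto
  then have c: "coord (Abs_rvec (\<lambda>i. if i < n then a i else 0)) = (\<lambda>i. if i < n then a i else 0)"
    by (simp add: Abs_rvec_inverse)
  show "\<exists>v\<in>Rn n. a = restrict (coord v) {..<n}"
    using a by (intro bexI[of _ "Abs_rvec (\<lambda>i. if i < n then a i else 0)"])
      (auto simp: c Rn_def fun_eq_iff restrict_def PiE_def extensional_def)
qed auto

lemma subspace_Rn: "subspace (Rn n)"
  by (simp add: subspace_def Rn_def zero_rvec.rep_eq plus_rvec.rep_eq scaleR_rvec.rep_eq)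


section \<open>Calculus on a subspace\<close>

text \<open>
  Functions on \<open>S = \<real>\<^sup>n\<close> or \<open>S = \<real>\<^sup>p \<times> \<real>\<^sup>d\<close> are total functions on the ambient type of which only
  the values on \<open>S\<close> matter; accordingly derivatives are taken within \<open>S\<close>, where they are determined
  only on \<open>S\<close>, and gradients are required to lie in \<open>S\<close>.  The norm of a pair is the joint
  Euclidean norm.
\<close>

definition gradient_on :: "'a::real_inner set \<Rightarrow> ('a \<Rightarrow> real) \<Rightarrow> 'a \<Rightarrow> 'a"
  where "gradient_on S F z = (THE G. G \<in> S \<and> (F has_derivative (\<lambda>v. inner G v)) (at z within S))"

lemma gradient_on_eqI:
  assumes S: "subspace S" and z: "z \<in> S" and G: "G \<in> S"
    and der: "(F has_derivative (\<lambda>v. inner G v)) (at z within S)"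
  shows "gradient_on S F z = G"
  unfolding gradient_on_def
proof (rule the_equality)
  show "G \<in> S \<and> (F has_derivative (\<lambda>v. inner G v)) (at z within S)"
    using G der by simp
next
  fix G' assume G': "G' \<in> S \<and> (F has_derivative (\<lambda>v. inner G' v)) (at z within S)"
  define w where "w = G' - G"
  have w: "w \<in> S" using G G' S by (simp add: w_def subspace_diff)
  define l where "l = (\<lambda>t::real. z + t *\<^sub>R w)"
  have lS: "range l \<subseteq> S"
    using S z w by (auto simp: l_def subspace_add subspace_scale)
  have l: "(l has_derivative (\<lambda>t. t *\<^sub>R w)) (at 0)"
    unfolding l_def by (auto intro!: derivative_eq_intros)
  have "((\<lambda>t. F (l t)) has_derivative (\<lambda>t. inner H (t *\<^sub>R w))) (at 0)"
    if "(F has_derivative (\<lambda>v. inner H v)) (at z within S)" for H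
    using has_derivative_in_compose[OF l, of F "\<lambda>v. inner H v"] has_derivative_subset[OF that lS]
    by (simp add: l_def)
  then have "(\<lambda>t. inner G (t *\<^sub>R w)) = (\<lambda>t. inner G' (t *\<^sub>R w))"
    using der G' by (blast intro: has_derivative_unique)
  then have "inner G (1 *\<^sub>R w) = inner G' (1 *\<^sub>R w)" by meson
  then have "inner w w = 0" by (simp add: w_def inner_diff_left)
  then show "G' = G" by (simp add: w_def)
qed

definition hessian_on :: "'a::real_inner set \<Rightarrow> ('a \<Rightarrow> real) \<Rightarrow> 'a \<Rightarrow> 'a \<Rightarrow> 'a"
  where "hessian_on S F z = frechet_derivative (gradient_on S F) (at z within S)"

definition onorm_on :: "'a::real_normed_vector set \<Rightarrow> ('a \<Rightarrow> 'b::real_normed_vector) \<Rightarrow> real"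
  where "onorm_on S D = (SUP v\<in>S. norm (D v) / norm v)"

definition L_smooth_on :: "'a::real_inner set \<Rightarrow> real \<Rightarrow> ('a \<Rightarrow> real) \<Rightarrow> bool"
  where "L_smooth_on S L F \<longleftrightarrow>
    (\<forall>z\<in>S. F differentiable (at z within S)) \<and> L-lipschitz_on S (gradient_on S F)"

definition strongly_convex_on :: "'a::real_inner set \<Rightarrow> real \<Rightarrow> ('a \<Rightarrow> real) \<Rightarrow> bool"
  where "strongly_convex_on S \<mu> F \<longleftrightarrow> convex_on S (\<lambda>y. F y - \<mu> / 2 * (norm y)\<^sup>2)"

definition proj_ball :: "nat \<Rightarrow> real \<Rightarrow> rvec \<Rightarrow> rvec"
  where "proj_ball d \<iota> u = arg_min_on (\<lambda>w. norm (w - u)) (cball 0 \<iota> \<inter> Rn d)"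


section \<open>The bilevel problem\<close>

definition avg :: "nat \<Rightarrow> (nat \<Rightarrow> 'a \<Rightarrow> real) \<Rightarrow> 'a \<Rightarrow> real"
  where "avg m F z = (\<Sum>i<m. F i z) / real m"

definition grad :: "nat \<Rightarrow> nat \<Rightarrow> (rvec \<times> rvec \<Rightarrow> real) \<Rightarrow> rvec \<times> rvec \<Rightarrow> rvec \<times> rvec"
  where "grad p d = gradient_on (Rn p \<times> Rn d)"

definition grad_x :: "nat \<Rightarrow> nat \<Rightarrow> (rvec \<times> rvec \<Rightarrow> real) \<Rightarrow> rvec \<times> rvec \<Rightarrow> rvec"
  where "grad_x p d F z = fst (grad p d F z)"

definition grad_y :: "nat \<Rightarrow> nat \<Rightarrow> (rvec \<times> rvec \<Rightarrow> real) \<Rightarrow> rvec \<times> rvec \<Rightarrow> rvec"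
  where "grad_y p d F z = snd (grad p d F z)"

definition hess :: "nat \<Rightarrow> nat \<Rightarrow> (rvec \<times> rvec \<Rightarrow> real) \<Rightarrow> rvec \<times> rvec \<Rightarrow> rvec \<times> rvec \<Rightarrow> rvec \<times> rvec"
  where "hess p d = hessian_on (Rn p \<times> Rn d)"

text \<open>
  Applying the full second derivative to \<open>(0, u)\<close> gives the pair of the products of the blocks
  \<open>\<nabla>\<^sub>x\<^sub>y\<close> (a \<open>p \<times> d\<close> matrix) and \<open>\<nabla>\<^sub>y\<^sub>y\<close> (a \<open>d \<times> d\<close> matrix) with \<open>u\<close>.
\<close>

definition hess_xy :: "nat \<Rightarrow> nat \<Rightarrow> (rvec \<times> rvec \<Rightarrow> real) \<Rightarrow> rvec \<times> rvec \<Rightarrow> rvec \<Rightarrow> rvec"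
  where "hess_xy p d G z u = fst (hess p d G z (0, u))"

definition hess_yy :: "nat \<Rightarrow> nat \<Rightarrow> (rvec \<times> rvec \<Rightarrow> real) \<Rightarrow> rvec \<times> rvec \<Rightarrow> rvec \<Rightarrow> rvec"
  where "hess_yy p d G z u = snd (hess p d G z (0, u))"

definition y_opt :: "nat \<Rightarrow> (rvec \<times> rvec \<Rightarrow> real) \<Rightarrow> rvec \<Rightarrow> rvec"
  where "y_opt d G x = arg_min_on (\<lambda>y. G (x, y)) (Rn d)"

definition u_opt ::
    "nat \<Rightarrow> nat \<Rightarrow> (rvec \<times> rvec \<Rightarrow> real) \<Rightarrow> (rvec \<times> rvec \<Rightarrow> real) \<Rightarrow> rvec \<Rightarrow> rvec"
  where "u_opt p d F G x =
    inv_into (Rn d) (hess_yy p d G (x, y_opt d G x)) (grad_y p d F (x, y_opt d G x))"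

definition hyper_obj ::
    "nat \<Rightarrow> (rvec \<times> rvec \<Rightarrow> real) \<Rightarrow> (rvec \<times> rvec \<Rightarrow> real) \<Rightarrow> rvec \<Rightarrow> real"
  where "hyper_obj d F G x = F (x, y_opt d G x)"

definition upper_assms ::
    "nat \<Rightarrow> nat \<Rightarrow> nat \<Rightarrow> (nat \<Rightarrow> rvec \<times> rvec \<Rightarrow> real) \<Rightarrow> real \<Rightarrow> real \<Rightarrow> bool"
  where "upper_assms p d m f L C\<^sub>f \<longleftrightarrow> (\<forall>i<m.
    L_smooth_on (Rn p \<times> Rn d) L (f i) \<and>
    (\<forall>z \<in> Rn p \<times> Rn d. norm (grad_y p d (f i) z) \<le> C\<^sub>f))"

definition lower_assms ::
    "nat \<Rightarrow> nat \<Rightarrow> nat \<Rightarrow> (nat \<Rightarrow> rvec \<times> rvec \<Rightarrow> real) \<Rightarrow> real \<Rightarrow> real \<Rightarrow> real \<Rightarrow> real \<Rightarrow> bool"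
  where "lower_assms p d n g L \<mu> L\<^sub>x\<^sub>y L\<^sub>y\<^sub>y \<longleftrightarrow> (\<forall>j<n.
    (\<forall>x \<in> Rn p. strongly_convex_on (Rn d) \<mu> (\<lambda>y. g j (x, y))) \<and>
    L_smooth_on (Rn p \<times> Rn d) L (g j) \<and>
    (\<forall>z \<in> Rn p \<times> Rn d. grad p d (g j) differentiable (at z within Rn p \<times> Rn d)) \<and>
    (\<forall>z \<in> Rn p \<times> Rn d. \<forall>z' \<in> Rn p \<times> Rn d.
      onorm_on (Rn d) (\<lambda>v. hess_xy p d (g j) z v - hess_xy p d (g j) z' v) \<le> L\<^sub>x\<^sub>y * dist z z' \<and>
      onorm_on (Rn d) (\<lambda>v. hess_yy p d (g j) z v - hess_yy p d (g j) z' v) \<le> L\<^sub>y\<^sub>y * dist z z'))"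

definition bounded_heterogeneity ::
    "nat \<Rightarrow> nat \<Rightarrow> nat \<Rightarrow> nat \<Rightarrow> (nat \<Rightarrow> rvec \<times> rvec \<Rightarrow> real) \<Rightarrow> (nat \<Rightarrow> rvec \<times> rvec \<Rightarrow> real) \<Rightarrow>
      real \<Rightarrow> bool"
  where "bounded_heterogeneity p d m n f g A \<longleftrightarrow> (\<forall>z \<in> Rn p \<times> Rn d.
    (\<forall>i<m. norm (grad p d (f i) z - grad p d (avg m f) z) \<le> A) \<and>
    (\<forall>j<n. norm (grad p d (g j) z - grad p d (avg n g) z) \<le> A \<and>
      onorm_on (Rn p \<times> Rn d) (\<lambda>v. hess p d (g j) z v - hess p d (avg n g) z v) \<le> A))"


section \<open>The algorithm\<close>

text \<open>
  \<open>w\<close> is the auxiliary iterate before projection and \<open>u\<close> the one actually used; they differ only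
  at the steps that start an epoch.  The learning rates are functions of the step.
\<close>

definition wior_bo ::
    "nat \<Rightarrow> nat \<Rightarrow> nat \<Rightarrow> nat \<Rightarrow> (nat \<Rightarrow> rvec \<times> rvec \<Rightarrow> real) \<Rightarrow> (nat \<Rightarrow> rvec \<times> rvec \<Rightarrow> real) \<Rightarrow>
      real \<Rightarrow> nat \<Rightarrow> (nat \<Rightarrow> nat) \<Rightarrow> (nat \<Rightarrow> nat) \<Rightarrow>
      (nat \<Rightarrow> real) \<Rightarrow> (nat \<Rightarrow> real) \<Rightarrow> (nat \<Rightarrow> real) \<Rightarrow>
      (nat \<Rightarrow> rvec) \<Rightarrow> (nat \<Rightarrow> rvec) \<Rightarrow> (nat \<Rightarrow> rvec) \<Rightarrow> bool"
  where "wior_bo p d m n f g \<iota> R \<xi> \<zeta> \<eta> \<gamma> \<rho> x y u \<longleftrightarrow>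
    (let I = lcm m n; T = R * I in
      x 0 \<in> Rn p \<and> y 0 \<in> Rn d \<and>
      (\<exists>w. w 0 \<in> Rn d \<and>
        (\<forall>t\<le>T. u t = (if t < T \<and> I dvd t then proj_ball d \<iota> (w t) else w t)) \<and>
        (\<forall>t<T.
          y (Suc t) = y t - \<gamma> t *\<^sub>R grad_y p d (g (\<zeta> t)) (x t, y t) \<and>
          w (Suc t) = u t - \<rho> t *\<^sub>R (hess_yy p d (g (\<zeta> t)) (x t, y t) (u t)
                                      - grad_y p d (f (\<xi> t)) (x t, y t)) \<and>
          x (Suc t) = x t - \<eta> t *\<^sub>R (grad_x p d (f (\<xi> t)) (x t, y t)
                                      - hess_xy p d (g (\<zeta> t)) (x t, y t) (u t)))))"

definition averaged_gradient_bounds ::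
    "nat \<Rightarrow> nat \<Rightarrow> nat \<Rightarrow> nat \<Rightarrow> (nat \<Rightarrow> rvec \<times> rvec \<Rightarrow> real) \<Rightarrow> (nat \<Rightarrow> rvec \<times> rvec \<Rightarrow> real) \<Rightarrow>
      nat \<Rightarrow> (nat \<Rightarrow> nat) \<Rightarrow> (nat \<Rightarrow> nat) \<Rightarrow> (nat \<Rightarrow> rvec) \<Rightarrow> (nat \<Rightarrow> rvec) \<Rightarrow> real \<Rightarrow> real \<Rightarrow> bool"
  where "averaged_gradient_bounds p d m n f g T \<xi> \<zeta> x y \<alpha> C \<longleftrightarrow>
    (\<forall>t s. 0 < s \<and> t + s \<le> T \<longrightarrow> (let z = (x t, y t); B = real s powr (-\<alpha>) * C\<^sup>2 in
      (norm ((1 / real s) *\<^sub>R (\<Sum>\<tau>=t..<t+s. grad p d (f (\<xi> \<tau>)) z) - grad p d (avg m f) z))\<^sup>2 \<le> B \<and>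
      (norm ((1 / real s) *\<^sub>R (\<Sum>\<tau>=t..<t+s. grad p d (g (\<zeta> \<tau>)) z) - grad p d (avg n g) z))\<^sup>2 \<le> B \<and>
      (onorm_on (Rn p \<times> Rn d)
        (\<lambda>v. (1 / real s) *\<^sub>R (\<Sum>\<tau>=t..<t+s. hess p d (g (\<zeta> \<tau>)) z v) - hess p d (avg n g) z v))\<^sup>2 \<le> B))"

end

theory Submission
  imports Defs
begin

text \<open>
  Put \<open>w = (x, y, u)\<close>.  The algorithm moves \<open>w\<close> by a sampled vector field \<open>V\<^sub>t\<close> that is Lipschitz on
  the ball \<open>norm u \<le> C\<^sub>f / \<mu>\<close>; this ball is invariant, so only the first projection has an effect.  Over
  \<open>k\<close> steps the sampling errors average out and \<open>w\<close> moves by one deterministic step of length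
  \<open>a = k\<eta>\<close> along the mean field, up to an error \<open>a O(\<delta> + a norm V)\<close> with \<open>\<delta>\<^sup>2 = C\<^sup>2 k powr (-\<alpha>)\<close>.
  Such a step decreases \<open>h x + norm (y - y\<^sub>x)\<^sup>2 + norm (u - u\<^sub>x)\<^sup>2\<close> by \<open>a / 2 norm (\<nabla> h x)\<^sup>2\<close> up to
  \<open>O(a \<delta>\<^sup>2)\<close>, provided that \<open>c\<^sub>2\<close> is large, \<open>c\<^sub>1\<close> is large compared to \<open>c\<^sub>2\<close>, and \<open>a\<close> is small.  For
  \<open>\<alpha> > 2\<close> short partial sums are controlled only through the samples of the next block; the last
  block has no successor and is treated by \<open>norm (\<nabla> h)\<^sup>2 = O(h - h\<^sup>*)\<close>.
\<close>

section \<open>Geometry of finitely supported sequences\<close>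

text \<open>Blocks of length \<open>k\<close> need not be aligned with epochs, so a projection that
  took effect inside a block would spoil the comparison with one mean-field step; this is why
  invariance of the ball is worth proving, and it is proved for single sampled pairs. Outside a ball
  the Hessian products are not uniformly Lipschitz, since they are linear in \<open>u\<close>. One
  constant \<open>K\<close> majorises every Lipschitz constant in sight, so that the remaining
  choices can be made in sequence without circularity. The damping rate \<open>c2\<close> must beat
  the drift of the target of \<open>u\<close> while \<open>x\<close> moves. The rate
  \<open>c1\<close> must do the same for \<open>y\<close> and also pay for the error of
  \<open>y\<close> that enters the \<open>u\<close>-step multiplied by \<open>c2\<close>. The step
  size comes last: the mean field is bounded by the norm of the hypergradient and the two tracking
  errors, so for small \<open>a\<close> its share of the block error is absorbed by the decrease.
  The case \<alpha> > 2 is special because the bound on a sum of \<open>s\<close> errors, of order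
  \<open>s powr (1 - \<alpha> / 2)\<close>, then decreases in \<open>s\<close>: short sums are
  controlled worse than long ones.\<close>

lift_definition axis_rvec :: "nat \<Rightarrow> rvec" is "\<lambda>i j. if j = i then 1 else 0"
  by (rule finite_subset[of _ "{i}" for i]) auto

lemma axis_in_Rn: "i < n \<Longrightarrow> axis_rvec i \<in> Rn n"
  by (simp add: Rn_def axis_rvec.rep_eq)

lemma coord_sum: "coord (\<Sum>i\<in>I. v i) j = (\<Sum>i\<in>I. coord (v i) j)"
  by (induction I rule: infinite_finite_induct) (auto simp: zero_rvec.rep_eq plus_rvec.rep_eq)

lemma Rn_expansion:
  assumes "v \<in> Rn n"
  shows "v = (\<Sum>i<n. coord v i *\<^sub>R axis_rvec i)"
  unfolding coord_inject[symmetric] using assms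
  by (auto simp: fun_eq_iff coord_sum scaleR_rvec.rep_eq axis_rvec.rep_eq if_distrib Rn_def
      sum.delta cong: if_cong)

lemma inner_axis_rvec: "inner v (axis_rvec i) = coord v i"
proof -
  have "inner (axis_rvec i) v = (\<Sum>j\<in>{i}. coord (axis_rvec i) j * coord v j)"
    by (rule inner_rvec_superset) (auto simp: axis_rvec.rep_eq)
  then show ?thesis by (simp add: axis_rvec.rep_eq inner_commute)
qed

text \<open>The ambient space is not complete and \<open>D\<close> is not assumed bounded, so in
  general no vector represents \<open>D\<close> everywhere. On finitely many coordinates the vector
  of its values on the axes does.\<close>

lemma linear_Rn_riesz:
  assumes "linear (D :: rvec \<Rightarrow> real)"
  obtains w where "w \<in> Rn n" "\<And>v. v \<in> Rn n \<Longrightarrow> D v = inner w v"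
proof
  let ?w = "\<Sum>i<n. D (axis_rvec i) *\<^sub>R axis_rvec i"
  show "?w \<in> Rn n"
    by (intro subspace_sum[OF subspace_Rn] subspace_scale[OF subspace_Rn] axis_in_Rn) simp
  fix v assume v: "v \<in> Rn n"
  have "D v = (\<Sum>i<n. coord v i * D (axis_rvec i))"
    by (subst Rn_expansion[OF v]) (simp add: linear_sum[OF assms] linear_scale[OF assms])
  also have "\<dots> = inner ?w v"
    by (simp add: inner_sum_left inner_commute[of "axis_rvec _" v] inner_axis_rvec mult.commute)
  finally show "D v = inner ?w v" .
qed

lemma linear_Rn_pair_riesz:
  assumes D: "linear (D :: rvec \<times> rvec \<Rightarrow> real)"
  obtains w where "w \<in> Rn p \<times> Rn d" "\<And>v. v \<in> Rn p \<times> Rn d \<Longrightarrow> D v = inner w v"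
proof -
  have pair: "linear (\<lambda>a :: rvec. (a, 0 :: rvec))" "linear (\<lambda>b :: rvec. (0 :: rvec, b))"
    by (auto intro!: linearI)
  have "linear (\<lambda>a. D (a, 0))" "linear (\<lambda>b. D (0, b))"
    using linear_compose[OF pair(1) D] linear_compose[OF pair(2) D] by (simp_all add: o_def)
  obtain w1 where w1: "w1 \<in> Rn p" "\<And>v. v \<in> Rn p \<Longrightarrow> D (v, 0) = inner w1 v"
    using linear_Rn_riesz[OF \<open>linear (\<lambda>a. D (a, 0))\<close>] by blast
  obtain w2 where w2: "w2 \<in> Rn d" "\<And>v. v \<in> Rn d \<Longrightarrow> D (0, v) = inner w2 v"
    using linear_Rn_riesz[OF \<open>linear (\<lambda>b. D (0, b))\<close>] by blast
  have "D v = inner (w1, w2) v" if "v \<in> Rn p \<times> Rn d" for v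
    using that linear_add[OF D, of "(fst v, 0)" "(0, snd v)"] w1 w2 by (cases v) auto
  then show thesis using w1 w2 that[of "(w1, w2)"] by auto
qed

text \<open>Closed balls of the ambient space are not compact, so compactness is built up by
  induction on the dimension, each new coordinate contributing a segment.\<close>

lemma compact_Rn_cball: "compact (cball 0 r \<inter> Rn n)"
proof (induction n)
  case 0
  have "Rn 0 = {0}" by (auto simp: Rn_def coord_inject[symmetric] fun_eq_iff zero_rvec.rep_eq)
  then show ?case by (simp add: closed_Int_compact)
next
  case (Suc n)
  let ?f = "\<lambda>(v, c::real). v + c *\<^sub>R axis_rvec n"
  let ?I = "?f ` ((cball 0 r \<inter> Rn n) \<times> {-r..r})"
  have "compact ?I"
    by (intro compact_continuous_image compact_Times Suc.IH compact_Icc)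
      (auto intro!: continuous_intros simp: split_beta)
  \<comment> \<open>The image is larger than the ball, since both summands may have norm
    \<open>r\<close>; intersecting with the closed ball repairs this and keeps compactness.\<close>
  moreover have "cball 0 r \<inter> Rn (Suc n) = cball 0 r \<inter> ?I"
  proof safe
    fix v assume v: "v \<in> cball 0 r" "v \<in> Rn (Suc n)"
    let ?w = "v - coord v n *\<^sub>R axis_rvec n"
    have sub: "?w \<in> Rn n"
      using v(2) by (auto simp: Rn_def minus_rvec.rep_eq scaleR_rvec.rep_eq axis_rvec.rep_eq)
    have na: "norm (axis_rvec n) = 1"
      by (simp add: norm_eq_sqrt_inner inner_axis_rvec axis_rvec.rep_eq)
    have c: "\<bar>coord v n\<bar> \<le> r"
      using Cauchy_Schwarz_ineq2[of v "axis_rvec n"] v(1) by (simp add: inner_axis_rvec na)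
    have "inner ?w (axis_rvec n) = 0"
      by (simp add: inner_axis_rvec minus_rvec.rep_eq scaleR_rvec.rep_eq axis_rvec.rep_eq)
    then have "(norm v)\<^sup>2 = (norm ?w)\<^sup>2 + (norm (coord v n *\<^sub>R axis_rvec n))\<^sup>2"
      using norm_add_Pythagorean[of ?w "coord v n *\<^sub>R axis_rvec n"] by (simp add: orthogonal_def)
    then have "(norm ?w)\<^sup>2 \<le> (norm v)\<^sup>2" by simp
    then have "norm ?w \<le> r" using v(1) power2_le_imp_le[of "norm ?w" "norm v"] by simp
    then show "v \<in> ?I"
      using sub c by (intro image_eqI[of _ _ "(?w, coord v n)"]) auto
  next
    fix v and c :: real assume "v \<in> Rn n"
    then show "v + c *\<^sub>R axis_rvec n \<in> Rn (Suc n)"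
      by (auto simp: Rn_def plus_rvec.rep_eq scaleR_rvec.rep_eq axis_rvec.rep_eq)
  qed
  ultimately show ?case by (simp add: closed_Int_compact)
qed

text \<open>A Cauchy sequence is bounded and so stays in one of the compact balls. Completeness is
  what the Banach fixed point theorem asks for later.\<close>

lemma complete_Rn: "complete (Rn n)"
  unfolding complete_def
proof safe
  fix s :: "nat \<Rightarrow> rvec" assume s: "\<forall>i. s i \<in> Rn n" "Cauchy s"
  obtain r where "\<And>i. norm (s i) \<le> r"
    using cauchy_imp_bounded[OF s(2)] by (auto simp: bounded_iff)
  then have "\<forall>i. s i \<in> cball 0 r \<inter> Rn n" using s(1) by simp
  then show "\<exists>l\<in>Rn n. s \<longlonglongrightarrow> l"
    using compact_imp_complete[OF compact_Rn_cball] s(2) unfolding complete_def by blast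
qed

lemma subspace_Rn_Times: "subspace (Rn p \<times> Rn d)"
  by (rule subspace_Times[OF subspace_Rn subspace_Rn])

lemma closed_Rn_Times: "closed (Rn p \<times> Rn d)"
  by (simp add: closed_Times complete_imp_closed complete_Rn)

lemma zero_in_Rn [simp]: "0 \<in> Rn n"
  by (rule subspace_0[OF subspace_Rn])

section \<open>Calculus and monotone operators on subspaces\<close>

text \<open>The common tool for derivatives within a subspace: membership, norm bounds and
  inequalities that hold for difference quotients with positive \<open>t\<close> pass to the
  derivative, and so does uniqueness in directions of the subspace.\<close>

lemma has_derivative_within_directional:
  assumes D: "(F has_derivative D) (at z within S)" and S: "subspace S" "z \<in> S" "v \<in> S"
  shows "((\<lambda>t. (F (z + t *\<^sub>R v) - F z) /\<^sub>R t) \<longlongrightarrow> D v) (at_right (0::real))"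
proof -
  have lD: "linear D" using D has_derivative_linear by blast
  define l where "l = (\<lambda>t::real. z + t *\<^sub>R v)"
  have lS: "range l \<subseteq> S" using S by (auto simp: l_def subspace_add subspace_scale)
  have l: "(l has_derivative (\<lambda>t. t *\<^sub>R v)) (at 0)"
    unfolding l_def by (auto intro!: derivative_eq_intros)
  have "((\<lambda>t. F (l t)) has_derivative (\<lambda>t. D (t *\<^sub>R v))) (at 0)"
    using has_derivative_in_compose[OF l, of F D] has_derivative_subset[OF D lS]
    by (simp add: l_def)
  then have "((\<lambda>t. norm (F (l t) - F z - t *\<^sub>R D v) / norm t) \<longlongrightarrow> 0) (at 0)"
    by (simp add: has_derivative_iff_norm l_def linear_scale[OF lD])
  then have lim: "((\<lambda>t. norm (F (l t) - F z - t *\<^sub>R D v) / norm t) \<longlongrightarrow> 0) (at_right 0)"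
    by (rule tendsto_within_subset) simp
  have "((\<lambda>t. norm ((F (l t) - F z) /\<^sub>R t - D v)) \<longlongrightarrow> 0) (at_right 0)"
  proof (rule Lim_transform_eventually[OF lim])
    show "\<forall>\<^sub>F t in at_right 0. norm (F (l t) - F z - t *\<^sub>R D v) / norm t
        = norm ((F (l t) - F z) /\<^sub>R t - D v)"
      using eventually_at_right_less[of 0]
    proof eventually_elim
      case (elim t)
      then have "(F (l t) - F z) /\<^sub>R t - D v = (F (l t) - F z - t *\<^sub>R D v) /\<^sub>R t"
        by (simp add: scaleR_diff_right)
      then show ?case using elim by (simp add: divide_inverse mult.commute)
    qed
  qed
  then show ?thesis
    unfolding l_def by (subst Lim_null) (rule tendsto_norm_zero_cancel)
qed

lemma has_derivative_within_in_subspace: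
  assumes "(F has_derivative D) (at z within S)" "subspace S" "z \<in> S" "v \<in> S"
    and "closed T" "subspace T" "\<And>w. w \<in> S \<Longrightarrow> F w \<in> T"
  shows "D v \<in> T"
proof (rule Lim_in_closed_set[OF assms(5) _ _ has_derivative_within_directional[OF assms(1-4)]])
  show "\<forall>\<^sub>F t in at_right 0. (F (z + t *\<^sub>R v) - F z) /\<^sub>R t \<in> T"
    using assms(2-4,6,7) by (intro always_eventually allI subspace_scale subspace_diff)
      (auto intro: subspace_add subspace_scale)
qed simp

lemma has_derivative_within_unique:
  assumes "(F has_derivative D) (at z within S)" "(F has_derivative D') (at z within S)"
    "subspace S" "z \<in> S" "v \<in> S"
  shows "D v = D' v"
  by (rule tendsto_unique[OF _ has_derivative_within_directional[OF assms(1,3-5)]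
        has_derivative_within_directional[OF assms(2,3-5)]]) simp

lemma lipschitz_derivative_bound:
  assumes D: "(F has_derivative D) (at z within S)" and S: "subspace S" "z \<in> S" "v \<in> S"
    and lip: "L-lipschitz_on S F"
  shows "norm (D v) \<le> L * norm v"
proof (rule tendsto_upperbound[OF tendsto_norm[OF has_derivative_within_directional[OF D S]]])
  show "\<forall>\<^sub>F t in at_right 0. norm ((F (z + t *\<^sub>R v) - F z) /\<^sub>R t) \<le> L * norm v"
    using eventually_at_right_less[of 0]
  proof eventually_elim
    case (elim t)
    have "norm (F (z + t *\<^sub>R v) - F z) \<le> L * norm (t *\<^sub>R v)"
      using lipschitz_onD[OF lip, of "z + t *\<^sub>R v" z] S
      by (simp add: dist_norm subspace_add subspace_scale)
    then show ?case using elim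
      by (simp only: norm_scaleR abs_inverse abs_of_pos) (simp add: field_simps)
  qed
qed simp

section \<open>Mean values and symmetry of second derivatives\<close>

lemma mvt_along_segment:
  assumes S: "subspace S" "z \<in> S" "v \<in> S"
    and der: "\<And>w. w \<in> S \<Longrightarrow> (F has_derivative (\<lambda>v. inner (N w) v)) (at w within S)"
  obtains \<theta> :: real where "0 \<le> \<theta>" "\<theta> \<le> 1" "F (z + v) - F z = inner (N (z + \<theta> *\<^sub>R v)) v"
proof -
  define l where "l = (\<lambda>t::real. z + t *\<^sub>R v)"
  have lS: "l t \<in> S" for t using S by (auto simp: l_def subspace_add subspace_scale)
  have "((\<lambda>t. F (l t)) has_derivative (\<lambda>s. inner (N (l t)) (s *\<^sub>R v))) (at t within {0..1})" for t
  proof (rule has_derivative_in_compose[of l "\<lambda>s. s *\<^sub>R v"])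
    show "(l has_derivative (\<lambda>s. s *\<^sub>R v)) (at t within {0..1})"
      unfolding l_def by (auto intro!: derivative_eq_intros)
    show "(F has_derivative (\<lambda>v. inner (N (l t)) v)) (at (l t) within l ` {0..1})"
      using lS by (intro has_derivative_subset[OF der]) auto
  qed
  then obtain \<theta> where "\<theta> \<in> {0..1}" "F (l 1) - F (l 0) = inner (N (l \<theta>)) ((1 - 0) *\<^sub>R v)"
    using mvt_very_simple[of 0 1 "\<lambda>t. F (l t)" "\<lambda>t s. inner (N (l t)) (s *\<^sub>R v)"] by auto
  then show thesis using that[of \<theta>] by (simp add: l_def)
qed

text \<open>The second difference is symmetric in \<open>v\<close> and \<open>w\<close>, so its
  limit yields the symmetry of the Hessian. Differentiability of the gradient at the single point
  \<open>z\<close> is enough because both gradient values are compared with the same expansion at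
  \<open>z\<close>.\<close>

lemma second_difference_limit:
  assumes S: "subspace S" "z \<in> S" "v \<in> S" "w \<in> S"
    and der: "\<And>w. w \<in> S \<Longrightarrow> (F has_derivative (\<lambda>v. inner (N w) v)) (at w within S)"
    and H: "(N has_derivative H) (at z within S)"
  shows "((\<lambda>s. (F (z + s *\<^sub>R v + s *\<^sub>R w) - F (z + s *\<^sub>R v) - (F (z + s *\<^sub>R w) - F z)) / s\<^sup>2)
    \<longlongrightarrow> inner (H w) v) (at_right (0::real))"
proof (rule tendstoI)
  fix e :: real assume e: "0 < e"
  have lH: "linear H" using H has_derivative_linear by blast
  define c where "c = norm v + norm w"
  \<comment> \<open>Two remainders of size \<open>e' * (s * c)\<close>, paired with \<open>v\<close>
    and divided by \<open>s\<close>, must stay below \<open>e\<close>; the added 1 covers the case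
    that \<open>v\<close> is zero.\<close>
  define e' where "e' = e / (2 * norm v * c + 1)"
  have c: "0 \<le> c" by (simp add: c_def)
  have pos: "0 < 2 * norm v * c + 1" using c by (simp add: add_nonneg_pos)
  have e': "0 < e'" using e pos by (simp add: e'_def)
  obtain \<delta> where \<delta>: "0 < \<delta>" and R: "\<And>q. q \<in> S \<Longrightarrow> norm (q - z) < \<delta> \<Longrightarrow>
      norm (N q - N z - H (q - z)) \<le> e' * norm (q - z)"
    using H e' unfolding has_derivative_within_alt by blast
  have "\<forall>\<^sub>F s in at_right 0. s < \<delta> / (c + 1)"
    using \<delta> c by (intro order_tendstoD(2)[of "\<lambda>s. s" 0]) auto
  then show "\<forall>\<^sub>F s in at_right 0. dist ((F (z + s *\<^sub>R v + s *\<^sub>R w) - F (z + s *\<^sub>R v)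
      - (F (z + s *\<^sub>R w) - F z)) / s\<^sup>2) (inner (H w) v) < e"
    using eventually_at_right_less[of 0]
  proof eventually_elim
    case (elim s)
    have dq: "((\<lambda>q. F (q + s *\<^sub>R w) - F q) has_derivative
        (\<lambda>k. inner (N (q + s *\<^sub>R w) - N q) k)) (at q within S)" if "q \<in> S" for q
    proof -
      have im: "(\<lambda>q. q + s *\<^sub>R w) ` S \<subseteq> S" using S by (auto intro: subspace_add subspace_scale)
      have "((\<lambda>q. F (q + s *\<^sub>R w)) has_derivative (\<lambda>k. inner (N (q + s *\<^sub>R w)) k)) (at q within S)"
      proof (rule has_derivative_in_compose[where f = "\<lambda>q. q + s *\<^sub>R w"])
        show "((\<lambda>q. q + s *\<^sub>R w) has_derivative (\<lambda>k. k)) (at q within S)"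
          by (auto intro!: derivative_eq_intros)
        show "(F has_derivative (\<lambda>k. inner (N (q + s *\<^sub>R w)) k))
            (at (q + s *\<^sub>R w) within (\<lambda>q. q + s *\<^sub>R w) ` S)"
          using that S im by (intro has_derivative_subset[OF der]) auto
      qed
      from has_derivative_diff[OF this der[OF that]] show ?thesis
        by (simp add: inner_diff_left)
    qed
    \<comment> \<open>The mean value theorem is applied to the first difference in direction
      \<open>w\<close>, so that away from \<open>z\<close> only gradients are evaluated.\<close>
    obtain \<theta> where \<theta>: "0 \<le> \<theta>" "\<theta> \<le> 1"
      and eq: "F (z + s *\<^sub>R v + s *\<^sub>R w) - F (z + s *\<^sub>R v) - (F (z + s *\<^sub>R w) - F z)
        = inner (N (z + \<theta> *\<^sub>R s *\<^sub>R v + s *\<^sub>R w) - N (z + \<theta> *\<^sub>R s *\<^sub>R v)) (s *\<^sub>R v)"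
      by (rule mvt_along_segment[OF S(1,2) subspace_scale[OF S(1,3)] dq])
    define a where "a = \<theta> *\<^sub>R s *\<^sub>R v"
    define b where "b = a + s *\<^sub>R w"
    have ab: "z + a \<in> S" "z + b \<in> S"
      using S by (auto simp: a_def b_def intro!: subspace_add subspace_scale)
    have na: "norm a \<le> s * norm v"
      using \<theta> elim(2) mult_right_mono[of \<theta> 1 "s * norm v"] by (simp add: a_def)
    have sw: "0 \<le> s * norm w" using elim(2) by simp
    have na': "norm a \<le> s * c"
      unfolding c_def distrib_left using na sw by linarith
    have nb: "norm b \<le> s * c"
    proof -
      have "norm b \<le> norm a + s * norm w"
        using norm_triangle_ineq[of a "s *\<^sub>R w"] elim(2) by (simp add: b_def)
      then show ?thesis unfolding c_def distrib_left using na by linarith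
    qed
    have sc: "s * c < \<delta>"
    proof -
      have "s * c \<le> s * (c + 1)" using elim(2) by simp
      also have "\<dots> < \<delta>" using elim(1) c by (simp add: pos_less_divide_eq)
      finally show ?thesis .
    qed
    have rem: "norm (N (z + k) - N z - H k) \<le> e' * (s * c)" if "z + k \<in> S" "norm k \<le> s * c" for k
    proof -
      have "norm (N (z + k) - N z - H k) \<le> e' * norm k"
        using R[OF that(1)] le_less_trans[OF that(2) sc] by simp
      also have "\<dots> \<le> e' * (s * c)" using e' that(2) by (intro mult_left_mono) auto
      finally show ?thesis .
    qed
    have ra: "norm (N (z + a) - N z - H a) \<le> e' * (s * c)"
      by (rule rem[OF ab(1) na'])
    have rb: "norm (N (z + b) - N z - H b) \<le> e' * (s * c)"
      by (rule rem[OF ab(2) nb])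
    have Hba: "H b = H a + s *\<^sub>R H w" by (simp add: b_def linear_add[OF lH] linear_scale[OF lH])
    have "norm (N (z + b) - N (z + a) - s *\<^sub>R H w) \<le> 2 * e' * s * c"
    proof -
      have "N (z + b) - N (z + a) - s *\<^sub>R H w = (N (z + b) - N z - H b) - (N (z + a) - N z - H a)"
        by (simp add: Hba)
      then have "norm (N (z + b) - N (z + a) - s *\<^sub>R H w)
          \<le> norm (N (z + b) - N z - H b) + norm (N (z + a) - N z - H a)"
        by (simp only: norm_triangle_ineq4)
      then show ?thesis using ra rb by simp
    qed
    then have "\<bar>inner (N (z + b) - N (z + a) - s *\<^sub>R H w) v\<bar> \<le> 2 * e' * s * c * norm v"
      using Cauchy_Schwarz_ineq2[of "N (z + b) - N (z + a) - s *\<^sub>R H w" v]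
        mult_right_mono[of _ "2 * e' * s * c" "norm v"] by (meson norm_ge_zero order_trans)
    also have "\<dots> = s * (e' * (2 * norm v * c))" by simp
    also have "\<dots> < s * e"
    proof -
      have "e' * (2 * norm v * c) < e' * (2 * norm v * c + 1)" using e' by simp
      also have "\<dots> = e" using pos by (simp add: e'_def)
      finally show ?thesis using elim(2) by simp
    qed
    finally have bnd: "\<bar>inner (N (z + b) - N (z + a) - s *\<^sub>R H w) v\<bar> < s * e" .
    have "inner (N (z + b) - N (z + a)) (s *\<^sub>R v) / s\<^sup>2 - inner (H w) v
        = inner (N (z + b) - N (z + a) - s *\<^sub>R H w) v / s"
      using elim(2) by (simp add: inner_diff_left power2_eq_square diff_divide_distrib)
    also have "\<bar>\<dots>\<bar> < e" using bnd elim(2) by (simp add: abs_divide field_simps)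
    finally show ?case
      unfolding eq dist_real_def b_def a_def by (simp add: add.assoc)
  qed
qed

text \<open>One and the same second difference has two limits, one for each order of the two
  directions.\<close>

lemma hessian_symmetric:
  assumes S: "subspace S" "z \<in> S" "v \<in> S" "w \<in> S"
    and der: "\<And>w. w \<in> S \<Longrightarrow> (F has_derivative (\<lambda>v. inner (N w) v)) (at w within S)"
    and H: "(N has_derivative H) (at z within S)"
  shows "inner (H v) w = inner v (H w)"
proof -
  have "inner (H w) v = inner (H v) w"
    using tendsto_unique[OF _ second_difference_limit[OF S der H]]
      second_difference_limit[OF S(1,2,4,3) der H]
    by (simp add: algebra_simps)
  then show ?thesis by (simp add: inner_commute)
qed

section \<open>Tangent inequalities of convex functions\<close>

lemma convex_on_above_tangent_within:
  assumes S: "subspace S" "y \<in> S" "y' \<in> S" and cvx: "convex_on S \<phi>"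
    and D: "(\<phi> has_derivative D) (at y within S)"
  shows "\<phi> y + D (y' - y) \<le> \<phi> y'"
proof -
  have "D (y' - y) \<le> \<phi> y' - \<phi> y"
  proof (rule tendsto_upperbound[OF has_derivative_within_directional[OF D S(1,2) subspace_diff[OF S(1,3,2)]]])
    have "\<forall>\<^sub>F t in at_right 0. t < (1::real)"
      by (intro order_tendstoD(2)[of "\<lambda>s. s" 0]) auto
    then show "\<forall>\<^sub>F t in at_right 0. (\<phi> (y + t *\<^sub>R (y' - y)) - \<phi> y) /\<^sub>R t \<le> \<phi> y' - \<phi> y"
      using eventually_at_right_less[of 0]
    proof eventually_elim
      case (elim t)
      have "\<phi> ((1 - t) *\<^sub>R y + t *\<^sub>R y') \<le> (1 - t) * \<phi> y + t * \<phi> y'"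
        using elim S by (intro convex_onD[OF cvx]) auto
      also have "(1 - t) *\<^sub>R y + t *\<^sub>R y' = y + t *\<^sub>R (y' - y)" by (simp add: algebra_simps)
      finally have "\<phi> (y + t *\<^sub>R (y' - y)) - \<phi> y \<le> t * (\<phi> y' - \<phi> y)" by (simp add: algebra_simps)
      then show ?case using elim by (simp add: field_simps)
    qed
  qed simp
  then show ?thesis by simp
qed

text \<open>Sum of the two tangent inequalities, from \<open>y\<close> to \<open>y'\<close> and
  back.\<close>

lemma strongly_convex_on_gradient_monotone:
  assumes S: "subspace S" "y \<in> S" "y' \<in> S" and cvx: "strongly_convex_on S \<mu> \<phi>"
    and der: "\<And>y. y \<in> S \<Longrightarrow> (\<phi> has_derivative (\<lambda>v. inner (N y) v)) (at y within S)"
  shows "\<mu> * (norm (y - y'))\<^sup>2 \<le> inner (N y - N y') (y - y')"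
proof -
  have d: "((\<lambda>y. \<phi> y - \<mu> / 2 * (norm y)\<^sup>2) has_derivative (\<lambda>v. inner (N y) v - \<mu> * inner y v))
      (at y within S)" if "y \<in> S" for y
    unfolding power2_norm_eq_inner
    by (auto intro!: derivative_eq_intros der[OF that] simp: inner_commute)
  have 1: "\<phi> y - \<mu> / 2 * (norm y)\<^sup>2 + (inner (N y) (y' - y) - \<mu> * inner y (y' - y))
      \<le> \<phi> y' - \<mu> / 2 * (norm y')\<^sup>2"
    using convex_on_above_tangent_within[OF S cvx[unfolded strongly_convex_on_def] d] S by simp
  have 2: "\<phi> y' - \<mu> / 2 * (norm y')\<^sup>2 + (inner (N y') (y - y') - \<mu> * inner y' (y - y'))
      \<le> \<phi> y - \<mu> / 2 * (norm y)\<^sup>2"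
    using convex_on_above_tangent_within[OF S(1,3,2) cvx[unfolded strongly_convex_on_def] d] S by simp
  from 1 2 show ?thesis
    by (simp add: power2_norm_eq_inner inner_diff_left inner_diff_right algebra_simps inner_commute)
qed

lemma strongly_convex_on_above_tangent:
  assumes S: "subspace S" "y \<in> S" "y' \<in> S" and cvx: "strongly_convex_on S \<mu> \<phi>"
    and der: "(\<phi> has_derivative (\<lambda>v. inner w v)) (at y within S)"
  shows "\<phi> y + inner w (y' - y) + \<mu> / 2 * (norm (y' - y))\<^sup>2 \<le> \<phi> y'"
proof -
  have d: "((\<lambda>y. \<phi> y - \<mu> / 2 * (norm y)\<^sup>2) has_derivative (\<lambda>v. inner w v - \<mu> * inner y v))
      (at y within S)"
    unfolding power2_norm_eq_inner
    by (auto intro!: derivative_eq_intros der simp: inner_commute)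
  show ?thesis
    using convex_on_above_tangent_within[OF S cvx[unfolded strongly_convex_on_def] d]
    by (simp add: power2_norm_eq_inner inner_diff_left inner_diff_right algebra_simps inner_commute)
qed

text \<open>Expanding the square, the term quadratic in \<open>q\<close> is absorbed by half of the
  linear one because \<open>q * L\<^sup>2 \<le> \<mu>\<close>. The remaining factor
  \<open>1 - q * \<mu>\<close> is at most the square of \<open>1 - q * \<mu> / 2\<close>. Here
  \<open>w\<close> may be a difference of values of a nonlinear map.\<close>

lemma strongly_monotone_step_contraction:
  fixes v w :: "'a::real_inner"
  assumes mono: "\<mu> * (norm v)\<^sup>2 \<le> inner w v" and lip: "norm w \<le> L * norm v"
    and q: "0 < \<mu>" "0 \<le> q" "q * L\<^sup>2 \<le> \<mu>"
  shows "norm (v - q *\<^sub>R w) \<le> (1 - q * \<mu> / 2) * norm v"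
proof (cases "v = 0")
  case False
  have "\<mu> * (norm v)\<^sup>2 \<le> norm w * norm v" using mono norm_cauchy_schwarz order_trans by blast
  also have "\<dots> \<le> L * norm v * norm v" by (intro mult_right_mono lip) simp
  finally have \<mu>L: "\<mu> \<le> L" using False by (simp add: power2_eq_square mult.assoc)
  have "q * \<mu>\<^sup>2 \<le> q * L\<^sup>2" using \<mu>L q by (intro mult_left_mono power_mono) auto
  then have "q * \<mu> * \<mu> \<le> 1 * \<mu>" using q(3) by (simp add: power2_eq_square mult.assoc)
  then have q\<mu>: "q * \<mu> \<le> 1" using q(1) by (simp only: mult_le_cancel_right_pos)
  have w2: "(norm w)\<^sup>2 \<le> L\<^sup>2 * (norm v)\<^sup>2"
    using power_mono[OF lip, of 2] by (simp add: power_mult_distrib)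
  have "q * (q * (norm w)\<^sup>2) \<le> q * (\<mu> * (norm v)\<^sup>2)"
  proof (intro mult_left_mono q(2))
    have "q * (norm w)\<^sup>2 \<le> q * (L\<^sup>2 * (norm v)\<^sup>2)" by (intro mult_left_mono w2 q)
    also have "\<dots> \<le> \<mu> * (norm v)\<^sup>2" using mult_right_mono[OF q(3), of "(norm v)\<^sup>2"] by (simp add: mult.assoc)
    finally show "q * (norm w)\<^sup>2 \<le> \<mu> * (norm v)\<^sup>2" .
  qed
  moreover have "q * (\<mu> * (norm v)\<^sup>2) \<le> q * inner w v" by (intro mult_left_mono mono q)
  moreover have "(norm (v - q *\<^sub>R w))\<^sup>2 = (norm v)\<^sup>2 - 2 * (q * inner w v) + q * (q * (norm w)\<^sup>2)"
    by (simp add: power2_norm_eq_inner inner_diff_left inner_diff_right inner_commute)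
  ultimately have "(norm (v - q *\<^sub>R w))\<^sup>2 \<le> (norm v)\<^sup>2 - q * (\<mu> * (norm v)\<^sup>2)" by linarith
  also have "\<dots> \<le> (norm v)\<^sup>2 - q * (\<mu> * (norm v)\<^sup>2) + (q * \<mu> / 2)\<^sup>2 * (norm v)\<^sup>2" by simp
  also have "\<dots> = ((1 - q * \<mu> / 2) * norm v)\<^sup>2" by (simp add: power2_eq_square algebra_simps)
  finally show ?thesis 
    by (rule power2_le_imp_le) (use q\<mu> in simp)
next
  case True
  then have "w = 0" using lip by simp
  with True show ?thesis by simp
qed

text \<open>
  Unlike \<open>strongly_monotone_step_contraction\<close>, the next bound has the sharp factor, which
  makes the ball of radius \<open>C\<^sub>f / \<mu>\<close> invariant; this needs the symmetry of the operator.
\<close>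

lemma symmetric_step_contraction:
  fixes H :: "'a::real_inner \<Rightarrow> 'a"
  assumes lH: "linear H" and S: "subspace S" "\<And>v. v \<in> S \<Longrightarrow> H v \<in> S"
    and sym: "\<And>v w. v \<in> S \<Longrightarrow> w \<in> S \<Longrightarrow> inner (H v) w = inner v (H w)"
    and lo: "\<And>v. v \<in> S \<Longrightarrow> \<mu> * (norm v)\<^sup>2 \<le> inner (H v) v"
    and up: "\<And>v. v \<in> S \<Longrightarrow> norm (H v) \<le> L * norm v"
    and r: "0 \<le> r" "r * L \<le> 1" "r * \<mu> < 1" and v: "v \<in> S"
  shows "norm (v - r *\<^sub>R H v) \<le> (1 - r * \<mu>) * norm v"
proof -
  define b where "b = 1 - r * \<mu>"
  define P where "P v = v - r *\<^sub>R H v" for v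
  define p where "p = P v"
  \<comment> \<open>This vector replaces the spectral theorem. For \<open>0 \<le> P \<le> b\<close>
    one has \<open>P\<^sup>2 \<le> b P\<close>, since \<open>b P (b - P)\<close> is the sum of
    \<open>(b - P) P (b - P)\<close> and \<open>P (b - P) P\<close>. Positivity of \<open>P\<close>
    is tested at \<open>q\<close>, the upper bound at \<open>p\<close>.\<close>
  define q where "q = b *\<^sub>R v - p"
  have PS: "P v \<in> S" if "v \<in> S" for v
    using that S by (simp add: P_def subspace_diff subspace_scale)
  have pq: "p \<in> S" "q \<in> S" using v S PS by (auto simp: p_def q_def subspace_diff subspace_scale)
  have P0: "0 \<le> inner (P v) v" if "v \<in> S" for v
  proof -
    have "r * inner (H v) v \<le> r * (L * norm v * norm v)"
      using norm_cauchy_schwarz[of "H v" v] mult_right_mono[OF up[OF that], of "norm v"]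
      by (intro mult_left_mono r) auto
    also have "\<dots> \<le> 1 * (norm v * norm v)"
      using mult_right_mono[OF r(2), of "norm v * norm v"] by (simp add: mult.assoc)
    finally show ?thesis
      by (simp add: P_def inner_diff_left power2_eq_square[symmetric] power2_norm_eq_inner)
  qed
  have Pb: "inner (P v) v \<le> b * inner v v" if "v \<in> S" for v
    using mult_left_mono[OF lo[OF that] r(1)]
    by (simp add: P_def b_def inner_diff_left power2_norm_eq_inner algebra_simps)
  have Psym: "inner (P v) w = inner v (P w)" if "v \<in> S" "w \<in> S" for v w
    using sym[OF that] by (simp add: P_def inner_diff_left inner_diff_right)
  have "P q = b *\<^sub>R P v - P p"
    by (simp add: q_def P_def linear_diff[OF lH] linear_scale[OF lH] scaleR_diff_right mult.commute)
  then have Pq: "P q = b *\<^sub>R p - P p" by (simp only: p_def)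
  have "inner (P q) q + (b * inner p p - inner (P p) p) = b * (b * inner p v - inner p p)"
    using Psym[OF pq(1) v] unfolding Pq
    by (simp add: q_def p_def[symmetric] inner_diff_left inner_diff_right algebra_simps)
  then have "0 \<le> b * (b * inner p v - inner p p)" using P0[OF pq(2)] Pb[OF pq(1)] by linarith
  moreover have b: "0 < b" using r(3) by (simp add: b_def)
  ultimately have "inner p p \<le> b * inner p v" by (simp add: zero_le_mult_iff)
  also have "\<dots> \<le> b * (b * inner v v)" using Pb[OF v] b by (simp add: p_def)
  finally have "(norm p)\<^sup>2 \<le> (b * norm v)\<^sup>2" by (simp add: power2_norm_eq_inner power_mult_distrib power2_eq_square[of b])
  then have "norm p \<le> b * norm v" using b by (intro power2_le_imp_le[of "norm p"]) auto
  then show ?thesis by (simp only: p_def P_def b_def)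
qed

text \<open>Used twice: for the stationary point of the lower level and for the linear system that
  defines \<open>u_opt\<close>.\<close>

lemma strongly_monotone_zero_exists:
  fixes N :: "'a::real_inner \<Rightarrow> 'a"
  assumes S: "subspace S" "complete S" "\<And>y. y \<in> S \<Longrightarrow> N y \<in> S"
    and mono: "\<And>y y'. y \<in> S \<Longrightarrow> y' \<in> S \<Longrightarrow> \<mu> * (norm (y - y'))\<^sup>2 \<le> inner (N y - N y') (y - y')"
    and lip: "\<And>y y'. y \<in> S \<Longrightarrow> y' \<in> S \<Longrightarrow> norm (N y - N y') \<le> L * norm (y - y')"
    and \<mu>: "0 < \<mu>"
  obtains y where "y \<in> S" "N y = 0"
proof -
  \<comment> \<open>This step gives \<open>q * L\<^sup>2 \<le> \<mu>\<close> for the contraction and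
    \<open>q * \<mu> \<le> 1\<close> for a nonnegative factor at once; the denominator is positive
    whatever \<open>L\<close> is.\<close>
  define q where "q = \<mu> / (L\<^sup>2 + \<mu>\<^sup>2)"
  have den: "0 < L\<^sup>2 + \<mu>\<^sup>2" using \<mu> by (simp add: add_nonneg_pos)
  have q0: "0 < q" using \<mu> den by (simp add: q_def)
  have "q * (L\<^sup>2 + \<mu>\<^sup>2) = \<mu>" using den by (simp add: q_def)
  then have "q * L\<^sup>2 + q * \<mu>\<^sup>2 = \<mu>" by (simp only: distrib_left)
  moreover have "0 \<le> q * L\<^sup>2" "0 \<le> q * \<mu>\<^sup>2" using q0 by auto
  ultimately have "q * L\<^sup>2 \<le> \<mu>" "q * \<mu>\<^sup>2 \<le> \<mu>" by linarith+
  then have q: "0 < q" "q * L\<^sup>2 \<le> \<mu>" "q * \<mu> \<le> 1"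
    using q0 \<mu> mult_le_cancel_right_pos[OF \<mu>, of "q * \<mu>" 1]
    by (simp_all add: power2_eq_square mult.assoc)
  have "\<exists>!y\<in>S. y - q *\<^sub>R N y = y"
  proof (rule Banach_fix[OF S(2), where c = "1 - q * \<mu> / 2"])
    show "S \<noteq> {}" using subspace_0[OF S(1)] by auto
    show "(\<lambda>y. y - q *\<^sub>R N y) ` S \<subseteq> S" using S
      by (intro image_subsetI subspace_diff subspace_scale)
    show "0 \<le> 1 - q * \<mu> / 2" "1 - q * \<mu> / 2 < 1" using q(3) mult_pos_pos[OF q0 \<mu>] by linarith+
    show "dist (y - q *\<^sub>R N y) (y' - q *\<^sub>R N y') \<le> (1 - q * \<mu> / 2) * dist y y'"
      if "y \<in> S" "y' \<in> S" for y y'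
    proof -
      have "(y - q *\<^sub>R N y) - (y' - q *\<^sub>R N y') = (y - y') - q *\<^sub>R (N y - N y')"
        by (simp add: algebra_simps)
      then show ?thesis
        using strongly_monotone_step_contraction[OF mono[OF that] lip[OF that] \<mu> less_imp_le[OF q(1)] q(2)]
        by (simp only: dist_norm)
    qed
  qed
  then have "\<exists>y. y \<in> S \<and> y - q *\<^sub>R N y = y" by (rule ex1_implies_ex)
  then obtain y where y: "y \<in> S" "y - q *\<^sub>R N y = y" by (elim exE conjE)
  from y(2) q(1) have "N y = 0" by simp
  with y(1) show thesis by (rule that)
qed

section \<open>Smooth and strongly convex functions\<close>

text \<open>The supremum in \<open>onorm_on\<close> is one of reals and bounds its members only if
  the quotients are bounded above, hence the bounded linearity of \<open>D\<close>. The zero vector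
  contributes the quotient 0 by the convention for division.\<close>

lemma onorm_onD:
  assumes D: "bounded_linear D" and v: "v \<in> S"
  shows "norm (D v) \<le> onorm_on S D * norm v"
proof (cases "v = 0")
  case True
  then show ?thesis using linear_0[OF bounded_linear.linear[OF D]] by simp
next
  case False
  obtain B where B: "0 < B" "\<And>v. norm (D v) \<le> norm v * B"
    using bounded_linear.pos_bounded[OF D] by auto
  have "norm (D w) / norm w \<le> B" for w
    using B(1) B(2)[of w] by (cases "w = 0") (simp_all add: pos_divide_le_eq mult.commute)
  then have "bdd_above ((\<lambda>w. norm (D w) / norm w) ` S)" by (intro bdd_aboveI2)
  then have "norm (D v) / norm v \<le> onorm_on S D"
    unfolding onorm_on_def by (rule cSUP_upper[OF v])
  then show ?thesis using False by (simp add: pos_divide_le_eq)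
qed

text \<open>Only directions of the subspace matter for a derivative within it, so a linear
  functional may be exchanged for the inner product with a vector of the subspace.\<close>

lemma has_derivative_within_subspace_cong:
  assumes D: "(F has_derivative D) (at z within S)" and S: "subspace S" "z \<in> S"
    and D': "bounded_linear D'" "\<And>v. v \<in> S \<Longrightarrow> D v = D' v"
  shows "(F has_derivative D') (at z within S)"
proof -
  have "D (w - z) = D' (w - z)" if "w \<in> S" for w
    using that S by (intro D'(2) subspace_diff)
  then show ?thesis using D D'(1) unfolding has_derivative_within_alt by simp
qed

lemma norm_fst_le_norm: "norm (fst z) \<le> norm z"
  by (cases z) (simp add: norm_fst_le)

lemma norm_snd_le_norm: "norm (snd z) \<le> norm z"
  by (cases z) (simp add: norm_snd_le)

locale smooth_function =
  fixes p d :: nat and \<phi> :: "rvec \<times> rvec \<Rightarrow> real" and L :: real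
  assumes differentiable: "z \<in> Rn p \<times> Rn d \<Longrightarrow> \<phi> differentiable (at z within Rn p \<times> Rn d)"
    and grad_lipschitz: "z \<in> Rn p \<times> Rn d \<Longrightarrow> z' \<in> Rn p \<times> Rn d \<Longrightarrow>
      norm (grad p d \<phi> z - grad p d \<phi> z') \<le> L * norm (z - z')"
begin

text \<open>\<open>gradient_on\<close> is a definite description. Differentiability supplies some
  derivative, and its Riesz vector in the subspace is the object described.\<close>

lemma grad_props:
  assumes z: "z \<in> Rn p \<times> Rn d"
  shows "grad p d \<phi> z \<in> Rn p \<times> Rn d"
    and "(\<phi> has_derivative (\<lambda>v. inner (grad p d \<phi> z) v)) (at z within Rn p \<times> Rn d)"
proof -
  obtain D where D: "(\<phi> has_derivative D) (at z within Rn p \<times> Rn d)"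
    using differentiable[OF z] unfolding differentiable_def by blast
  obtain w where w: "w \<in> Rn p \<times> Rn d" "\<And>v. v \<in> Rn p \<times> Rn d \<Longrightarrow> D v = inner w v"
    using linear_Rn_pair_riesz[OF has_derivative_linear[OF D]] by blast
  have der: "(\<phi> has_derivative (\<lambda>v. inner w v)) (at z within Rn p \<times> Rn d)"
    by (rule has_derivative_within_subspace_cong[OF D subspace_Rn_Times z bounded_linear_inner_right w(2)])
  have "grad p d \<phi> z = w"
    unfolding grad_def by (rule gradient_on_eqI[OF subspace_Rn_Times z w(1) der])
  then show "grad p d \<phi> z \<in> Rn p \<times> Rn d"
    "(\<phi> has_derivative (\<lambda>v. inner (grad p d \<phi> z) v)) (at z within Rn p \<times> Rn d)"
    using w(1) der by simp_all
qed

lemma grad_x_in: "z \<in> Rn p \<times> Rn d \<Longrightarrow> grad_x p d \<phi> z \<in> Rn p"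
  and grad_y_in: "z \<in> Rn p \<times> Rn d \<Longrightarrow> grad_y p d \<phi> z \<in> Rn d"
  using grad_props(1)[of z] by (auto simp: grad_x_def grad_y_def mem_Times_iff)

lemma grad_x_lipschitz: "z \<in> Rn p \<times> Rn d \<Longrightarrow> z' \<in> Rn p \<times> Rn d \<Longrightarrow>
      norm (grad_x p d \<phi> z - grad_x p d \<phi> z') \<le> L * norm (z - z')"
  and grad_y_lipschitz: "z \<in> Rn p \<times> Rn d \<Longrightarrow> z' \<in> Rn p \<times> Rn d \<Longrightarrow>
      norm (grad_y p d \<phi> z - grad_y p d \<phi> z') \<le> L * norm (z - z')"
  unfolding grad_x_def grad_y_def fst_diff[symmetric] snd_diff[symmetric]
  by (blast intro: order_trans[OF norm_fst_le_norm] order_trans[OF norm_snd_le_norm] grad_lipschitz)+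

lemma has_derivative_snd:
  assumes "x \<in> Rn p" "y \<in> Rn d"
  shows "((\<lambda>y. \<phi> (x, y)) has_derivative (\<lambda>v. inner (grad_y p d \<phi> (x, y)) v)) (at y within Rn d)"
proof -
  have "((\<lambda>y. \<phi> (x, y)) has_derivative (\<lambda>v. inner (grad p d \<phi> (x, y)) (0, v))) (at y within Rn d)"
  proof (rule has_derivative_in_compose[where f = "\<lambda>y. (x, y)" and f' = "\<lambda>v. (0, v)"])
    show "(Pair x has_derivative Pair 0) (at y within Rn d)"
      by (auto intro!: derivative_eq_intros)
    show "(\<phi> has_derivative inner (grad p d \<phi> (x, y))) (at (x, y) within Pair x ` Rn d)"
      using assms by (intro has_derivative_subset[OF grad_props(2)]) auto
  qed
  then show ?thesis by (simp add: inner_prod_def grad_y_def)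
qed

end

text \<open>The Lipschitz bounds in operator norm are stated as applied to vectors; in this form
  they pass to averages by the triangle inequality.\<close>

locale lower_function = smooth_function +
  fixes \<mu> L\<^sub>x\<^sub>y L\<^sub>y\<^sub>y :: real
  assumes \<mu>_pos: "0 < \<mu>"
    and strongly_convex: "x \<in> Rn p \<Longrightarrow> strongly_convex_on (Rn d) \<mu> (\<lambda>y. \<phi> (x, y))"
    and grad_differentiable: "z \<in> Rn p \<times> Rn d \<Longrightarrow>
      grad p d \<phi> differentiable (at z within Rn p \<times> Rn d)"
    and hess_xy_lipschitz: "z \<in> Rn p \<times> Rn d \<Longrightarrow> z' \<in> Rn p \<times> Rn d \<Longrightarrow> v \<in> Rn d \<Longrightarrow>
      norm (hess_xy p d \<phi> z v - hess_xy p d \<phi> z' v) \<le> L\<^sub>x\<^sub>y * norm (z - z') * norm v"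
    and hess_yy_lipschitz: "z \<in> Rn p \<times> Rn d \<Longrightarrow> z' \<in> Rn p \<times> Rn d \<Longrightarrow> v \<in> Rn d \<Longrightarrow>
      norm (hess_yy p d \<phi> z v - hess_yy p d \<phi> z' v) \<le> L\<^sub>y\<^sub>y * norm (z - z') * norm v"
begin

lemma hess_derivative:
  "z \<in> Rn p \<times> Rn d \<Longrightarrow> (grad p d \<phi> has_derivative hess p d \<phi> z) (at z within Rn p \<times> Rn d)"
  using grad_differentiable frechet_derivative_works
  unfolding hess_def hessian_on_def grad_def by blast

lemma hess_linear: "z \<in> Rn p \<times> Rn d \<Longrightarrow> linear (hess p d \<phi> z)"
  by (rule has_derivative_linear[OF hess_derivative])

lemma hess_in: "z \<in> Rn p \<times> Rn d \<Longrightarrow> v \<in> Rn p \<times> Rn d \<Longrightarrow> hess p d \<phi> z v \<in> Rn p \<times> Rn d"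
  by (rule has_derivative_within_in_subspace[OF hess_derivative subspace_Rn_Times _ _
        closed_Rn_Times subspace_Rn_Times grad_props(1)])

lemma hess_symmetric: "z \<in> Rn p \<times> Rn d \<Longrightarrow> v \<in> Rn p \<times> Rn d \<Longrightarrow> w \<in> Rn p \<times> Rn d \<Longrightarrow>
    inner (hess p d \<phi> z v) w = inner v (hess p d \<phi> z w)"
  by (rule hessian_symmetric[OF subspace_Rn_Times _ _ _ grad_props(2) hess_derivative])

lemma hess_bound:
  assumes "z \<in> Rn p \<times> Rn d" "v \<in> Rn p \<times> Rn d" "0 \<le> L"
  shows "norm (hess p d \<phi> z v) \<le> L * norm v"
  by (rule lipschitz_derivative_bound[OF hess_derivative subspace_Rn_Times _ _ lipschitz_onI])
    (use assms grad_lipschitz in \<open>auto simp: dist_norm\<close>)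

lemma hess_xy_linear: "z \<in> Rn p \<times> Rn d \<Longrightarrow> linear (hess_xy p d \<phi> z)"
  and hess_yy_linear: "z \<in> Rn p \<times> Rn d \<Longrightarrow> linear (hess_yy p d \<phi> z)"
proof -
  assume z: "z \<in> Rn p \<times> Rn d"
  have "linear (\<lambda>v :: rvec. (0 :: rvec, v))" by (auto intro!: linearI)
  then have l: "linear (\<lambda>v. hess p d \<phi> z (0, v))"
    using linear_compose[OF _ hess_linear[OF z]] by (auto simp: o_def)
  show "linear (hess_xy p d \<phi> z)" "linear (hess_yy p d \<phi> z)"
    using linear_compose[OF l bounded_linear.linear[OF bounded_linear_fst]]
      linear_compose[OF l bounded_linear.linear[OF bounded_linear_snd]]
    unfolding o_def hess_xy_def[abs_def] hess_yy_def[abs_def] by auto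
qed

lemma hess_xy_in: "z \<in> Rn p \<times> Rn d \<Longrightarrow> v \<in> Rn d \<Longrightarrow> hess_xy p d \<phi> z v \<in> Rn p"
  and hess_yy_in: "z \<in> Rn p \<times> Rn d \<Longrightarrow> v \<in> Rn d \<Longrightarrow> hess_yy p d \<phi> z v \<in> Rn d"
  using hess_in[of z "(0, v)"] by (auto simp: hess_xy_def hess_yy_def mem_Times_iff)

lemma hess_xy_bound: "z \<in> Rn p \<times> Rn d \<Longrightarrow> v \<in> Rn d \<Longrightarrow> 0 \<le> L \<Longrightarrow>
      norm (hess_xy p d \<phi> z v) \<le> L * norm v"
  and hess_yy_bound: "z \<in> Rn p \<times> Rn d \<Longrightarrow> v \<in> Rn d \<Longrightarrow> 0 \<le> L \<Longrightarrow>
      norm (hess_yy p d \<phi> z v) \<le> L * norm v"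
  using order_trans[OF norm_fst_le_norm hess_bound[of z "(0, v)"]]
    order_trans[OF norm_snd_le_norm hess_bound[of z "(0, v)"]]
  by (simp_all add: hess_xy_def hess_yy_def norm_Pair)

lemma hess_yy_symmetric: "z \<in> Rn p \<times> Rn d \<Longrightarrow> v \<in> Rn d \<Longrightarrow> w \<in> Rn d \<Longrightarrow>
    inner (hess_yy p d \<phi> z v) w = inner v (hess_yy p d \<phi> z w)"
  using hess_symmetric[of z "(0, v)" "(0, w)"] by (simp add: hess_yy_def inner_prod_def)

lemma grad_y_monotone:
  assumes "x \<in> Rn p" "y \<in> Rn d" "y' \<in> Rn d"
  shows "\<mu> * (norm (y - y'))\<^sup>2 \<le> inner (grad_y p d \<phi> (x, y) - grad_y p d \<phi> (x, y')) (y - y')"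
  by (rule strongly_convex_on_gradient_monotone[OF subspace_Rn assms(2,3) strongly_convex[OF assms(1)]
        has_derivative_snd[OF assms(1)]])

text \<open>Strong monotonicity of the \<open>y\<close>-gradient between \<open>y + t v\<close> and
  \<open>y\<close>, divided by the square of \<open>t\<close>, in the limit of small positive
  \<open>t\<close>.\<close>

lemma hess_yy_lower:
  assumes z: "z \<in> Rn p \<times> Rn d" and v: "v \<in> Rn d"
  shows "\<mu> * (norm v)\<^sup>2 \<le> inner (hess_yy p d \<phi> z v) v"
proof -
  have v': "(0, v) \<in> Rn p \<times> Rn d" using v by simp
  have lim: "((\<lambda>t. inner ((grad p d \<phi> (z + t *\<^sub>R (0, v)) - grad p d \<phi> z) /\<^sub>R t) (0, v))
      \<longlongrightarrow> inner (hess p d \<phi> z (0, v)) (0, v)) (at_right 0)"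
    by (intro tendsto_inner tendsto_const
        has_derivative_within_directional[OF hess_derivative[OF z] subspace_Rn_Times z v'])
  have "\<mu> * (norm v)\<^sup>2 \<le> inner (hess p d \<phi> z (0, v)) (0, v)"
  proof (rule tendsto_lowerbound[OF lim])
    show "\<forall>\<^sub>F t in at_right 0. \<mu> * (norm v)\<^sup>2
        \<le> inner ((grad p d \<phi> (z + t *\<^sub>R (0, v)) - grad p d \<phi> z) /\<^sub>R t) (0, v)"
      using eventually_at_right_less[of 0]
    proof eventually_elim
      case (elim t)
      obtain x y where xy: "z = (x, y)" "x \<in> Rn p" "y \<in> Rn d" using z by auto
      have "\<mu> * (norm (t *\<^sub>R v))\<^sup>2
          \<le> inner (grad_y p d \<phi> (x, y + t *\<^sub>R v) - grad_y p d \<phi> (x, y)) (t *\<^sub>R v)"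
        using grad_y_monotone[OF xy(2) subspace_add[OF subspace_Rn xy(3) subspace_scale[OF subspace_Rn v]] xy(3)]
        by simp
      then have "t * (t * (\<mu> * (norm v)\<^sup>2))
          \<le> t * inner (grad_y p d \<phi> (x, y + t *\<^sub>R v) - grad_y p d \<phi> (x, y)) v"
        by (simp add: power_mult_distrib power2_eq_square mult_ac)
      then have "t * (\<mu> * (norm v)\<^sup>2)
          \<le> inner (grad_y p d \<phi> (x, y + t *\<^sub>R v) - grad_y p d \<phi> (x, y)) v"
        using elim by (simp only: mult_le_cancel_left_pos)
      then have "\<mu> * (norm v)\<^sup>2
          \<le> inner (grad_y p d \<phi> (x, y + t *\<^sub>R v) - grad_y p d \<phi> (x, y)) v / t"
        using elim by (simp add: pos_le_divide_eq mult.commute)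
      then show ?case using elim
        by (simp add: xy(1) inner_prod_def grad_y_def divide_inverse mult.commute)
    qed
  qed simp
  then show ?thesis by (simp add: hess_yy_def inner_prod_def)
qed

end

locale upper_function = smooth_function +
  fixes C\<^sub>f :: real
  assumes grad_y_bounded: "z \<in> Rn p \<times> Rn d \<Longrightarrow> norm (grad_y p d \<phi> z) \<le> C\<^sub>f"

section \<open>From the assumptions on the datasets to the locales\<close>

lemma smooth_function_of_L_smooth_on:
  assumes "L_smooth_on (Rn p \<times> Rn d) L \<phi>"
  shows "smooth_function p d \<phi> L"
  using assms lipschitz_onD[of L "Rn p \<times> Rn d" "grad p d \<phi>"]
  by unfold_locales (auto simp: L_smooth_on_def grad_def dist_norm)

lemma upper_assms_D:
  assumes "upper_assms p d m f L C\<^sub>f" "i < m"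
  shows "upper_function p d (f i) L C\<^sub>f"
proof -
  interpret smooth_function p d "f i" L
    by (rule smooth_function_of_L_smooth_on) (use assms in \<open>simp add: upper_assms_def\<close>)
  show ?thesis using assms by unfold_locales (auto simp: upper_assms_def)
qed

lemma lower_assms_D:
  assumes g: "lower_assms p d n g L \<mu> L\<^sub>x\<^sub>y L\<^sub>y\<^sub>y" "j < n" "0 < \<mu>"
  shows "lower_function p d (g j) L \<mu> L\<^sub>x\<^sub>y L\<^sub>y\<^sub>y"
proof -
  interpret smooth_function p d "g j" L
    by (rule smooth_function_of_L_smooth_on) (use g in \<open>simp add: lower_assms_def\<close>)
  have bl: "bounded_linear (\<lambda>v. hess p d (g j) z (0, v))" if "z \<in> Rn p \<times> Rn d" for z
  proof -
    have "bounded_linear (hess p d (g j) z)"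
      using g that frechet_derivative_works
      unfolding lower_assms_def hess_def hessian_on_def grad_def
      by (blast intro: has_derivative_bounded_linear)
    moreover have "bounded_linear (\<lambda>v :: rvec. (0 :: rvec, v))"
      by (intro bounded_linear_Pair bounded_linear_zero bounded_linear_ident)
    ultimately show ?thesis by (rule bounded_linear_compose)
  qed
  have blx: "bounded_linear (\<lambda>v. hess_xy p d (g j) z v - hess_xy p d (g j) z' v)"
    and bly: "bounded_linear (\<lambda>v. hess_yy p d (g j) z v - hess_yy p d (g j) z' v)"
    if "z \<in> Rn p \<times> Rn d" "z' \<in> Rn p \<times> Rn d" for z z'
    unfolding hess_xy_def hess_yy_def
    by (intro bounded_linear_sub bounded_linear_compose[OF bounded_linear_fst]
        bounded_linear_compose[OF bounded_linear_snd] bl that)+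
  have onx: "onorm_on (Rn d) (\<lambda>v. hess_xy p d (g j) z v - hess_xy p d (g j) z' v) \<le> L\<^sub>x\<^sub>y * norm (z - z')"
    and ony: "onorm_on (Rn d) (\<lambda>v. hess_yy p d (g j) z v - hess_yy p d (g j) z' v) \<le> L\<^sub>y\<^sub>y * norm (z - z')"
    if "z \<in> Rn p \<times> Rn d" "z' \<in> Rn p \<times> Rn d" for z z'
    using g that unfolding lower_assms_def dist_norm by blast+
  show ?thesis
  proof
    fix z z' v assume z: "z \<in> Rn p \<times> Rn d" "z' \<in> Rn p \<times> Rn d" and v: "v \<in> Rn d"
    show "norm (hess_xy p d (g j) z v - hess_xy p d (g j) z' v) \<le> L\<^sub>x\<^sub>y * norm (z - z') * norm v"
      using onorm_onD[OF blx[OF z] v] mult_right_mono[OF onx[OF z] norm_ge_zero]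
      by (rule order_trans)
    show "norm (hess_yy p d (g j) z v - hess_yy p d (g j) z' v) \<le> L\<^sub>y\<^sub>y * norm (z - z') * norm v"
      using onorm_onD[OF bly[OF z] v] mult_right_mono[OF ony[OF z] norm_ge_zero]
      by (rule order_trans)
  qed (use g in \<open>auto simp: lower_assms_def\<close>)
qed

section \<open>Averages over a dataset\<close>

lemma norm_average_le:
  assumes "0 < n" "\<And>i. i < n \<Longrightarrow> norm (v i) \<le> c"
  shows "norm ((1 / real n) *\<^sub>R (\<Sum>i<n. v i)) \<le> c"
proof -
  have "norm (\<Sum>i<n. v i) \<le> real n * c"
    using sum_norm_bound[of "{..<n}" v c] assms(2) by simp
  then show ?thesis using assms(1) by (simp add: pos_divide_le_eq mult.commute)
qed

lemma avg_gradient: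
  assumes f: "\<And>i. i < m \<Longrightarrow> smooth_function p d (f i) L"
    and z: "z \<in> Rn p \<times> Rn d"
  shows "(avg m f has_derivative (\<lambda>v. inner ((1 / real m) *\<^sub>R (\<Sum>i<m. grad p d (f i) z)) v))
      (at z within Rn p \<times> Rn d)"
    and "grad p d (avg m f) z = (1 / real m) *\<^sub>R (\<Sum>i<m. grad p d (f i) z)"
proof -
  have "((\<lambda>z. (1 / real m) *\<^sub>R (\<Sum>i<m. f i z)) has_derivative
      (\<lambda>v. (1 / real m) *\<^sub>R (\<Sum>i<m. inner (grad p d (f i) z) v))) (at z within Rn p \<times> Rn d)"
    using f smooth_function.grad_props(2)[OF _ z]
    by (intro has_derivative_scaleR_right has_derivative_sum) blast
  then show D: "(avg m f has_derivative (\<lambda>v. inner ((1 / real m) *\<^sub>R (\<Sum>i<m. grad p d (f i) z)) v))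
      (at z within Rn p \<times> Rn d)"
    by (simp add: avg_def[abs_def] inner_sum_left)
  show "grad p d (avg m f) z = (1 / real m) *\<^sub>R (\<Sum>i<m. grad p d (f i) z)"
    unfolding grad_def
    by (rule gradient_on_eqI[OF subspace_Rn_Times z _ D[unfolded grad_def]])
      (use f smooth_function.grad_props(1)[OF _ z, unfolded grad_def] in
        \<open>blast intro: subspace_scale[OF subspace_Rn_Times] subspace_sum[OF subspace_Rn_Times]\<close>)
qed

lemma smooth_function_avg:
  assumes f: "\<And>i. i < m \<Longrightarrow> smooth_function p d (f i) L" and m: "0 < m"
  shows "smooth_function p d (avg m f) L"
proof
  fix z assume "z \<in> Rn p \<times> Rn d"
  then show "avg m f differentiable (at z within Rn p \<times> Rn d)"
    by (intro differentiableI[OF avg_gradient(1)[where L = L]] f)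
next
  fix z z' assume z: "z \<in> Rn p \<times> Rn d" "z' \<in> Rn p \<times> Rn d"
  have "grad p d (avg m f) z - grad p d (avg m f) z'
      = (1 / real m) *\<^sub>R (\<Sum>i<m. grad p d (f i) z - grad p d (f i) z')"
    by (simp add: avg_gradient(2)[OF f] z sum_subtractf scaleR_diff_right)
  then show "norm (grad p d (avg m f) z - grad p d (avg m f) z') \<le> L * norm (z - z')"
    using norm_average_le[OF m smooth_function.grad_lipschitz[OF f z]] by (simp only:)
qed

lemma upper_function_avg:
  assumes f: "\<And>i. i < m \<Longrightarrow> upper_function p d (f i) L C\<^sub>f" and m: "0 < m"
  shows "upper_function p d (avg m f) L C\<^sub>f"
proof -
  have sf: "\<And>i. i < m \<Longrightarrow> smooth_function p d (f i) L" using f upper_function.axioms(1) by blast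
  interpret smooth_function p d "avg m f" L by (rule smooth_function_avg[OF sf m])
  show ?thesis
  proof
    fix z assume z: "z \<in> Rn p \<times> Rn d"
    have "grad_y p d (avg m f) z = (1 / real m) *\<^sub>R (\<Sum>i<m. grad_y p d (f i) z)"
      by (simp add: grad_y_def avg_gradient(2)[OF sf z] snd_sum)
    then show "norm (grad_y p d (avg m f) z) \<le> C\<^sub>f"
      using norm_average_le[OF m upper_function.grad_y_bounded[OF f z]] by (simp only:)
  qed
qed

text \<open>The equation is restricted to vectors of the subspace because \<open>hess\<close> is a
  Frechet derivative within it and is undetermined in other directions.\<close>

lemma avg_hess:
  assumes g: "\<And>j. j < n \<Longrightarrow> lower_function p d (g j) L \<mu> L\<^sub>x\<^sub>y L\<^sub>y\<^sub>y"
    and z: "z \<in> Rn p \<times> Rn d"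
  shows "grad p d (avg n g) differentiable (at z within Rn p \<times> Rn d)"
    and "v \<in> Rn p \<times> Rn d \<Longrightarrow> hess p d (avg n g) z v = (1 / real n) *\<^sub>R (\<Sum>j<n. hess p d (g j) z v)"
proof -
  have sg: "\<And>j. j < n \<Longrightarrow> smooth_function p d (g j) L" using g lower_function.axioms(1) by blast
  have "((\<lambda>z. (1 / real n) *\<^sub>R (\<Sum>j<n. grad p d (g j) z)) has_derivative
      (\<lambda>v. (1 / real n) *\<^sub>R (\<Sum>j<n. hess p d (g j) z v))) (at z within Rn p \<times> Rn d)"
    using g lower_function.hess_derivative[OF _ z]
    by (intro has_derivative_scaleR_right has_derivative_sum) blast
  then have D: "(grad p d (avg n g) has_derivative
      (\<lambda>v. (1 / real n) *\<^sub>R (\<Sum>j<n. hess p d (g j) z v))) (at z within Rn p \<times> Rn d)"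
    by (rule has_derivative_transform[OF z, rotated]) (simp add: avg_gradient(2)[OF sg])
  then show diff: "grad p d (avg n g) differentiable (at z within Rn p \<times> Rn d)"
    unfolding differentiable_def by blast
  have D': "(grad p d (avg n g) has_derivative hess p d (avg n g) z) (at z within Rn p \<times> Rn d)"
    using diff frechet_derivative_works unfolding hess_def hessian_on_def grad_def by blast
  show "hess p d (avg n g) z v = (1 / real n) *\<^sub>R (\<Sum>j<n. hess p d (g j) z v)"
    if "v \<in> Rn p \<times> Rn d"
    by (rule has_derivative_within_unique[OF D' D subspace_Rn_Times z that])
qed

lemma strongly_convex_on_avg:
  assumes g: "\<And>j. j < n \<Longrightarrow> strongly_convex_on S \<mu> (g j)" and n: "0 < n"
  shows "strongly_convex_on S \<mu> (\<lambda>y. (\<Sum>j<n. g j y) / real n)"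
proof -
  have cvx: "convex S" using g[OF n] convex_on_imp_convex unfolding strongly_convex_on_def by blast
  have "convex_on S (\<lambda>y. \<Sum>j<k. (1 / real n) * (g j y - \<mu> / 2 * (norm y)\<^sup>2))" if "k \<le> n" for k
    using that
  proof (induction k)
    case 0
    then show ?case using cvx by (simp add: convex_on_def)
  next
    case (Suc k)
    then show ?case
      using g[of k] unfolding strongly_convex_on_def sum.lessThan_Suc
      by (intro convex_on_add convex_on_cmul) auto
  qed
  from this[OF order_refl]
  have "convex_on S (\<lambda>y. \<Sum>j<n. (1 / real n) * (g j y - \<mu> / 2 * (norm y)\<^sup>2))" .
  moreover have "(\<Sum>j<n. (1 / real n) * (g j y - \<mu> / 2 * (norm y)\<^sup>2))
      = (\<Sum>j<n. g j y) / real n - \<mu> / 2 * (norm y)\<^sup>2" for y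
    using n by (simp add: sum_subtractf sum_divide_distrib diff_divide_distrib)
  ultimately show ?thesis unfolding strongly_convex_on_def by simp
qed

lemma lower_function_avg:
  assumes g: "\<And>j. j < n \<Longrightarrow> lower_function p d (g j) L \<mu> L\<^sub>x\<^sub>y L\<^sub>y\<^sub>y" and n: "0 < n"
  shows "lower_function p d (avg n g) L \<mu> L\<^sub>x\<^sub>y L\<^sub>y\<^sub>y"
proof -
  have sg: "\<And>j. j < n \<Longrightarrow> smooth_function p d (g j) L" using g lower_function.axioms(1) by blast
  interpret smooth_function p d "avg n g" L by (rule smooth_function_avg[OF sg n])
  have xy: "hess_xy p d (avg n g) z v = (1 / real n) *\<^sub>R (\<Sum>j<n. hess_xy p d (g j) z v)"
    and yy: "hess_yy p d (avg n g) z v = (1 / real n) *\<^sub>R (\<Sum>j<n. hess_yy p d (g j) z v)"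
    if "z \<in> Rn p \<times> Rn d" "v \<in> Rn d" for z v
    using that by (simp_all add: hess_xy_def hess_yy_def avg_hess(2)[OF g] fst_sum snd_sum)
  show ?thesis
  proof
    show "0 < \<mu>" using lower_function.\<mu>_pos[OF g[OF n]] .
    show "strongly_convex_on (Rn d) \<mu> (\<lambda>y. avg n g (x, y))" if "x \<in> Rn p" for x
      unfolding avg_def
      by (rule strongly_convex_on_avg[OF lower_function.strongly_convex[OF g that] n])
    show "grad p d (avg n g) differentiable (at z within Rn p \<times> Rn d)" if "z \<in> Rn p \<times> Rn d" for z
      by (rule avg_hess(1)[OF g that])
    fix z z' v assume z: "z \<in> Rn p \<times> Rn d" "z' \<in> Rn p \<times> Rn d" and v: "v \<in> Rn d"
    have "hess_xy p d (avg n g) z v - hess_xy p d (avg n g) z' v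
        = (1 / real n) *\<^sub>R (\<Sum>j<n. hess_xy p d (g j) z v - hess_xy p d (g j) z' v)"
      "hess_yy p d (avg n g) z v - hess_yy p d (avg n g) z' v
        = (1 / real n) *\<^sub>R (\<Sum>j<n. hess_yy p d (g j) z v - hess_yy p d (g j) z' v)"
      using z v by (simp_all add: xy yy sum_subtractf scaleR_diff_right)
    then show "norm (hess_xy p d (avg n g) z v - hess_xy p d (avg n g) z' v)
        \<le> L\<^sub>x\<^sub>y * norm (z - z') * norm v"
      "norm (hess_yy p d (avg n g) z v - hess_yy p d (avg n g) z' v)
        \<le> L\<^sub>y\<^sub>y * norm (z - z') * norm v"
      using norm_average_le[OF n lower_function.hess_xy_lipschitz[OF g z v]]
        norm_average_le[OF n lower_function.hess_yy_lipschitz[OF g z v]] by (simp_all only:)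
  qed
qed

section \<open>The hypergradient\<close>

lemma strongly_monotone_inverse_bound:
  assumes "\<mu> * (norm v)\<^sup>2 \<le> inner w v" "0 < \<mu>"
  shows "norm v \<le> norm w / \<mu>"
proof (cases "v = 0")
  case True
  then show ?thesis using assms(2) by simp
next
  case False
  have "\<mu> * norm v * norm v \<le> norm w * norm v"
    using order_trans[OF assms(1) norm_cauchy_schwarz] by (simp add: power2_eq_square mult.assoc)
  then have "\<mu> * norm v \<le> norm w" using False by (simp add: mult_le_cancel_right)
  then show ?thesis using assms(2) by (simp add: pos_le_divide_eq mult.commute)
qed

text \<open>The five bounds on \<open>K\<close> serve, in this order, the Lipschitz constants of the
  update directions on the ball, the sampling error of a gradient plus that of a Hessian applied to
  \<open>u\<close>, and the Lipschitz constants of \<open>y_opt\<close>, of \<open>u_opt\<close> and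
  of the hypergradient. The locale is used both for the averaged problem and for every pair of
  components.\<close>

locale bilevel_problem =
  upper: upper_function p d F L C\<^sub>f + lower: lower_function p d G L \<mu> L\<^sub>x\<^sub>y L\<^sub>y\<^sub>y
  for p d :: nat and F G :: "rvec \<times> rvec \<Rightarrow> real" and L C\<^sub>f \<mu> L\<^sub>x\<^sub>y L\<^sub>y\<^sub>y :: real +
  fixes K :: real
  assumes pos: "0 < L" "0 < C\<^sub>f" "0 < L\<^sub>x\<^sub>y" "0 < L\<^sub>y\<^sub>y"
    and K_ge: "2 * L + L\<^sub>x\<^sub>y * (C\<^sub>f / \<mu>) + L\<^sub>y\<^sub>y * (C\<^sub>f / \<mu>) \<le> K" "1 + C\<^sub>f / \<mu> \<le> K" "L / \<mu> \<le> K"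
      "(L + L\<^sub>y\<^sub>y * (C\<^sub>f / \<mu>)) * (1 + L / \<mu>) / \<mu> \<le> K"
      "(L + L\<^sub>x\<^sub>y * (C\<^sub>f / \<mu>)) * (1 + L / \<mu>) + L * ((L + L\<^sub>y\<^sub>y * (C\<^sub>f / \<mu>)) * (1 + L / \<mu>) / \<mu>) \<le> K"
begin

abbreviation "\<iota> \<equiv> C\<^sub>f / \<mu>"
abbreviation "yx \<equiv> y_opt d G"
abbreviation "ux \<equiv> u_opt p d F G"
abbreviation "h \<equiv> hyper_obj d F G"

lemma \<iota>_pos: "0 < \<iota>"
  using pos lower.\<mu>_pos by simp

lemma K_bounds: "1 \<le> K" "L \<le> K" "L + L\<^sub>x\<^sub>y * \<iota> \<le> K" "L + L\<^sub>y\<^sub>y * \<iota> \<le> K"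
proof -
  have "0 < L\<^sub>x\<^sub>y * \<iota>" "0 < L\<^sub>y\<^sub>y * \<iota>" by (intro mult_pos_pos pos \<iota>_pos)+
  then show "1 \<le> K" "L \<le> K" "L + L\<^sub>x\<^sub>y * \<iota> \<le> K" "L + L\<^sub>y\<^sub>y * \<iota> \<le> K"
    using K_ge(1,2) \<iota>_pos pos(1) by linarith+
qed

lemma coeff_nonneg: "0 \<le> L + L\<^sub>x\<^sub>y * \<iota>" "0 \<le> L + L\<^sub>y\<^sub>y * \<iota>"
  by (intro add_nonneg_nonneg mult_nonneg_nonneg less_imp_le pos \<iota>_pos)+

text \<open>A zero of the gradient exists by the fixed point argument. Strong convexity gives
  quadratic growth around it, so it is the only minimiser and the choice in
  \<open>arg_min_on\<close> must return it.\<close>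

lemma y_opt_in: "x \<in> Rn p \<Longrightarrow> yx x \<in> Rn d"
  and grad_y_y_opt: "x \<in> Rn p \<Longrightarrow> grad_y p d G (x, yx x) = 0"
proof -
  assume x: "x \<in> Rn p"
  obtain y0 where y0: "y0 \<in> Rn d" "grad_y p d G (x, y0) = 0"
  proof (rule strongly_monotone_zero_exists[OF subspace_Rn complete_Rn,
        where N = "\<lambda>y. grad_y p d G (x, y)" and \<mu> = \<mu> and L = L])
    show "grad_y p d G (x, y) \<in> Rn d" if "y \<in> Rn d" for y
      using lower.grad_y_in x that by simp
    show "\<mu> * (norm (y - y'))\<^sup>2 \<le> inner (grad_y p d G (x, y) - grad_y p d G (x, y')) (y - y')"
      if "y \<in> Rn d" "y' \<in> Rn d" for y y'
      by (rule lower.grad_y_monotone[OF x that])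
    show "norm (grad_y p d G (x, y) - grad_y p d G (x, y')) \<le> L * norm (y - y')"
      if "y \<in> Rn d" "y' \<in> Rn d" for y y'
      using lower.grad_y_lipschitz[of "(x, y)" "(x, y')"] x that by (simp add: norm_Pair)
    show "0 < \<mu>" by (rule lower.\<mu>_pos)
  qed
  have growth: "G (x, y0) + \<mu> / 2 * (norm (y - y0))\<^sup>2 \<le> G (x, y)" if "y \<in> Rn d" for y
    using strongly_convex_on_above_tangent[OF subspace_Rn y0(1) that lower.strongly_convex[OF x]
        lower.has_derivative_snd[OF x y0(1)]] y0(2) by simp
  have le: "G (x, y0) \<le> G (x, y)" if "y \<in> Rn d" for y
  proof -
    have "0 \<le> \<mu> / 2 * (norm (y - y0))\<^sup>2" using lower.\<mu>_pos by simp
    then show ?thesis using growth[OF that] by linarith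
  qed
  have "yx x = y0"
    unfolding y_opt_def arg_min_on_def arg_min_def
  proof (rule some_equality)
    show "is_arg_min (\<lambda>y. G (x, y)) (\<lambda>y. y \<in> Rn d) y0"
      unfolding is_arg_min_linorder using y0(1) le by blast
  next
    fix y assume "is_arg_min (\<lambda>y. G (x, y)) (\<lambda>y. y \<in> Rn d) y"
    then have y: "y \<in> Rn d" "G (x, y) \<le> G (x, y0)"
      unfolding is_arg_min_linorder using y0(1) by blast+
    have "\<mu> / 2 * (norm (y - y0))\<^sup>2 \<le> 0" using growth[OF y(1)] y(2) by linarith
    then show "y = y0" using lower.\<mu>_pos by (simp add: mult_le_0_iff)
  qed
  then show "yx x \<in> Rn d" "grad_y p d G (x, yx x) = 0" using y0 by simp_all
qed

lemma graph_in: "x \<in> Rn p \<Longrightarrow> (x, yx x) \<in> Rn p \<times> Rn d"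
  using y_opt_in by simp

text \<open>Strong monotonicity at \<open>x'\<close> between \<open>yx x\<close> and
  \<open>yx x'\<close>: the gradient at \<open>(x', yx x)\<close> is small because the one at
  \<open>(x, yx x)\<close> is zero.\<close>

lemma y_opt_lipschitz:
  assumes x: "x \<in> Rn p" "x' \<in> Rn p"
  shows "norm (yx x - yx x') \<le> L / \<mu> * norm (x - x')"
proof -
  define w where "w = grad_y p d G (x', yx x) - grad_y p d G (x, yx x)"
  have "\<mu> * (norm (yx x - yx x'))\<^sup>2 \<le> inner w (yx x - yx x')"
    using lower.grad_y_monotone[OF x(2) y_opt_in[OF x(1)] y_opt_in[OF x(2)]]
      grad_y_y_opt[OF x(1)] grad_y_y_opt[OF x(2)] by (simp add: w_def)
  then have "norm (yx x - yx x') \<le> norm w / \<mu>"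
    by (rule strongly_monotone_inverse_bound[OF _ lower.\<mu>_pos])
  also have "\<dots> \<le> L * norm (x - x') / \<mu>"
    using lower.grad_y_lipschitz[of "(x', yx x)" "(x, yx x)"] x y_opt_in[OF x(1)] lower.\<mu>_pos
    by (intro divide_right_mono) (simp_all add: w_def norm_Pair norm_minus_commute)
  finally show ?thesis by simp
qed

lemma graph_lipschitz:
  assumes "x \<in> Rn p" "x' \<in> Rn p"
  shows "norm ((x, yx x) - (x', yx x')) \<le> (1 + L / \<mu>) * norm (x - x')"
  using norm_Pair_le[of "x - x'" "yx x - yx x'"] y_opt_lipschitz[OF assms]
  by (simp add: distrib_right)

text \<open>Whichever preimage \<open>inv_into\<close> returns solves the linear system, so it is
  enough to show that the right-hand side is attained on \<open>Rn d\<close>.\<close>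

lemma u_opt_in: "x \<in> Rn p \<Longrightarrow> ux x \<in> Rn d"
  and hess_yy_u_opt: "x \<in> Rn p \<Longrightarrow> hess_yy p d G (x, yx x) (ux x) = grad_y p d F (x, yx x)"
proof -
  assume x: "x \<in> Rn p"
  note z = graph_in[OF x]
  let ?H = "hess_yy p d G (x, yx x)" and ?b = "grad_y p d F (x, yx x)"
  note lin = lower.hess_yy_linear[OF z]
  obtain v where v: "v \<in> Rn d" "?H v - ?b = 0"
  proof (rule strongly_monotone_zero_exists[OF subspace_Rn complete_Rn,
        where N = "\<lambda>v. ?H v - ?b" and \<mu> = \<mu> and L = L])
    show "?H v - ?b \<in> Rn d" if "v \<in> Rn d" for v
      using lower.hess_yy_in[OF z that] upper.grad_y_in[OF z] by (rule subspace_diff[OF subspace_Rn])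
    fix v v' assume v: "v \<in> Rn d" "v' \<in> Rn d"
    have vv: "v - v' \<in> Rn d" by (rule subspace_diff[OF subspace_Rn v])
    show "\<mu> * (norm (v - v'))\<^sup>2 \<le> inner (?H v - ?b - (?H v' - ?b)) (v - v')"
      using lower.hess_yy_lower[OF z vv] by (simp add: linear_diff[OF lin])
    show "norm (?H v - ?b - (?H v' - ?b)) \<le> L * norm (v - v')"
      using lower.hess_yy_bound[OF z vv] pos(1) by (simp add: linear_diff[OF lin])
  next
    show "0 < \<mu>" by (rule lower.\<mu>_pos)
  qed
  then have b: "?b \<in> ?H ` Rn d" by force
  show "ux x \<in> Rn d" "?H (ux x) = ?b"
    unfolding u_opt_def using inv_into_into[OF b] f_inv_into_f[OF b] by simp_all
qed

lemma u_opt_bound: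
  assumes x: "x \<in> Rn p"
  shows "norm (ux x) \<le> \<iota>"
proof -
  have "norm (ux x) \<le> norm (grad_y p d F (x, yx x)) / \<mu>"
    using lower.hess_yy_lower[OF graph_in[OF x] u_opt_in[OF x]] hess_yy_u_opt[OF x]
    by (intro strongly_monotone_inverse_bound lower.\<mu>_pos) simp
  also have "\<dots> \<le> \<iota>"
    using upper.grad_y_bounded[OF graph_in[OF x]] lower.\<mu>_pos by (simp add: divide_right_mono)
  finally show ?thesis .
qed

text \<open>Changing the vector first and the matrix afterwards, the change of matrix meets only
  \<open>u'\<close>; therefore just one of the two vectors has to lie in the ball.\<close>

lemma hess_product_lipschitz:
  assumes z: "z \<in> Rn p \<times> Rn d" "z' \<in> Rn p \<times> Rn d" and u: "u \<in> Rn d" "u' \<in> Rn d" "norm u' \<le> \<iota>"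
  shows "norm (hess_xy p d G z u - hess_xy p d G z' u') \<le> L * norm (u - u') + L\<^sub>x\<^sub>y * \<iota> * norm (z - z')"
    and "norm (hess_yy p d G z u - hess_yy p d G z' u') \<le> L * norm (u - u') + L\<^sub>y\<^sub>y * \<iota> * norm (z - z')"
proof -
  have uu: "u - u' \<in> Rn d" by (rule subspace_diff[OF subspace_Rn u(1,2)])
  have m: "c * norm (z - z') * norm u' \<le> c * \<iota> * norm (z - z')" if "0 < c" for c
    using mult_left_mono[OF u(3), of "c * norm (z - z')"] that by (simp add: mult_ac)
  have eq: "hess_xy p d G z u - hess_xy p d G z' u'
      = hess_xy p d G z (u - u') + (hess_xy p d G z u' - hess_xy p d G z' u')"
    by (simp add: linear_diff[OF lower.hess_xy_linear[OF z(1)]])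
  show "norm (hess_xy p d G z u - hess_xy p d G z' u')
      \<le> L * norm (u - u') + L\<^sub>x\<^sub>y * \<iota> * norm (z - z')"
    unfolding eq
    using norm_triangle_ineq[of "hess_xy p d G z (u - u')" "hess_xy p d G z u' - hess_xy p d G z' u'"]
      lower.hess_xy_bound[OF z(1) uu less_imp_le[OF pos(1)]] lower.hess_xy_lipschitz[OF z u(2)]
      m[OF pos(3)] by linarith
  have eq: "hess_yy p d G z u - hess_yy p d G z' u'
      = hess_yy p d G z (u - u') + (hess_yy p d G z u' - hess_yy p d G z' u')"
    by (simp add: linear_diff[OF lower.hess_yy_linear[OF z(1)]])
  show "norm (hess_yy p d G z u - hess_yy p d G z' u')
      \<le> L * norm (u - u') + L\<^sub>y\<^sub>y * \<iota> * norm (z - z')"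
    unfolding eq
    using norm_triangle_ineq[of "hess_yy p d G z (u - u')" "hess_yy p d G z u' - hess_yy p d G z' u'"]
      lower.hess_yy_bound[OF z(1) uu less_imp_le[OF pos(1)]] lower.hess_yy_lipschitz[OF z u(2)]
      m[OF pos(4)] by linarith
qed

lemma u_opt_lipschitz:
  assumes x: "x \<in> Rn p" "x' \<in> Rn p"
  shows "norm (ux x - ux x') \<le> (L + L\<^sub>y\<^sub>y * \<iota>) * (1 + L / \<mu>) / \<mu> * norm (x - x')"
proof -
  let ?z = "(x, yx x)" and ?z' = "(x', yx x')"
  note z = graph_in[OF x(1)] graph_in[OF x(2)]
  note u = u_opt_in[OF x(1)] u_opt_in[OF x(2)]
  have uu: "ux x - ux x' \<in> Rn d" by (rule subspace_diff[OF subspace_Rn u])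
  let ?w = "hess_yy p d G ?z (ux x - ux x')"
  \<comment> \<open>Difference of the linear systems for \<open>ux x\<close> and
    \<open>ux x'\<close>; the change of matrix is applied to \<open>ux x'\<close>, which lies in the
    ball.\<close>
  have w: "?w = (grad_y p d F ?z - grad_y p d F ?z')
      - (hess_yy p d G ?z (ux x') - hess_yy p d G ?z' (ux x'))"
    by (simp add: linear_diff[OF lower.hess_yy_linear[OF z(1)]] hess_yy_u_opt x)
  have "norm ?w \<le> L * norm (?z - ?z') + L\<^sub>y\<^sub>y * \<iota> * norm (?z - ?z')"
    unfolding w
    using norm_triangle_ineq4[of "grad_y p d F ?z - grad_y p d F ?z'"
        "hess_yy p d G ?z (ux x') - hess_yy p d G ?z' (ux x')"]
      upper.grad_y_lipschitz[OF z] hess_product_lipschitz(2)[OF z u(2) u(2) u_opt_bound[OF x(2)]]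
    by simp
  also have "\<dots> = (L + L\<^sub>y\<^sub>y * \<iota>) * norm (?z - ?z')" by (simp only: distrib_right)
  also have "\<dots> \<le> (L + L\<^sub>y\<^sub>y * \<iota>) * ((1 + L / \<mu>) * norm (x - x'))"
    by (intro mult_left_mono graph_lipschitz x coeff_nonneg)
  finally have "norm ?w \<le> (L + L\<^sub>y\<^sub>y * \<iota>) * ((1 + L / \<mu>) * norm (x - x'))" .
  then have "norm ?w / \<mu> \<le> (L + L\<^sub>y\<^sub>y * \<iota>) * ((1 + L / \<mu>) * norm (x - x')) / \<mu>"
    using lower.\<mu>_pos by (simp only: divide_right_mono less_imp_le)
  moreover have "norm (ux x - ux x') \<le> norm ?w / \<mu>"
    by (rule strongly_monotone_inverse_bound[OF lower.hess_yy_lower[OF z(1) uu] lower.\<mu>_pos])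
  ultimately show ?thesis by (simp add: mult_ac)
qed

definition hypergrad :: "rvec \<Rightarrow> rvec"
  where "hypergrad x = grad_x p d F (x, yx x) - hess_xy p d G (x, yx x) (ux x)"

lemma hypergrad_in: "x \<in> Rn p \<Longrightarrow> hypergrad x \<in> Rn p"
  unfolding hypergrad_def
  by (intro subspace_diff[OF subspace_Rn] upper.grad_x_in lower.hess_xy_in graph_in u_opt_in)

lemma hypergrad_lipschitz:
  assumes x: "x \<in> Rn p" "x' \<in> Rn p"
  shows "norm (hypergrad x - hypergrad x') \<le> K * norm (x - x')"
proof -
  let ?z = "(x, yx x)" and ?z' = "(x', yx x')"
  note z = graph_in[OF x(1)] graph_in[OF x(2)]
  note u = u_opt_in[OF x(1)] u_opt_in[OF x(2)]
  have "norm (hypergrad x - hypergrad x')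
      \<le> norm (grad_x p d F ?z - grad_x p d F ?z')
        + norm (hess_xy p d G ?z (ux x) - hess_xy p d G ?z' (ux x'))"
    using norm_triangle_ineq4[of "grad_x p d F ?z - grad_x p d F ?z'"
        "hess_xy p d G ?z (ux x) - hess_xy p d G ?z' (ux x')"]
    by (simp add: hypergrad_def algebra_simps)
  also have "\<dots> \<le> L * norm (?z - ?z') + (L * norm (ux x - ux x') + L\<^sub>x\<^sub>y * \<iota> * norm (?z - ?z'))"
    by (intro add_mono upper.grad_x_lipschitz z hess_product_lipschitz(1) u u_opt_bound x)
  also have "\<dots> = (L + L\<^sub>x\<^sub>y * \<iota>) * norm (?z - ?z') + L * norm (ux x - ux x')"
    by (simp only: distrib_right add_ac)
  also have "\<dots> \<le> (L + L\<^sub>x\<^sub>y * \<iota>) * ((1 + L / \<mu>) * norm (x - x'))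
      + L * ((L + L\<^sub>y\<^sub>y * \<iota>) * (1 + L / \<mu>) / \<mu> * norm (x - x'))"
    by (intro add_mono mult_left_mono graph_lipschitz u_opt_lipschitz x coeff_nonneg
        less_imp_le[OF pos(1)])
  also have "\<dots> = ((L + L\<^sub>x\<^sub>y * \<iota>) * (1 + L / \<mu>)
      + L * ((L + L\<^sub>y\<^sub>y * \<iota>) * (1 + L / \<mu>) / \<mu>)) * norm (x - x')"
    by (simp only: distrib_right mult.assoc)
  also have "\<dots> \<le> K * norm (x - x')" by (intro mult_right_mono K_ge) simp
  finally show ?thesis .
qed

lemma y_opt_K_lipschitz: "x \<in> Rn p \<Longrightarrow> x' \<in> Rn p \<Longrightarrow> norm (yx x - yx x') \<le> K * norm (x - x')"
  using order_trans[OF y_opt_lipschitz mult_right_mono[OF K_ge(3)]] by simp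

lemma u_opt_K_lipschitz: "x \<in> Rn p \<Longrightarrow> x' \<in> Rn p \<Longrightarrow> norm (ux x - ux x') \<le> K * norm (x - x')"
  using order_trans[OF u_opt_lipschitz mult_right_mono[OF K_ge(4)]] by simp

text \<open>
  No implicit function theorem is needed.  With \<open>u = u\<^sub>x\<close> fixed, \<open>h\<close> is the composition of the
  Lipschitz map \<open>x' \<mapsto> (x', y\<^sub>x\<^sub>')\<close> with \<open>\<Psi> z = F z - \<langle>\<nabla>\<^sub>y G z, u\<rangle>\<close>, because \<open>\<nabla>\<^sub>y G\<close> vanishes on
  the graph, and the choice of \<open>u\<close> makes the \<open>y\<close>-derivative of \<open>\<Psi>\<close> at \<open>(x, y\<^sub>x)\<close> vanish.
\<close>

lemma hyper_obj_has_derivative: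
  assumes x: "x \<in> Rn p"
  shows "(h has_derivative (\<lambda>v. inner (hypergrad x) v)) (at x within Rn p)"
proof -
  let ?S = "Rn p \<times> Rn d"
  define u where "u = ux x"
  define z where "z = (x, yx x)"
  define \<Psi> where "\<Psi> z = F z - inner (grad p d G z) (0, u)" for z
  have z: "z \<in> ?S" and u: "(0, u) \<in> ?S"
    using graph_in[OF x] u_opt_in[OF x] by (simp_all add: z_def u_def)
  have "(\<Psi> has_derivative (\<lambda>v. inner (grad p d F z) v - inner (hess p d G z v) (0, u))) (at z within ?S)"
    unfolding \<Psi>_def
    by (intro has_derivative_diff has_derivative_inner_left upper.grad_props lower.hess_derivative z)
  then have "(\<Psi> has_derivative (\<lambda>v. inner (hypergrad x, 0) v)) (at z within ?S)"
  proof (rule has_derivative_within_subspace_cong[OF _ subspace_Rn_Times z bounded_linear_inner_right])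
    fix v assume v: "v \<in> ?S"
    \<comment> \<open>Symmetry moves the second derivative onto \<open>(0, u)\<close>. Its first
      component is then the \<open>hess_xy\<close> product, and its second cancels the
      \<open>y\<close>-gradient of \<open>F\<close> by the equation for \<open>ux x\<close>.\<close>
    have "inner (hess p d G z v) (0, u) = inner (hess p d G z (0, u)) v"
      using lower.hess_symmetric[OF z v u] by (simp add: inner_commute)
    moreover have "grad p d F z - hess p d G z (0, u) = (hypergrad x, 0)"
      using hess_yy_u_opt[OF x]
      by (simp add: prod_eq_iff z_def u_def hypergrad_def grad_x_def grad_y_def hess_xy_def hess_yy_def)
    ultimately show "inner (grad p d F z) v - inner (hess p d G z v) (0, u) = inner (hypergrad x, 0) v"
      by (simp only: inner_diff_left[symmetric])
  qed
  then have \<Psi>: "\<And>e. 0 < e \<Longrightarrow> \<exists>\<delta>>0. \<forall>w\<in>?S. norm (w - z) < \<delta> \<longrightarrow>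
      norm (\<Psi> w - \<Psi> z - inner (hypergrad x, 0) (w - z)) \<le> e * norm (w - z)"
    unfolding has_derivative_within_alt by blast
  have h\<Psi>: "h x' = \<Psi> (x', yx x')" if "x' \<in> Rn p" for x'
    using grad_y_y_opt[OF that] by (simp add: \<Psi>_def hyper_obj_def inner_prod_def grad_y_def)
  define \<kappa> where "\<kappa> = 1 + L / \<mu>"
  have \<kappa>: "0 < \<kappa>" using pos lower.\<mu>_pos by (simp add: \<kappa>_def add_pos_pos)
  show ?thesis
    unfolding has_derivative_within_alt
  proof (intro conjI bounded_linear_inner_right allI impI)
    fix e :: real assume e: "0 < e"
    \<comment> \<open>The tolerance is divided by \<kappa> because distances on the graph may exceed
      those of the base points by this factor.\<close>
    obtain \<delta> where \<delta>: "0 < \<delta>" "\<And>w. w \<in> ?S \<Longrightarrow> norm (w - z) < \<delta> \<Longrightarrow>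
        norm (\<Psi> w - \<Psi> z - inner (hypergrad x, 0) (w - z)) \<le> e / \<kappa> * norm (w - z)"
      using \<Psi>[of "e / \<kappa>"] e \<kappa> by auto
    show "\<exists>\<delta>>0. \<forall>x'\<in>Rn p. norm (x' - x) < \<delta> \<longrightarrow>
        norm (h x' - h x - inner (hypergrad x) (x' - x)) \<le> e * norm (x' - x)"
    proof (intro exI[of _ "\<delta> / \<kappa>"] conjI ballI impI)
      show "0 < \<delta> / \<kappa>" using \<delta>(1) \<kappa> by simp
      fix x' assume x': "x' \<in> Rn p" "norm (x' - x) < \<delta> / \<kappa>"
      let ?w = "(x', yx x')"
      have lip: "norm (?w - z) \<le> \<kappa> * norm (x' - x)"
        unfolding z_def \<kappa>_def by (rule graph_lipschitz[OF x'(1) x])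
      have "\<kappa> * norm (x' - x) < \<delta>" using x'(2) \<kappa> by (simp add: pos_less_divide_eq mult.commute)
      then have "norm (\<Psi> ?w - \<Psi> z - inner (hypergrad x, 0) (?w - z)) \<le> e / \<kappa> * norm (?w - z)"
        using lip by (intro \<delta>(2) graph_in x'(1)) simp
      also have "\<dots> \<le> e / \<kappa> * (\<kappa> * norm (x' - x))"
        using e \<kappa> by (intro mult_left_mono lip) simp
      also have "\<dots> = e * norm (x' - x)" using \<kappa> by simp
      finally show "norm (h x' - h x - inner (hypergrad x) (x' - x)) \<le> e * norm (x' - x)"
        by (simp add: h\<Psi>[OF x'(1)] h\<Psi>[OF x] z_def)
    qed
  qed
qed

lemma gradient_hyper_obj: "x \<in> Rn p \<Longrightarrow> gradient_on (Rn p) h x = hypergrad x"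
  by (rule gradient_on_eqI[OF subspace_Rn _ hypergrad_in hyper_obj_has_derivative])

text \<open>Proved by the mean value theorem instead of an integral, which gives the coefficient
  \<open>K\<close> where integration would give \<open>K / 2\<close>; only the constants feel
  this.\<close>

lemma hyper_obj_descent:
  assumes x: "x \<in> Rn p" "x' \<in> Rn p"
  shows "h x' \<le> h x + inner (hypergrad x) (x' - x) + K * (norm (x' - x))\<^sup>2"
proof -
  define v where "v = x' - x"
  have v: "v \<in> Rn p" unfolding v_def by (rule subspace_diff[OF subspace_Rn x(2,1)])
  obtain \<theta> where \<theta>: "0 \<le> \<theta>" "\<theta> \<le> 1" and eq: "h (x + v) - h x = inner (hypergrad (x + \<theta> *\<^sub>R v)) v"
    by (rule mvt_along_segment[OF subspace_Rn x(1) v hyper_obj_has_derivative])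
  have "x + \<theta> *\<^sub>R v \<in> Rn p" by (intro subspace_add[OF subspace_Rn] subspace_scale[OF subspace_Rn] x v)
  from hypergrad_lipschitz[OF this x(1)]
  have "norm (hypergrad (x + \<theta> *\<^sub>R v) - hypergrad x) \<le> K * (\<theta> * norm v)" using \<theta> by simp
  also have "\<dots> \<le> K * norm v"
    using \<theta> K_bounds(1) mult_right_mono[OF \<theta>(2), of "norm v"] by (intro mult_left_mono) simp_all
  finally have "norm (hypergrad (x + \<theta> *\<^sub>R v) - hypergrad x) * norm v \<le> K * norm v * norm v"
    by (rule mult_right_mono) simp
  then have "inner (hypergrad (x + \<theta> *\<^sub>R v) - hypergrad x) v \<le> K * (norm v)\<^sup>2"
    using norm_cauchy_schwarz[of "hypergrad (x + \<theta> *\<^sub>R v) - hypergrad x" v]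
    by (simp add: power2_eq_square mult.assoc)
  then show ?thesis using eq by (simp add: v_def inner_diff_left)
qed

text \<open>A gradient step of length \<open>1 / (2 * K)\<close> lowers \<open>h\<close> by
  \<open>(norm (hypergrad x))\<^sup>2 / (4 * K)\<close>, yet cannot pass below the infimum.\<close>

lemma hypergrad_bound_by_gap:
  assumes x: "x \<in> Rn p" and bdd: "bdd_below (h ` Rn p)"
  shows "(norm (hypergrad x))\<^sup>2 \<le> 4 * K * (h x - (INF x \<in> Rn p. h x))"
proof -
  define w where "w = hypergrad x"
  have K: "0 < K" using K_bounds(1) by simp
  define x' where "x' = x - (1 / (2 * K)) *\<^sub>R w"
  have x': "x' \<in> Rn p"
    unfolding x'_def w_def
    by (intro subspace_diff[OF subspace_Rn] subspace_scale[OF subspace_Rn] x hypergrad_in)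
  have "(INF x \<in> Rn p. h x) \<le> h x'" by (rule cINF_lower[OF bdd x'])
  also have "\<dots> \<le> h x + inner w (x' - x) + K * (norm (x' - x))\<^sup>2"
    unfolding w_def by (rule hyper_obj_descent[OF x x'])
  also have "\<dots> = h x - (norm w)\<^sup>2 / (4 * K)"
  proof -
    have *: "inner w (x' - x) = - ((norm w)\<^sup>2 / (2 * K))" "norm (x' - x) = norm w / (2 * K)"
      using K by (simp_all add: x'_def power2_norm_eq_inner)
    show ?thesis unfolding * using K by (simp add: field_simps power2_eq_square)
  qed
  finally have "(norm w)\<^sup>2 / (4 * K) \<le> h x - (INF x \<in> Rn p. h x)" by simp
  then show ?thesis using K by (simp add: w_def pos_divide_le_eq mult.commute)
qed

section \<open>Directions and steps at a fixed state\<close>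

context
  fixes x y u :: rvec
  assumes xyu: "x \<in> Rn p" "y \<in> Rn d" "u \<in> Rn d"
begin

abbreviation "e_y \<equiv> norm (y - yx x)"
abbreviation "e_u \<equiv> norm (u - ux x)"

lemma dist_to_graph: "norm ((x, y) - (x, yx x)) = e_y"
  by (simp add: norm_Pair)

lemma z_in: "(x, y) \<in> Rn p \<times> Rn d"
  using xyu by simp

lemma x_direction_error:
  "norm (grad_x p d F (x, y) - hess_xy p d G (x, y) u - hypergrad x) \<le> K * (e_y + e_u)"
proof -
  let ?z = "(x, y)" and ?z' = "(x, yx x)"
  have "norm (grad_x p d F ?z - hess_xy p d G ?z u - hypergrad x)
      \<le> norm (grad_x p d F ?z - grad_x p d F ?z')
        + norm (hess_xy p d G ?z u - hess_xy p d G ?z' (ux x))"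
    using norm_triangle_ineq4[of "grad_x p d F ?z - grad_x p d F ?z'"
        "hess_xy p d G ?z u - hess_xy p d G ?z' (ux x)"]
    by (simp add: hypergrad_def algebra_simps)
  also have "\<dots> \<le> L * norm (?z - ?z') + (L * e_u + L\<^sub>x\<^sub>y * \<iota> * norm (?z - ?z'))"
    by (intro add_mono upper.grad_x_lipschitz z_in graph_in hess_product_lipschitz(1) u_opt_in u_opt_bound xyu)
  also have "\<dots> = (L + L\<^sub>x\<^sub>y * \<iota>) * e_y + L * e_u" by (simp only: dist_to_graph distrib_right add_ac)
  also have "\<dots> \<le> K * e_y + K * e_u" by (intro add_mono mult_right_mono K_bounds) simp_all
  finally show ?thesis by (simp only: distrib_left)
qed

lemma y_direction_bound: "norm (grad_y p d G (x, y)) \<le> K * e_y"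
proof -
  have "norm (grad_y p d G (x, y)) \<le> L * e_y"
    using lower.grad_y_lipschitz[OF z_in graph_in[OF xyu(1)]]
    by (simp only: dist_to_graph grad_y_y_opt[OF xyu(1)] diff_zero)
  also have "\<dots> \<le> K * e_y" by (intro mult_right_mono K_bounds) simp
  finally show ?thesis .
qed

text \<open>The residual vanishes at \<open>y = yx x\<close>, so the error of \<open>y\<close> is
  its only source. This is the coupling through which \<open>y\<close> disturbs the tracking of
  \<open>u\<close>.\<close>

lemma u_residual_at_u_opt:
  "norm (hess_yy p d G (x, y) (ux x) - grad_y p d F (x, y)) \<le> K * e_y"
proof -
  let ?z = "(x, y)" and ?z' = "(x, yx x)"
  have "norm (hess_yy p d G ?z (ux x) - grad_y p d F ?z)
      \<le> norm (hess_yy p d G ?z (ux x) - hess_yy p d G ?z' (ux x))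
        + norm (grad_y p d F ?z - grad_y p d F ?z')"
    using norm_triangle_ineq4[of "hess_yy p d G ?z (ux x) - hess_yy p d G ?z' (ux x)"
        "grad_y p d F ?z - grad_y p d F ?z'"] hess_yy_u_opt[OF xyu(1)]
    by simp
  also have "\<dots> \<le> (L * norm (ux x - ux x) + L\<^sub>y\<^sub>y * \<iota> * norm (?z - ?z')) + L * norm (?z - ?z')"
    by (intro add_mono upper.grad_y_lipschitz z_in graph_in hess_product_lipschitz(2) u_opt_in u_opt_bound xyu)
  also have "\<dots> = (L + L\<^sub>y\<^sub>y * \<iota>) * e_y" by (simp add: dist_to_graph distrib_right)
  also have "\<dots> \<le> K * e_y" by (intro mult_right_mono K_bounds) simp
  finally show ?thesis .
qed

lemma u_direction_split:
  "hess_yy p d G (x, y) u - grad_y p d F (x, y)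
    = hess_yy p d G (x, y) (u - ux x) + (hess_yy p d G (x, y) (ux x) - grad_y p d F (x, y))"
  by (simp add: linear_diff[OF lower.hess_yy_linear[OF z_in]])

lemma u_diff_in: "u - ux x \<in> Rn d"
  by (intro subspace_diff[OF subspace_Rn] xyu u_opt_in)

lemma u_direction_bound:
  "norm (hess_yy p d G (x, y) u - grad_y p d F (x, y)) \<le> K * (e_y + e_u)"
proof -
  have "norm (hess_yy p d G (x, y) (u - ux x)) \<le> L * e_u"
    by (intro lower.hess_yy_bound z_in u_diff_in less_imp_le[OF pos(1)])
  also have "\<dots> \<le> K * e_u" by (intro mult_right_mono K_bounds) simp
  finally show ?thesis
    unfolding u_direction_split
    using norm_triangle_ineq[of "hess_yy p d G (x, y) (u - ux x)"
        "hess_yy p d G (x, y) (ux x) - grad_y p d F (x, y)"] u_residual_at_u_opt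
    by (simp add: distrib_left)
qed

lemma y_step_contraction:
  assumes q: "0 \<le> q" "q * L\<^sup>2 \<le> \<mu>"
  shows "norm (y - q *\<^sub>R grad_y p d G (x, y) - yx x) \<le> (1 - q * \<mu> / 2) * e_y"
proof -
  have "norm ((y - yx x) - q *\<^sub>R grad_y p d G (x, y)) \<le> (1 - q * \<mu> / 2) * e_y"
  proof (rule strongly_monotone_step_contraction[OF _ _ lower.\<mu>_pos q])
    show "\<mu> * e_y\<^sup>2 \<le> inner (grad_y p d G (x, y)) (y - yx x)"
      using lower.grad_y_monotone[OF xyu(1,2) y_opt_in[OF xyu(1)]]
      by (simp only: grad_y_y_opt[OF xyu(1)] diff_zero)
    show "norm (grad_y p d G (x, y)) \<le> L * e_y"
      using lower.grad_y_lipschitz[OF z_in graph_in[OF xyu(1)]]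
      by (simp only: dist_to_graph grad_y_y_opt[OF xyu(1)] diff_zero)
  qed
  moreover have "y - q *\<^sub>R grad_y p d G (x, y) - yx x = (y - yx x) - q *\<^sub>R grad_y p d G (x, y)" by simp
  ultimately show ?thesis by (simp only:)
qed

lemma u_step_contraction:
  assumes q: "0 \<le> q" "q * L\<^sup>2 \<le> \<mu>"
  shows "norm (u - q *\<^sub>R (hess_yy p d G (x, y) u - grad_y p d F (x, y)) - ux x)
    \<le> (1 - q * \<mu> / 2) * e_u + q * (K * e_y)"
proof -
  let ?r = "hess_yy p d G (x, y) (ux x) - grad_y p d F (x, y)"
  have "norm ((u - ux x) - q *\<^sub>R hess_yy p d G (x, y) (u - ux x)) \<le> (1 - q * \<mu> / 2) * e_u"
    by (intro strongly_monotone_step_contraction[OF _ _ lower.\<mu>_pos q] lower.hess_yy_lower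
        lower.hess_yy_bound z_in u_diff_in less_imp_le[OF pos(1)])
  moreover have "norm (q *\<^sub>R ?r) \<le> q * (K * e_y)"
    using mult_left_mono[OF u_residual_at_u_opt q(1)] q(1) by simp
  moreover have eq: "u - q *\<^sub>R (hess_yy p d G (x, y) u - grad_y p d F (x, y)) - ux x
      = ((u - ux x) - q *\<^sub>R hess_yy p d G (x, y) (u - ux x)) - q *\<^sub>R ?r"
    unfolding u_direction_split by (simp add: scaleR_add_right algebra_simps)
  ultimately show ?thesis
    using norm_triangle_ineq4[of "(u - ux x) - q *\<^sub>R hess_yy p d G (x, y) (u - ux x)" "q *\<^sub>R ?r"]
    unfolding eq by linarith
qed

end

end

section \<open>One-block estimates\<close>

text \<open>Convexity of the square. Writing the perturbation as a multiple of \<open>q\<close>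
  makes its squared cost proportional to \<open>q\<close> as well.\<close>

lemma square_contraction_step:
  fixes q e e' w :: real
  assumes "0 \<le> q" "q \<le> 1" "0 \<le> e'" "e' \<le> (1 - q) * e + q * w"
  shows "e'\<^sup>2 \<le> (1 - q) * e\<^sup>2 + q * w\<^sup>2"
proof -
  have "e'\<^sup>2 \<le> ((1 - q) * e + q * w)\<^sup>2" using assms(3,4) by (intro power_mono)
  also have "\<dots> = (1 - q) * e\<^sup>2 + q * w\<^sup>2 - q * (1 - q) * (e - w)\<^sup>2"
    by (simp add: power2_eq_square algebra_simps)
  also have "\<dots> \<le> (1 - q) * e\<^sup>2 + q * w\<^sup>2"
  proof -
    have "0 \<le> q * (1 - q) * (e - w)\<^sup>2" using assms(1,2) by (intro mult_nonneg_nonneg) auto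
    then show ?thesis by linarith
  qed
  finally show ?thesis .
qed

lemma sum2_squared_le: "(a + b)\<^sup>2 \<le> 2 * (a\<^sup>2 + b\<^sup>2)" for a b :: real
  using sum_squares_bound[of a b] by (simp add: power2_sum)

lemma sum3_squared_le: "(a + b + c)\<^sup>2 \<le> 3 * (a\<^sup>2 + b\<^sup>2 + c\<^sup>2)" for a b c :: real
proof -
  have "(a + b + c)\<^sup>2 = 3 * (a\<^sup>2 + b\<^sup>2 + c\<^sup>2) - ((a - b)\<^sup>2 + (b - c)\<^sup>2 + (a - c)\<^sup>2)"
    by (simp add: power2_eq_square algebra_simps)
  also have "\<dots> \<le> 3 * (a\<^sup>2 + b\<^sup>2 + c\<^sup>2)"
    using zero_le_power2[of "a - b"] zero_le_power2[of "b - c"] zero_le_power2[of "a - c"] by linarith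
  finally show ?thesis .
qed

lemma sum4_squared_le: "(a + b + c + d)\<^sup>2 \<le> 4 * (a\<^sup>2 + b\<^sup>2 + c\<^sup>2 + d\<^sup>2)" for a b c d :: real
  using sum2_squared_le[of "a + b" "c + d"] sum2_squared_le[of a b] sum2_squared_le[of c d]
  by (simp add: add.assoc)

text \<open>Scalar core of the descent argument. \<open>P\<close> stands for the norm of the
  hypergradient, \<open>X\<close> for the displacement of \<open>x\<close>, \<epsilon> for the block
  error per unit of \<open>a\<close>, and \<open>Q * \<delta>\<close> for its noise part. Moving
  \<open>x\<close> shifts both targets by at most \<open>K * X\<close>; the conditions on
  \<open>c1\<close> and \<open>c2\<close> say that damping outweighs these shifts and the cross
  terms in the decrease of \<open>h\<close>.\<close>

lemma lyapunov_decrease: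
  fixes a K \<mu> c1 c2 P e_y e_u e_y' e_u' \<epsilon> X h h' Q \<delta> :: real
  assumes a: "0 < a" "K * a \<le> 1 / 64" and K: "1 \<le> K" and \<mu>: "0 < \<mu>"
    and c: "c2 * \<mu> = 400 * K\<^sup>2" "400 * K\<^sup>2 + 12 * (c2 * K\<^sup>2 / \<mu>) \<le> c1 * \<mu>"
    and q: "c1 * a * \<mu> \<le> 2" "c2 * a * \<mu> \<le> 2"
    and nn: "0 \<le> P" "0 \<le> e_y" "0 \<le> e_u" "0 \<le> e_y'" "0 \<le> e_u'" "0 \<le> \<epsilon>" "0 \<le> X"
    and X: "X \<le> a * (P + K * (e_y + e_u) + \<epsilon>)"
    and h': "h' \<le> h - a * P\<^sup>2 + a * (P * (K * (e_y + e_u) + \<epsilon>)) + K * X\<^sup>2"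
    and e_y': "e_y' \<le> (1 - c1 * a * \<mu> / 2) * e_y + a * \<epsilon> + K * X"
    and e_u': "e_u' \<le> (1 - c2 * a * \<mu> / 2) * e_u + c2 * a * (K * e_y) + a * \<epsilon> + K * X"
    and \<epsilon>: "\<epsilon> \<le> Q * \<delta> + (P + e_y + e_u) / 16"
  shows "h' + e_y'\<^sup>2 + e_u'\<^sup>2 \<le> h + e_y\<^sup>2 + e_u\<^sup>2 - a / 2 * P\<^sup>2 + a * (20 * Q\<^sup>2 * \<delta>\<^sup>2)"
proof -
  have K2: "1 \<le> K\<^sup>2" using K by (simp add: one_le_power)
  define W where "W = P + K * (e_y + e_u) + \<epsilon>"
  define A where "A = P\<^sup>2"
  define B1 where "B1 = K\<^sup>2 * e_y\<^sup>2"
  define B2 where "B2 = K\<^sup>2 * e_u\<^sup>2"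
  have AB: "0 \<le> A" "0 \<le> B1" "0 \<le> B2" by (simp_all add: A_def B1_def B2_def)
  have eB: "e_y\<^sup>2 \<le> B1" "e_u\<^sup>2 \<le> B2"
    using mult_right_mono[OF K2, of "e_y\<^sup>2"] mult_right_mono[OF K2, of "e_u\<^sup>2"]
    by (simp_all add: B1_def B2_def)
  have W0: "0 \<le> W" unfolding W_def using K nn by (intro add_nonneg_nonneg mult_nonneg_nonneg) auto
  have XW: "X \<le> a * W" using X by (simp only: W_def)
  have W2: "W\<^sup>2 \<le> 4 * A + 4 * B1 + 4 * B2 + 4 * \<epsilon>\<^sup>2"
    using sum4_squared_le[of P "K * e_y" "K * e_u" \<epsilon>]
    by (simp add: W_def A_def B1_def B2_def power_mult_distrib distrib_left add.assoc)
  \<comment> \<open>A weight of 1/16 turns into 4/256 = 1/64 in the four-term inequality, small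
    enough to be absorbed in the final tally.\<close>
  have E2: "\<epsilon>\<^sup>2 \<le> 4 * (Q\<^sup>2 * \<delta>\<^sup>2) + A / 64 + B1 / 64 + B2 / 64"
  proof -
    have "\<epsilon>\<^sup>2 \<le> (Q * \<delta> + P / 16 + e_y / 16 + e_u / 16)\<^sup>2"
      using \<epsilon> nn(6) by (intro power_mono) (simp_all add: add_divide_distrib)
    also have "\<dots> \<le> 4 * ((Q * \<delta>)\<^sup>2 + (P / 16)\<^sup>2 + (e_y / 16)\<^sup>2 + (e_u / 16)\<^sup>2)"
      by (rule sum4_squared_le)
    also have "\<dots> = 4 * (Q\<^sup>2 * \<delta>\<^sup>2) + (A + e_y\<^sup>2 + e_u\<^sup>2) / 64"
      by (simp add: A_def power_mult_distrib power_divide)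
    finally show ?thesis using eB unfolding add_divide_distrib by linarith
  qed
  have h1: "h' \<le> h + a * (- A + A / 8 + 8 * B1 + 8 * B2 + 4 * \<epsilon>\<^sup>2 + W\<^sup>2 / 64)"
  proof -
    have "P * (K * (e_y + e_u)) \<le> P\<^sup>2 / 16 + 4 * (K * (e_y + e_u))\<^sup>2"
      using zero_le_power2[of "P / 4 - 2 * (K * (e_y + e_u))"] by (simp add: power2_eq_square algebra_simps)
    moreover have "(K * (e_y + e_u))\<^sup>2 \<le> 2 * B1 + 2 * B2"
      using sum2_squared_le[of "K * e_y" "K * e_u"]
      by (simp add: B1_def B2_def power_mult_distrib distrib_left)
    moreover have "P * \<epsilon> \<le> P\<^sup>2 / 16 + 4 * \<epsilon>\<^sup>2"
      using zero_le_power2[of "P / 4 - 2 * \<epsilon>"] by (simp add: power2_eq_square algebra_simps)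
    ultimately have "P * (K * (e_y + e_u) + \<epsilon>) \<le> A / 8 + 8 * B1 + 8 * B2 + 4 * \<epsilon>\<^sup>2"
      unfolding A_def distrib_left[of P] by linarith
    then have 1: "a * (P * (K * (e_y + e_u) + \<epsilon>)) \<le> a * (A / 8 + 8 * B1 + 8 * B2 + 4 * \<epsilon>\<^sup>2)"
      using a(1) by (intro mult_left_mono) auto
    have "K * X\<^sup>2 \<le> K * (a * W)\<^sup>2"
      using XW nn(7) K by (intro mult_left_mono power_mono) auto
    also have "\<dots> = (K * a) * (a * W\<^sup>2)" by (simp add: power2_eq_square)
    also have "\<dots> \<le> 1 / 64 * (a * W\<^sup>2)" using a by (intro mult_right_mono) auto
    finally have 2: "K * X\<^sup>2 \<le> a * (W\<^sup>2 / 64)" by simp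
    have "a * (- A + A / 8 + 8 * B1 + 8 * B2 + 4 * \<epsilon>\<^sup>2 + W\<^sup>2 / 64)
        = - (a * A) + a * (A / 8 + 8 * B1 + 8 * B2 + 4 * \<epsilon>\<^sup>2) + a * (W\<^sup>2 / 64)"
      by (simp add: algebra_simps)
    then show ?thesis using h' 1 2 unfolding A_def[symmetric] by linarith
  qed
  have KX: "K * X \<le> a * (K * W)"
    using mult_left_mono[OF XW, of K] K by (simp add: mult_ac)
  have c2: "0 < c2 * \<mu>" and c1: "400 * K\<^sup>2 \<le> c1 * \<mu>" "0 < c1 * \<mu>"
  proof -
    show c2: "0 < c2 * \<mu>" using c(1) K2 by linarith
    then have "0 < c2" using \<mu> by (simp add: zero_less_mult_iff)
    then have "0 \<le> c2 * K\<^sup>2 / \<mu>" using \<mu> by simp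
    then show "400 * K\<^sup>2 \<le> c1 * \<mu>" using c(2) by linarith
    then show "0 < c1 * \<mu>" using K2 by linarith
  qed
  have KW: "(\<epsilon> + K * W)\<^sup>2 \<le> 2 * (K\<^sup>2 * (\<epsilon>\<^sup>2 + W\<^sup>2))"
  proof -
    have "(\<epsilon> + K * W)\<^sup>2 \<le> 2 * (\<epsilon>\<^sup>2 + (K * W)\<^sup>2)" by (rule sum2_squared_le)
    moreover have "\<epsilon>\<^sup>2 \<le> K\<^sup>2 * \<epsilon>\<^sup>2" using mult_right_mono[OF K2, of "\<epsilon>\<^sup>2"] by simp
    ultimately show ?thesis by (simp add: power_mult_distrib distrib_left)
  qed
  \<comment> \<open>The perturbation \<open>a * (\<epsilon> + K * W)\<close> is \<open>q\<close>
    times \<open>2 / r * (\<epsilon> + K * W)\<close>, so its squared cost is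
    \<open>a * (2 / r)\<close> times a square; since \<open>r\<close> is at least
    \<open>400 * K\<^sup>2\<close>, only one hundredth of
    \<open>\<epsilon>\<^sup>2 + W\<^sup>2\<close> remains.\<close>
  have y1: "e_y'\<^sup>2 \<le> e_y\<^sup>2 + a * (- (c1 * \<mu> / 2) * e_y\<^sup>2 + (\<epsilon>\<^sup>2 + W\<^sup>2) / 100)"
  proof -
    define r where "r = c1 * \<mu>"
    have r: "0 < r" "400 * K\<^sup>2 \<le> r" using c1 by (simp_all add: r_def)
    define q where "q = a * r / 2"
    have q_square: "q * (2 / r * s)\<^sup>2 = a * (2 / r * s\<^sup>2)" for s
      using r(1) by (simp add: q_def power2_eq_square)
    have q01: "0 \<le> q" "q \<le> 1"
      using mult_nonneg_nonneg[OF less_imp_le[OF a(1)] less_imp_le[OF r(1)]] q(1)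
      by (simp_all add: q_def r_def mult_ac)
    have "e_y' \<le> (1 - q) * e_y + q * (2 / r * (\<epsilon> + K * W))"
    proof -
      have "q * (2 / r * (\<epsilon> + K * W)) = a * \<epsilon> + a * (K * W)" using r(1) by (simp add: q_def distrib_left)
      moreover have "c1 * a * \<mu> / 2 = q" by (simp add: q_def r_def)
      ultimately show ?thesis using e_y' KX by simp
    qed
    then have "e_y'\<^sup>2 \<le> (1 - q) * e_y\<^sup>2 + q * (2 / r * (\<epsilon> + K * W))\<^sup>2"
      by (intro square_contraction_step q01 nn)
    also have "q * (2 / r * (\<epsilon> + K * W))\<^sup>2 = a * (2 / r * (\<epsilon> + K * W)\<^sup>2)"
      by (rule q_square)
    also have "\<dots> \<le> a * ((\<epsilon>\<^sup>2 + W\<^sup>2) / 100)"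
    proof (rule mult_left_mono)
      have "2 / r * (\<epsilon> + K * W)\<^sup>2 \<le> 2 / r * (2 * (K\<^sup>2 * (\<epsilon>\<^sup>2 + W\<^sup>2)))"
        using r(1) by (intro mult_left_mono KW) simp
      also have "\<dots> = (400 * K\<^sup>2) / r * ((\<epsilon>\<^sup>2 + W\<^sup>2) / 100)" by simp
      also have "\<dots> \<le> 1 * ((\<epsilon>\<^sup>2 + W\<^sup>2) / 100)" using r by (intro mult_right_mono) simp_all
      finally show "2 / r * (\<epsilon> + K * W)\<^sup>2 \<le> (\<epsilon>\<^sup>2 + W\<^sup>2) / 100" by simp
    qed (use a(1) in simp)
    finally show ?thesis by (simp add: q_def r_def algebra_simps)
  qed
  \<comment> \<open>The error of \<open>y\<close> enters with the factor \<open>c2 * K\<close>;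
    squared and divided by the damping \<open>c2 * \<mu>\<close> it leaves a multiple of
    \<open>c2 * K\<^sup>2 / \<mu>\<close>, which \<open>c1\<close> has to dominate.\<close>
  have u1: "e_u'\<^sup>2 \<le> e_u\<^sup>2 + a * (- 200 * B2 + 6 * (c2 * K\<^sup>2 / \<mu>) * e_y\<^sup>2 + 3 * (\<epsilon>\<^sup>2 + W\<^sup>2) / 200)"
  proof -
    define r where "r = c2 * \<mu>"
    have r: "0 < r" "r = 400 * K\<^sup>2" using c2 c(1) by (simp_all add: r_def)
    define q where "q = a * r / 2"
    let ?s = "c2 * K * e_y + \<epsilon> + K * W"
    have q_square: "q * (2 / r * s)\<^sup>2 = a * (2 / r * s\<^sup>2)" for s
      using r(1) by (simp add: q_def power2_eq_square)
    have q01: "0 \<le> q" "q \<le> 1"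
      using mult_nonneg_nonneg[OF less_imp_le[OF a(1)] less_imp_le[OF r(1)]] q(2)
      by (simp_all add: q_def r_def mult_ac)
    have "e_u' \<le> (1 - q) * e_u + q * (2 / r * ?s)"
    proof -
      have "q * (2 / r * ?s) = c2 * a * (K * e_y) + a * \<epsilon> + a * (K * W)"
        using r(1) by (simp add: q_def distrib_left)
      moreover have "c2 * a * \<mu> / 2 = q" by (simp add: q_def r_def)
      ultimately show ?thesis using e_u' KX by simp
    qed
    then have "e_u'\<^sup>2 \<le> (1 - q) * e_u\<^sup>2 + q * (2 / r * ?s)\<^sup>2"
      by (intro square_contraction_step q01 nn)
    also have "q * (2 / r * ?s)\<^sup>2 = a * (2 / r * ?s\<^sup>2)"
      by (rule q_square)
    also have "\<dots> \<le> a * (6 * (c2 * K\<^sup>2 / \<mu>) * e_y\<^sup>2 + 3 * (\<epsilon>\<^sup>2 + W\<^sup>2) / 200)"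
    proof (rule mult_left_mono)
      have "\<epsilon>\<^sup>2 \<le> K\<^sup>2 * \<epsilon>\<^sup>2" using mult_right_mono[OF K2, of "\<epsilon>\<^sup>2"] by simp
      then have "?s\<^sup>2 \<le> 3 * (c2\<^sup>2 * K\<^sup>2 * e_y\<^sup>2 + K\<^sup>2 * (\<epsilon>\<^sup>2 + W\<^sup>2))"
        using sum3_squared_le[of "c2 * K * e_y" \<epsilon> "K * W"]
        by (simp add: power_mult_distrib distrib_left)
      then have "2 / r * ?s\<^sup>2 \<le> 2 / r * (3 * (c2\<^sup>2 * K\<^sup>2 * e_y\<^sup>2 + K\<^sup>2 * (\<epsilon>\<^sup>2 + W\<^sup>2)))"
        using r(1) by (intro mult_left_mono) simp_all
      also have "\<dots> = 6 * (c2\<^sup>2 * K\<^sup>2 / r) * e_y\<^sup>2 + 6 * (K\<^sup>2 / r) * (\<epsilon>\<^sup>2 + W\<^sup>2)"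
        by (simp add: distrib_left add_divide_distrib)
      also have "c2\<^sup>2 * K\<^sup>2 / r = c2 * K\<^sup>2 / \<mu>" using r(1) by (simp add: r_def power2_eq_square)
      also have "K\<^sup>2 / r = 1 / 400" using r K2 by simp
      finally show "2 / r * ?s\<^sup>2 \<le> 6 * (c2 * K\<^sup>2 / \<mu>) * e_y\<^sup>2 + 3 * (\<epsilon>\<^sup>2 + W\<^sup>2) / 200" by simp
    qed (use a(1) in simp)
    finally show ?thesis by (simp add: q_def r(2) B2_def algebra_simps)
  qed
  define y_coeff where "y_coeff = c2 * K\<^sup>2 / \<mu> * e_y\<^sup>2"
  \<comment> \<open>Half of the condition on \<open>c1\<close>: the 12 there is twice the 6 that the
    estimate for \<open>u\<close> leaves behind.\<close>
  have cy: "200 * B1 + 6 * y_coeff \<le> c1 * \<mu> / 2 * e_y\<^sup>2"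
    using mult_right_mono[OF c(2), of "e_y\<^sup>2"] by (simp add: B1_def y_coeff_def distrib_right)
  have "a * (- A + A / 8 + 8 * B1 + 8 * B2 + 4 * \<epsilon>\<^sup>2 + W\<^sup>2 / 64)
      + a * (- (c1 * \<mu> / 2) * e_y\<^sup>2 + (\<epsilon>\<^sup>2 + W\<^sup>2) / 100)
      + a * (- 200 * B2 + 6 * (c2 * K\<^sup>2 / \<mu>) * e_y\<^sup>2 + 3 * (\<epsilon>\<^sup>2 + W\<^sup>2) / 200)
    = a * ((- A + A / 8 + 8 * B1 + 8 * B2 + 4 * \<epsilon>\<^sup>2 + W\<^sup>2 / 64)
      + (- (c1 * \<mu> / 2) * e_y\<^sup>2 + (\<epsilon>\<^sup>2 + W\<^sup>2) / 100)
      + (- 200 * B2 + 6 * (c2 * K\<^sup>2 / \<mu>) * e_y\<^sup>2 + 3 * (\<epsilon>\<^sup>2 + W\<^sup>2) / 200))"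
    by (simp only: distrib_left)
  \<comment> \<open>In the tally \<open>\<epsilon>\<^sup>2\<close> has total coefficient below 5,
    whence the 20 before the noise, and \<open>A\<close> keeps a coefficient below -1/2.\<close>
  also have "\<dots> \<le> a * (- A / 2 + 20 * (Q\<^sup>2 * \<delta>\<^sup>2))"
  proof (rule mult_left_mono)
    have t: "- (c1 * \<mu> / 2) * e_y\<^sup>2 = - (c1 * \<mu> / 2 * e_y\<^sup>2)"
      "6 * (c2 * K\<^sup>2 / \<mu>) * e_y\<^sup>2 = 6 * y_coeff" by (simp_all add: y_coeff_def)
    show "(- A + A / 8 + 8 * B1 + 8 * B2 + 4 * \<epsilon>\<^sup>2 + W\<^sup>2 / 64)
      + (- (c1 * \<mu> / 2) * e_y\<^sup>2 + (\<epsilon>\<^sup>2 + W\<^sup>2) / 100)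
      + (- 200 * B2 + 6 * (c2 * K\<^sup>2 / \<mu>) * e_y\<^sup>2 + 3 * (\<epsilon>\<^sup>2 + W\<^sup>2) / 200)
      \<le> - A / 2 + 20 * (Q\<^sup>2 * \<delta>\<^sup>2)"
      unfolding t add_divide_distrib distrib_left using cy W2 E2 AB mult_nonneg_nonneg[OF zero_le_power2[of Q] zero_le_power2[of \<delta>]] by linarith
  qed (use a(1) in simp)
  also have "\<dots> = - a / 2 * P\<^sup>2 + a * (20 * Q\<^sup>2 * \<delta>\<^sup>2)" by (simp add: A_def algebra_simps)
  finally show ?thesis using h1 y1 u1 by linarith
qed

lemma without_replacement_block_error:
  fixes w :: "nat \<Rightarrow> 'a::real_normed_vector" and V :: "nat \<Rightarrow> 'a \<Rightarrow> 'a"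
  assumes lip: "\<And>\<tau> i j. \<tau> < T \<Longrightarrow> i \<le> T \<Longrightarrow> j \<le> T \<Longrightarrow> norm (V \<tau> (w i) - V \<tau> (w j)) \<le> K * norm (w i - w j)"
    and lip': "\<And>i j. i \<le> T \<Longrightarrow> j \<le> T \<Longrightarrow> norm (Vb (w i) - Vb (w j)) \<le> K * norm (w i - w j)"
    and noise: "\<And>t s. 0 < s \<Longrightarrow> t + s \<le> T \<Longrightarrow>
      norm ((1 / real s) *\<^sub>R (\<Sum>\<tau>=t..<t+s. V \<tau> (w t)) - Vb (w t)) \<le> B * real s powr (- \<alpha> / 2)"
    and step: "\<And>\<tau>. \<tau> < T \<Longrightarrow> w (Suc \<tau>) = w \<tau> - \<eta> *\<^sub>R V \<tau> (w \<tau>)"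
    and k: "0 < k" "t + 2 * k \<le> T" and \<eta>: "0 < \<eta>" "K * (\<eta> * real k) \<le> 1 / 6"
    and nn: "0 \<le> B" "0 \<le> K"
  shows "norm (w (t + k) - w t + (\<eta> * real k) *\<^sub>R Vb (w t))
    \<le> \<eta> * real k * (4 * (B * real k powr (- \<alpha> / 2)) + 6 * K * (\<eta> * real k) * norm (Vb (w t)))"
proof -
  define a where "a = \<eta> * real k"
  have a: "0 < a" "K * a \<le> 1 / 6" using k \<eta> by (simp_all add: a_def)
  define \<delta> where "\<delta> = B * real k powr (- \<alpha> / 2)"
  have \<delta>: "0 \<le> \<delta>" using nn by (simp add: \<delta>_def)
  define D where "D = Max ((\<lambda>s. norm (w (t + s) - w t)) ` {..k})"
  have D: "norm (w (t + s) - w t) \<le> D" if "s \<le> k" for s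
    unfolding D_def using that by (intro Max_ge) auto
  have D0: "0 \<le> D" using D[of 0] by simp
  define \<Sigma> where "\<Sigma> i s v = (\<Sum>\<tau>=i..<i+s. V \<tau> v - Vb v)" for i s v
  have \<Sigma>_noise: "norm (\<Sigma> i s (w i)) \<le> B * real s powr (1 - \<alpha> / 2)" if "0 < s" "i + s \<le> T" for i s
  proof -
    have "\<Sigma> i s (w i) = real s *\<^sub>R ((1 / real s) *\<^sub>R (\<Sum>\<tau>=i..<i+s. V \<tau> (w i)) - Vb (w i))"
      using that(1) by (simp add: \<Sigma>_def sum_subtractf scaleR_diff_right sum_constant_scaleR)
    then have "norm (\<Sigma> i s (w i)) = real s * norm ((1 / real s) *\<^sub>R (\<Sum>\<tau>=i..<i+s. V \<tau> (w i)) - Vb (w i))"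
      by simp
    also have "\<dots> \<le> real s * (B * real s powr (- \<alpha> / 2))"
      by (intro mult_left_mono noise that) simp
    also have "\<dots> = B * (real s powr 1 * real s powr (- \<alpha> / 2))" using that(1) by simp
    also have "\<dots> = B * real s powr (1 - \<alpha> / 2)" by (simp only: powr_add[symmetric]) simp
    finally show ?thesis .
  qed
  define M where "M = B * real k powr (1 - \<alpha> / 2)"
  have M: "0 \<le> M" "M = real k * \<delta>"
  proof -
    show "0 \<le> M" using nn by (simp add: M_def)
    have "real k powr (1 - \<alpha> / 2) = real k powr 1 * real k powr (- \<alpha> / 2)"
      by (simp only: powr_add[symmetric]) simp
    then show "M = real k * \<delta>" using k(1) by (simp add: M_def \<delta>_def)
  qed
  have \<Sigma>_bound: "norm (\<Sigma> t s (w t)) \<le> 2 * M + real k * (2 * (K * D))" if s: "s \<le> k" for s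
  proof -
    have KD: "0 \<le> real k * (2 * (K * D))" using nn D0 by simp
    consider "s = 0" | "0 < s" "\<alpha> \<le> 2" | "0 < s" "2 < \<alpha>" by linarith
    then show ?thesis
    proof cases
      case 1
      then have "\<Sigma> t s (w t) = 0" by (simp add: \<Sigma>_def)
      then show ?thesis using KD M by simp
    next
      case 2
      \<comment> \<open>The exponent is nonnegative here, so a short sum is no worse than one of
        length \<open>k\<close>.\<close>
      have "norm (\<Sigma> t s (w t)) \<le> B * real s powr (1 - \<alpha> / 2)"
        using 2 s k by (intro \<Sigma>_noise) auto
      also have "\<dots> \<le> M" unfolding M_def using 2 s nn by (intro mult_left_mono powr_mono2) auto
      finally show ?thesis using KD M by linarith
    next
      case 3
      \<comment> \<open>Here partial sums of fewer than \<open>k\<close> terms are not controlled well enough, so the sum is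
          written as a difference of two sums of at least \<open>k\<close> terms.\<close>
      have "\<Sigma> t (s + k) (w t) = \<Sigma> t s (w t) + \<Sigma> (t + s) k (w t)"
        unfolding \<Sigma>_def
        using sum.atLeastLessThan_concat[of t "t + s" "t + s + k" "\<lambda>\<tau>. V \<tau> (w t) - Vb (w t)"]
        by (simp add: add.assoc)
      then have eq: "\<Sigma> t s (w t) = \<Sigma> t (s + k) (w t) - \<Sigma> (t + s) k (w (t + s))
          - (\<Sigma> (t + s) k (w t) - \<Sigma> (t + s) k (w (t + s)))" by simp
      have "norm (\<Sigma> t (s + k) (w t)) \<le> B * real (s + k) powr (1 - \<alpha> / 2)"
        using 3 s k by (intro \<Sigma>_noise) auto
      also have "\<dots> \<le> M" unfolding M_def using 3 k nn by (intro mult_left_mono powr_mono2') auto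
      finally have 1: "norm (\<Sigma> t (s + k) (w t)) \<le> M" .
      have 2: "norm (\<Sigma> (t + s) k (w (t + s))) \<le> M"
        unfolding M_def using s k by (intro \<Sigma>_noise) auto
      have "norm (\<Sigma> (t + s) k (w t) - \<Sigma> (t + s) k (w (t + s)))
          = norm (\<Sum>\<tau>=t+s..<t+s+k. (V \<tau> (w t) - V \<tau> (w (t + s))) - (Vb (w t) - Vb (w (t + s))))"
        unfolding \<Sigma>_def sum_subtractf[symmetric] by (simp add: algebra_simps)
      also have "\<dots> \<le> real (card {t+s..<t+s+k}) * (2 * (K * D))"
      proof (rule sum_norm_bound)
        fix \<tau> assume "\<tau> \<in> {t+s..<t+s+k}"
        then have \<tau>: "\<tau> < T" "t \<le> T" "t + s \<le> T" using s k by auto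
        have "K * norm (w t - w (t + s)) \<le> K * D"
          using D[OF s] nn by (intro mult_left_mono) (simp_all add: norm_minus_commute)
        then show "norm ((V \<tau> (w t) - V \<tau> (w (t + s))) - (Vb (w t) - Vb (w (t + s)))) \<le> 2 * (K * D)"
          using norm_triangle_ineq4[of "V \<tau> (w t) - V \<tau> (w (t + s))" "Vb (w t) - Vb (w (t + s))"]
            lip[OF \<tau>] lip'[OF \<tau>(2,3)] by linarith
      qed
      finally have 3: "norm (\<Sigma> (t + s) k (w t) - \<Sigma> (t + s) k (w (t + s))) \<le> real k * (2 * (K * D))"
        by simp
      show ?thesis
        unfolding eq
        using norm_triangle_ineq4[of "\<Sigma> t (s + k) (w t) - \<Sigma> (t + s) k (w (t + s))"
            "\<Sigma> (t + s) k (w t) - \<Sigma> (t + s) k (w (t + s))"]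
          norm_triangle_ineq4[of "\<Sigma> t (s + k) (w t)" "\<Sigma> (t + s) k (w (t + s))"] 1 2 3
        by linarith
    qed
  qed
  have iter: "w (t + s) - w t = - (\<eta> *\<^sub>R (\<Sum>\<tau>=t..<t+s. V \<tau> (w \<tau>)))" if "s \<le> k" for s
    using that
  proof (induction s)
    case (Suc s)
    then have "w (t + Suc s) - w t = (w (t + s) - w t) - \<eta> *\<^sub>R V (t + s) (w (t + s))"
      using k step[of "t + s"] by simp
    also have "w (t + s) - w t = - (\<eta> *\<^sub>R (\<Sum>\<tau>=t..<t+s. V \<tau> (w \<tau>)))" using Suc by simp
    finally show ?case by (simp add: scaleR_add_right)
  qed simp
  have dev: "norm ((\<Sum>\<tau>=t..<t+s. V \<tau> (w \<tau>)) - real s *\<^sub>R Vb (w t)) \<le> 2 * M + real k * (3 * (K * D))"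
    if s: "s \<le> k" for s
  proof -
    have "(\<Sum>\<tau>=t..<t+s. V \<tau> (w \<tau>)) - real s *\<^sub>R Vb (w t)
        = \<Sigma> t s (w t) + (\<Sum>\<tau>=t..<t+s. V \<tau> (w \<tau>) - V \<tau> (w t))"
      by (simp add: \<Sigma>_def sum_subtractf sum_constant_scaleR)
    moreover have "norm (\<Sum>\<tau>=t..<t+s. V \<tau> (w \<tau>) - V \<tau> (w t)) \<le> real (card {t..<t+s}) * (K * D)"
    proof (rule sum_norm_bound)
      fix \<tau> assume "\<tau> \<in> {t..<t+s}"
      then have \<tau>: "\<tau> = t + (\<tau> - t)" "\<tau> - t \<le> k" "\<tau> < T" using s k by auto
      have "norm (V \<tau> (w \<tau>) - V \<tau> (w t)) \<le> K * norm (w \<tau> - w t)" using \<tau> by (intro lip) auto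
      also have "\<dots> \<le> K * D" using D[OF \<tau>(2)] \<tau>(1) nn by (intro mult_left_mono) auto
      finally show "norm (V \<tau> (w \<tau>) - V \<tau> (w t)) \<le> K * D" .
    qed
    moreover have "real (card {t..<t+s}) * (K * D) \<le> real k * (K * D)"
      using s nn D0 by (intro mult_right_mono) auto
    ultimately show ?thesis
      using norm_triangle_ineq[of "\<Sigma> t s (w t)" "\<Sum>\<tau>=t..<t+s. V \<tau> (w \<tau>) - V \<tau> (w t)"] \<Sigma>_bound[OF s]
      by simp
  qed
  define N where "N = norm (Vb (w t))"
  have M': "\<eta> * (2 * M + real k * (3 * (K * D))) = a * (2 * \<delta> + 3 * (K * D))"
    by (simp add: a_def M(2) algebra_simps)
  have Da: "D \<le> a * (N + 2 * \<delta> + 3 * (K * D))"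
  proof -
    have "norm (w (t + s) - w t) \<le> a * (N + 2 * \<delta> + 3 * (K * D))" if s: "s \<le> k" for s
    proof -
      have "norm (\<Sum>\<tau>=t..<t+s. V \<tau> (w \<tau>)) \<le> real s * N + (2 * M + real k * (3 * (K * D)))"
        using dev[OF s] norm_triangle_ineq[of "real s *\<^sub>R Vb (w t)"
            "(\<Sum>\<tau>=t..<t+s. V \<tau> (w \<tau>)) - real s *\<^sub>R Vb (w t)"]
        by (simp add: N_def)
      also have "real s * N \<le> real k * N" using s by (intro mult_right_mono) (simp_all add: N_def)
      finally have "\<eta> * norm (\<Sum>\<tau>=t..<t+s. V \<tau> (w \<tau>))
          \<le> \<eta> * (real k * N + (2 * M + real k * (3 * (K * D))))"
        using \<eta>(1) by (intro mult_left_mono) auto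
      also have "\<dots> = a * N + \<eta> * (2 * M + real k * (3 * (K * D)))" by (simp add: a_def distrib_left)
      also have "\<dots> = a * (N + 2 * \<delta> + 3 * (K * D))" unfolding M' by (simp add: distrib_left)
      finally show ?thesis using \<eta>(1) by (simp add: iter[OF s])
    qed
    then show ?thesis unfolding D_def by (intro Max.boundedI) auto
  qed
  \<comment> \<open>The bound \<open>Da\<close> has \<open>D\<close> on both sides; as
    \<open>K * a \<le> 1 / 6\<close>, its right-hand occurrence amounts to at most half of
    \<open>D\<close>.\<close>
  have "a * (3 * (K * D)) \<le> 1 / 2 * D"
    using mult_right_mono[OF a(2), of "3 * D"] D0 by (simp add: mult_ac)
  then have D2: "D \<le> 2 * a * (N + 2 * \<delta>)" using Da by (simp add: distrib_left)
  have "w (t + k) - w t + a *\<^sub>R Vb (w t)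
      = - (\<eta> *\<^sub>R ((\<Sum>\<tau>=t..<t+k. V \<tau> (w \<tau>)) - real k *\<^sub>R Vb (w t)))"
    by (simp add: iter a_def scaleR_diff_right)
  then have "norm (w (t + k) - w t + a *\<^sub>R Vb (w t))
      = \<eta> * norm ((\<Sum>\<tau>=t..<t+k. V \<tau> (w \<tau>)) - real k *\<^sub>R Vb (w t))"
    using \<eta>(1) by simp
  also have "\<dots> \<le> \<eta> * (2 * M + real k * (3 * (K * D)))"
    using \<eta>(1) by (intro mult_left_mono dev) auto
  also have "\<dots> = a * (2 * \<delta> + 3 * (K * D))" by (rule M')
  also have "\<dots> \<le> a * (4 * \<delta> + 6 * K * a * N)"
  proof (rule mult_left_mono)
    have "3 * (K * D) \<le> 3 * (K * (2 * a * (N + 2 * \<delta>)))" using D2 nn by (intro mult_left_mono) auto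
    also have "\<dots> = 6 * K * a * N + 12 * \<delta> * (K * a)" by (simp add: algebra_simps)
    also have "12 * \<delta> * (K * a) \<le> 12 * \<delta> * (1 / 6)" using a(2) \<delta> by (intro mult_left_mono) auto
    finally show "2 * \<delta> + 3 * (K * D) \<le> 4 * \<delta> + 6 * K * a * N" by simp
  qed (use a(1) in simp)
  finally show ?thesis by (simp only: a_def \<delta>_def N_def)
qed

section \<open>Mean field and potential\<close>

text \<open>\<open>arg_min_on\<close> is a choice, so a minimiser has to be exhibited first: the
  point itself inside the ball, its radial rescaling outside.\<close>

lemma proj_ball_in:
  assumes "0 < r" "v \<in> Rn d"
  shows "proj_ball d r v \<in> Rn d" "norm (proj_ball d r v) \<le> r"
    and "norm v \<le> r \<Longrightarrow> proj_ball d r v = v"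
proof -
  have min: "is_arg_min (\<lambda>w. norm (w - v)) (\<lambda>w. w \<in> cball 0 r \<inter> Rn d) (proj_ball d r v)"
    if "is_arg_min (\<lambda>w. norm (w - v)) (\<lambda>w. w \<in> cball 0 r \<inter> Rn d) w0" for w0
    unfolding proj_ball_def arg_min_on_def arg_min_def 
    by (rule someI[of "is_arg_min (\<lambda>w. norm (w - v)) (\<lambda>w. w \<in> cball 0 r \<inter> Rn d)" w0, OF that])
  have inside: "is_arg_min (\<lambda>w. norm (w - v)) (\<lambda>w. w \<in> cball 0 r \<inter> Rn d) v" if "norm v \<le> r"
    using that assms(2) by (simp add: is_arg_min_linorder)
  have outside: "is_arg_min (\<lambda>w. norm (w - v)) (\<lambda>w. w \<in> cball 0 r \<inter> Rn d) ((r / norm v) *\<^sub>R v)"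
    if "r < norm v"
    unfolding is_arg_min_linorder
  proof (intro conjI allI impI)
    show "(r / norm v) *\<^sub>R v \<in> cball 0 r \<inter> Rn d"
      using that assms by (auto intro: subspace_scale[OF subspace_Rn])
    have "(r / norm v) *\<^sub>R v - v = (r / norm v - 1) *\<^sub>R v" by (simp add: scaleR_diff_left)
    then have "norm ((r / norm v) *\<^sub>R v - v) = \<bar>r / norm v - 1\<bar> * norm v" by (simp only: norm_scaleR)
    also have "\<bar>r / norm v - 1\<bar> = 1 - r / norm v"
    proof -
      have "r / norm v < 1" using that assms(1) by (simp add: divide_less_eq_1)
      then show ?thesis by simp
    qed
    also have "(1 - r / norm v) * norm v = norm v - r"
      using that assms(1) by (cases "v = 0") (simp_all add: left_diff_distrib)
    finally show "norm ((r / norm v) *\<^sub>R v - v) \<le> norm (w - v)" if "w \<in> cball 0 r \<inter> Rn d" for w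
      using that norm_triangle_ineq2[of v w] by (simp add: norm_minus_commute)
  qed
  have "is_arg_min (\<lambda>w. norm (w - v)) (\<lambda>w. w \<in> cball 0 r \<inter> Rn d) (proj_ball d r v)"
    using min[OF inside] min[OF outside] by (cases "norm v \<le> r") auto
  then show "proj_ball d r v \<in> Rn d" "norm (proj_ball d r v) \<le> r"
    by (simp_all add: is_arg_min_linorder)
  show "proj_ball d r v = v" if "norm v \<le> r"
  proof -
    have "norm (proj_ball d r v - v) \<le> norm (v - v)"
      using min[OF inside[OF that]] that assms(2) unfolding is_arg_min_linorder by auto
    then show ?thesis by simp
  qed
qed

text \<open>The ratios of the learning rates are part of the field, so that all three updates share
  the step size \<eta>.\<close>

definition bilevel_field ::
    "nat \<Rightarrow> nat \<Rightarrow> real \<Rightarrow> real \<Rightarrow> (rvec \<times> rvec \<Rightarrow> real) \<Rightarrow> (rvec \<times> rvec \<Rightarrow> real) \<Rightarrow>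
      rvec \<times> rvec \<times> rvec \<Rightarrow> rvec \<times> rvec \<times> rvec"
  where "bilevel_field p d c1 c2 F G = (\<lambda>(x, y, u).
    (grad_x p d F (x, y) - hess_xy p d G (x, y) u,
     c1 *\<^sub>R grad_y p d G (x, y),
     c2 *\<^sub>R (hess_yy p d G (x, y) u - grad_y p d F (x, y))))"

lemma norm_triple_le: "norm (a, b, c) \<le> norm a + norm b + norm c"
  using norm_Pair_le[of a "(b, c)"] norm_Pair_le[of b c] by simp

lemma norm_triple_components:
  "norm a \<le> norm (a, b, c)" "norm b \<le> norm (a, b, c)" "norm c \<le> norm (a, b, c)"
  "norm (a, b) \<le> norm (a, b, c)"
  using norm_fst_le[of a "(b, c)"] order_trans[OF norm_fst_le[of b c] norm_snd_le[of "(b, c)" a]]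
    order_trans[OF norm_snd_le[of c b] norm_snd_le[of "(b, c)" a]]
  by (simp_all add: norm_Pair)

context bilevel_problem
begin

lemma bilevel_field_lipschitz:
  assumes c: "0 \<le> c1" "0 \<le> c2"
    and xyu: "x \<in> Rn p" "y \<in> Rn d" "u \<in> Rn d" and xyu': "x' \<in> Rn p" "y' \<in> Rn d" "u' \<in> Rn d" "norm u' \<le> \<iota>"
  shows "norm (bilevel_field p d c1 c2 F G (x, y, u) - bilevel_field p d c1 c2 F G (x', y', u'))
    \<le> K * (1 + c1 + c2) * norm ((x, y, u) - (x', y', u'))"
proof -
  let ?z = "(x, y)" and ?z' = "(x', y')"
  define D where "D = norm ((x, y, u) - (x', y', u'))"
  have z: "?z \<in> Rn p \<times> Rn d" "?z' \<in> Rn p \<times> Rn d" using xyu xyu' by auto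
  have Dz: "norm (?z - ?z') \<le> D" and Du: "norm (u - u') \<le> D"
    unfolding D_def using norm_triple_components by simp_all
  have D0: "0 \<le> D" by (simp add: D_def)
  have \<iota>0: "0 \<le> L\<^sub>x\<^sub>y * \<iota>" "0 \<le> L\<^sub>y\<^sub>y * \<iota>" by (intro mult_nonneg_nonneg less_imp_le pos \<iota>_pos)+
  have LD: "L * norm (?z - ?z') \<le> L * D" "L * norm (u - u') \<le> L * D"
    "L\<^sub>x\<^sub>y * \<iota> * norm (?z - ?z') \<le> L\<^sub>x\<^sub>y * \<iota> * D" "L\<^sub>y\<^sub>y * \<iota> * norm (?z - ?z') \<le> L\<^sub>y\<^sub>y * \<iota> * D"
    by (intro mult_left_mono Dz Du \<iota>0 less_imp_le[OF pos(1)])+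
  have KD: "2 * (L * D) + L\<^sub>x\<^sub>y * \<iota> * D + L\<^sub>y\<^sub>y * \<iota> * D \<le> K * D"
    using mult_right_mono[OF K_ge(1) D0] by (simp only: distrib_right mult.assoc)
  have 0: "0 \<le> L * D" "0 \<le> L\<^sub>x\<^sub>y * \<iota> * D" "0 \<le> L\<^sub>y\<^sub>y * \<iota> * D"
    by (intro mult_nonneg_nonneg \<iota>0 D0 less_imp_le[OF pos(1)])+
  have 1: "norm ((grad_x p d F ?z - hess_xy p d G ?z u) - (grad_x p d F ?z' - hess_xy p d G ?z' u')) \<le> K * D"
  proof -
    have eq: "(grad_x p d F ?z - hess_xy p d G ?z u) - (grad_x p d F ?z' - hess_xy p d G ?z' u')
        = (grad_x p d F ?z - grad_x p d F ?z') - (hess_xy p d G ?z u - hess_xy p d G ?z' u')" by simp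
    show ?thesis
      unfolding eq
      using norm_triangle_ineq4[of "grad_x p d F ?z - grad_x p d F ?z'" "hess_xy p d G ?z u - hess_xy p d G ?z' u'"]
        upper.grad_x_lipschitz[OF z] hess_product_lipschitz(1)[OF z xyu(3) xyu'(3,4)] LD KD 0
      by linarith
  qed
  have 2: "norm (c1 *\<^sub>R grad_y p d G ?z - c1 *\<^sub>R grad_y p d G ?z') \<le> c1 * (K * D)"
  proof -
    have "norm (grad_y p d G ?z - grad_y p d G ?z') \<le> K * D"
      using lower.grad_y_lipschitz[OF z] LD KD 0 by linarith
    then show ?thesis using c(1) by (simp add: scaleR_diff_right[symmetric] mult_left_mono)
  qed
  have 3: "norm (c2 *\<^sub>R (hess_yy p d G ?z u - grad_y p d F ?z) - c2 *\<^sub>R (hess_yy p d G ?z' u' - grad_y p d F ?z'))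
      \<le> c2 * (K * D)"
  proof -
    have eq: "(hess_yy p d G ?z u - grad_y p d F ?z) - (hess_yy p d G ?z' u' - grad_y p d F ?z')
        = (hess_yy p d G ?z u - hess_yy p d G ?z' u') - (grad_y p d F ?z - grad_y p d F ?z')" by simp
    have "norm ((hess_yy p d G ?z u - grad_y p d F ?z) - (hess_yy p d G ?z' u' - grad_y p d F ?z')) \<le> K * D"
      unfolding eq
      using norm_triangle_ineq4[of "hess_yy p d G ?z u - hess_yy p d G ?z' u'" "grad_y p d F ?z - grad_y p d F ?z'"]
        upper.grad_y_lipschitz[OF z] hess_product_lipschitz(2)[OF z xyu(3) xyu'(3,4)] LD KD 0
      by linarith
    then show ?thesis using c(2) by (simp only: scaleR_diff_right[symmetric] norm_scaleR abs_of_nonneg mult_left_mono)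
  qed
  have "norm (bilevel_field p d c1 c2 F G (x, y, u) - bilevel_field p d c1 c2 F G (x', y', u'))
      \<le> K * D + c1 * (K * D) + c2 * (K * D)"
    unfolding bilevel_field_def prod.case diff_Pair
    using norm_triple_le add_mono[OF add_mono[OF 1 2] 3] by (rule order_trans)
  then show ?thesis unfolding D_def by (simp add: algebra_simps)
qed

text \<open>Bounds the field by the quantities whose squares drive the decrease of the potential, so
  that the part of the block error proportional to the field can be absorbed.\<close>

lemma bilevel_field_bound:
  assumes c: "0 \<le> c1" "0 \<le> c2" and xyu: "x \<in> Rn p" "y \<in> Rn d" "u \<in> Rn d"
  shows "norm (bilevel_field p d c1 c2 F G (x, y, u))
    \<le> K * (1 + c1 + c2) * (norm (hypergrad x) + norm (y - yx x) + norm (u - ux x))"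
proof -
  let ?z = "(x, y)" and ?P = "norm (hypergrad x)" and ?e = "norm (y - yx x)" and ?v = "norm (u - ux x)"
  have K0: "0 \<le> K" using K_bounds(1) by simp
  have "norm (grad_x p d F ?z - hess_xy p d G ?z u) \<le> ?P + K * (?e + ?v)"
    using x_direction_error[OF xyu] norm_triangle_sub[of "grad_x p d F ?z - hess_xy p d G ?z u" "hypergrad x"]
    by linarith
  also have "\<dots> \<le> K * (?P + ?e + ?v)"
    using mult_right_mono[OF K_bounds(1), of ?P] by (simp add: distrib_left)
  finally have 1: "norm (grad_x p d F ?z - hess_xy p d G ?z u) \<le> K * (?P + ?e + ?v)" .
  have "norm (grad_y p d G ?z) \<le> K * (?P + ?e + ?v)"
    by (rule order_trans[OF y_direction_bound[OF xyu]]) (intro mult_left_mono K0, simp)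
  then have 2: "norm (c1 *\<^sub>R grad_y p d G ?z) \<le> c1 * (K * (?P + ?e + ?v))"
    using c(1) by (simp add: mult_left_mono)
  have "norm (hess_yy p d G ?z u - grad_y p d F ?z) \<le> K * (?P + ?e + ?v)"
    by (rule order_trans[OF u_direction_bound[OF xyu]]) (intro mult_left_mono K0, simp)
  then have 3: "norm (c2 *\<^sub>R (hess_yy p d G ?z u - grad_y p d F ?z)) \<le> c2 * (K * (?P + ?e + ?v))"
    using c(2) by (simp add: mult_left_mono)
  have "norm (bilevel_field p d c1 c2 F G (x, y, u)) \<le>
      K * (?P + ?e + ?v) + c1 * (K * (?P + ?e + ?v)) + c2 * (K * (?P + ?e + ?v))"
    unfolding bilevel_field_def prod.case
    using norm_triple_le add_mono[OF add_mono[OF 1 2] 3] by (rule order_trans)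
  then show ?thesis by (simp add: algebra_simps)
qed

text \<open>The radius is exactly balanced:
  \<open>(1 - r * \<mu>) * \<iota> + r * C\<^sub>f = \<iota>\<close>. Any weaker contraction factor
  would let the norm grow.\<close>

lemma u_ball_invariant:
  assumes xyu: "x \<in> Rn p" "y \<in> Rn d" "u \<in> Rn d" and u: "norm u \<le> \<iota>"
    and r: "0 \<le> r" "r * L \<le> 1" "r * \<mu> < 1"
  shows "norm (u - r *\<^sub>R (hess_yy p d G (x, y) u - grad_y p d F (x, y))) \<le> \<iota>"
proof -
  have z: "(x, y) \<in> Rn p \<times> Rn d" using xyu by simp
  have "norm (u - r *\<^sub>R hess_yy p d G (x, y) u) \<le> (1 - r * \<mu>) * norm u"
    by (rule symmetric_step_contraction[OF lower.hess_yy_linear[OF z] subspace_Rn])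
      (use lower.hess_yy_in[OF z] lower.hess_yy_symmetric[OF z] lower.hess_yy_lower[OF z]
        lower.hess_yy_bound[OF z] pos(1) r xyu(3) in auto)
  also have "\<dots> \<le> (1 - r * \<mu>) * \<iota>" using r u by (intro mult_left_mono) auto
  also have "\<dots> = \<iota> - r * C\<^sub>f" unfolding left_diff_distrib using lower.\<mu>_pos by simp
  finally have 1: "norm (u - r *\<^sub>R hess_yy p d G (x, y) u) \<le> \<iota> - r * C\<^sub>f" .
  have 2: "norm (r *\<^sub>R grad_y p d F (x, y)) \<le> r * C\<^sub>f"
    using mult_left_mono[OF upper.grad_y_bounded[OF z] r(1)] r(1) by simp
  have eq: "u - r *\<^sub>R (hess_yy p d G (x, y) u - grad_y p d F (x, y))
      = (u - r *\<^sub>R hess_yy p d G (x, y) u) + r *\<^sub>R grad_y p d F (x, y)" by (simp add: scaleR_diff_right)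
  show ?thesis
    unfolding eq using norm_triangle_ineq[of "u - r *\<^sub>R hess_yy p d G (x, y) u" "r *\<^sub>R grad_y p d F (x, y)"] 1 2
    by linarith
qed

text \<open>Both tracking errors have weight 1, since the balance between the three terms is
  achieved by \<open>c1\<close> and \<open>c2\<close>.\<close>

definition potential :: "rvec \<Rightarrow> rvec \<Rightarrow> rvec \<Rightarrow> real"
  where "potential x y u = h x + (norm (y - yx x))\<^sup>2 + (norm (u - ux x))\<^sup>2"

lemma potential_decrease:
  fixes c1 c2 a \<delta> :: real
  defines "K' \<equiv> K * (1 + c1 + c2)"
  assumes c: "c2 * \<mu> = 400 * K\<^sup>2" "400 * K\<^sup>2 + 12 * (c2 * K\<^sup>2 / \<mu>) \<le> c1 * \<mu>" "0 < c1" "0 < c2"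
    and a: "0 < a" "a * (96 * K'\<^sup>2 + (c1 + c2) * (L\<^sup>2 / \<mu> + 2 * \<mu> + 2 * L)) \<le> 1"
    and xyu: "x \<in> Rn p" "y \<in> Rn d" "u \<in> Rn d" and x': "x' \<in> Rn p"
    and err: "norm ((x', y', u') - (x, y, u) + a *\<^sub>R bilevel_field p d c1 c2 F G (x, y, u))
      \<le> a * (4 * (K' * \<delta>) + 6 * K' * a * norm (bilevel_field p d c1 c2 F G (x, y, u)))"
    and \<delta>: "0 \<le> \<delta>"
  shows "potential x' y' u' \<le> potential x y u - a / 2 * (norm (hypergrad x))\<^sup>2 + a * ((20 * K')\<^sup>2 * \<delta>\<^sup>2)"
proof -
  let ?z = "(x, y)"
  define P where "P = norm (hypergrad x)"
  define e where "e = norm (y - yx x)"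
  define v where "v = norm (u - ux x)"
  define \<epsilon> where "\<epsilon> = 4 * (K' * \<delta>) + 6 * K' * a * norm (bilevel_field p d c1 c2 F G (x, y, u))"
  define g where "g = grad_x p d F ?z - hess_xy p d G ?z u"
  define X where "X = norm (x' - x)"
  have K: "1 \<le> K" by (rule K_bounds)
  have K'1: "1 \<le> K'"
    unfolding K'_def using mult_mono[of 1 K 1 "1 + c1 + c2"] K c by simp
  have KK': "K \<le> K'" unfolding K'_def using mult_left_mono[of 1 "1 + c1 + c2" K] K c by simp
  have \<epsilon>0: "0 \<le> \<epsilon>" unfolding \<epsilon>_def using K'1 \<delta> a(1) by (intro add_nonneg_nonneg mult_nonneg_nonneg) auto
  have parts: "0 \<le> L\<^sup>2 / \<mu>" "0 \<le> 2 * \<mu>" "0 \<le> 2 * L" using lower.\<mu>_pos pos(1) by simp_all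
  \<comment> \<open>The condition on \<open>a\<close> is a sum of nonnegative terms, each used
    alone: the first makes the block error small, the second bounds the damped steps for
    \<open>y\<close> and \<open>u\<close>.\<close>
  have aK': "a * (96 * K'\<^sup>2) \<le> 1"
    and ac: "a * ((c1 + c2) * (L\<^sup>2 / \<mu> + 2 * \<mu> + 2 * L)) \<le> 1"
  proof -
    have "0 \<le> a * (96 * K'\<^sup>2)" "0 \<le> a * ((c1 + c2) * (L\<^sup>2 / \<mu> + 2 * \<mu> + 2 * L))"
      using a(1) c parts by simp_all
    then show "a * (96 * K'\<^sup>2) \<le> 1" "a * ((c1 + c2) * (L\<^sup>2 / \<mu> + 2 * \<mu> + 2 * L)) \<le> 1"
      using a(2) unfolding distrib_left[of a] by linarith+
  qed
  have ac': "a * (c * b) \<le> 1" if "0 \<le> c" "c \<le> c1 + c2" "0 \<le> b" "b \<le> L\<^sup>2 / \<mu> + 2 * \<mu> + 2 * L" for c b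
  proof -
    have "a * (c * b) \<le> a * ((c1 + c2) * (L\<^sup>2 / \<mu> + 2 * \<mu> + 2 * L))"
      using that a(1) by (intro mult_left_mono mult_mono) auto
    then show ?thesis using ac by linarith
  qed
  have small: "c1 * a * \<mu> \<le> 2" "c2 * a * \<mu> \<le> 2" "c1 * a * L\<^sup>2 \<le> \<mu>" "c2 * a * L\<^sup>2 \<le> \<mu>"
  proof -
    have "a * (c1 * (L\<^sup>2 / \<mu>)) \<le> 1" "a * (c2 * (L\<^sup>2 / \<mu>)) \<le> 1"
      "a * (c1 * (2 * \<mu>)) \<le> 1" "a * (c2 * (2 * \<mu>)) \<le> 1"
      by (intro ac'; use c parts in linarith)+
    then show "c1 * a * \<mu> \<le> 2" "c2 * a * \<mu> \<le> 2" "c1 * a * L\<^sup>2 \<le> \<mu>" "c2 * a * L\<^sup>2 \<le> \<mu>"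
      using lower.\<mu>_pos by (simp_all add: pos_divide_le_eq mult_ac)
  qed
  have K'sq: "K' \<le> K'\<^sup>2" using mult_left_mono[OF K'1, of K'] K'1 by (simp add: power2_eq_square)
  have aK: "K * a \<le> 1 / 64"
    using mult_left_mono[OF order_trans[OF KK' K'sq] less_imp_le[OF a(1)]] aK' by (simp add: mult.commute)
  have comps: "norm (x' - x + a *\<^sub>R g) \<le> a * \<epsilon>"
    "norm (y' - y + a *\<^sub>R c1 *\<^sub>R grad_y p d G ?z) \<le> a * \<epsilon>"
    "norm (u' - u + a *\<^sub>R c2 *\<^sub>R (hess_yy p d G ?z u - grad_y p d F ?z)) \<le> a * \<epsilon>"
  proof -
    have "norm (x' - x + a *\<^sub>R g, y' - y + a *\<^sub>R c1 *\<^sub>R grad_y p d G ?z,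
        u' - u + a *\<^sub>R c2 *\<^sub>R (hess_yy p d G ?z u - grad_y p d F ?z)) \<le> a * \<epsilon>"
      using err by (simp add: \<epsilon>_def bilevel_field_def g_def)
    then show "norm (x' - x + a *\<^sub>R g) \<le> a * \<epsilon>"
      "norm (y' - y + a *\<^sub>R c1 *\<^sub>R grad_y p d G ?z) \<le> a * \<epsilon>"
      "norm (u' - u + a *\<^sub>R c2 *\<^sub>R (hess_yy p d G ?z u - grad_y p d F ?z)) \<le> a * \<epsilon>"
      using norm_triple_components order_trans by blast+
  qed
  have dir: "norm (g - hypergrad x) \<le> K * (e + v)"
    unfolding g_def e_def v_def by (rule x_direction_error[OF xyu])
  have gP: "norm g \<le> P + K * (e + v)"
    using norm_triangle_sub[of g "hypergrad x"] dir by (simp add: P_def)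
  have XX: "X \<le> a * (P + K * (e + v) + \<epsilon>)"
  proof -
    have "X \<le> norm (x' - x + a *\<^sub>R g) + norm (a *\<^sub>R g)"
      using norm_triangle_ineq4[of "x' - x + a *\<^sub>R g" "a *\<^sub>R g"] by (simp add: X_def)
    also have "\<dots> \<le> a * \<epsilon> + a * (P + K * (e + v))"
    proof (rule add_mono[OF comps(1)])
      show "norm (a *\<^sub>R g) \<le> a * (P + K * (e + v))" using mult_left_mono[OF gP, of a] a(1) by simp
    qed
    finally show ?thesis by (simp add: algebra_simps)
  qed
  have hd: "h x' \<le> h x - a * P\<^sup>2 + a * (P * (K * (e + v) + \<epsilon>)) + K * X\<^sup>2"
  proof -
    define r where "r = x' - x + a *\<^sub>R g"
    have r: "x' - x = r - a *\<^sub>R (g - hypergrad x) - a *\<^sub>R hypergrad x"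
      by (simp add: r_def scaleR_diff_right)
    have "inner (hypergrad x) (x' - x)
        = inner (hypergrad x) r - a * inner (hypergrad x) (g - hypergrad x) - a * P\<^sup>2"
      unfolding r by (simp add: inner_diff_right P_def power2_norm_eq_inner)
    moreover have "inner (hypergrad x) r \<le> P * (a * \<epsilon>)"
      using norm_cauchy_schwarz[of "hypergrad x" r] mult_left_mono[OF comps(1), of P]
      by (simp add: P_def r_def)
    moreover have "- inner (hypergrad x) (g - hypergrad x) \<le> P * (K * (e + v))"
      using norm_cauchy_schwarz[of "- hypergrad x" "g - hypergrad x"] mult_left_mono[OF dir, of P]
      by (simp add: P_def)
    then have "a * (- inner (hypergrad x) (g - hypergrad x)) \<le> a * (P * (K * (e + v)))"
      using a(1) by (intro mult_left_mono) auto
    moreover have "a * (P * (K * (e + v) + \<epsilon>)) = a * (P * (K * (e + v))) + P * (a * \<epsilon>)"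
      by (simp add: algebra_simps)
    ultimately show ?thesis using hyper_obj_descent[OF xyu(1) x'] by (simp add: X_def)
  qed
  have ed: "norm (y' - yx x') \<le> (1 - c1 * a * \<mu> / 2) * e + a * \<epsilon> + K * X"
  proof -
    have eq: "y' - yx x' = (y - (c1 * a) *\<^sub>R grad_y p d G ?z - yx x)
        + (y' - y + a *\<^sub>R c1 *\<^sub>R grad_y p d G ?z) + (yx x - yx x')" by (simp add: mult.commute)
    have A: "norm (yx x - yx x') \<le> K * X"
      using y_opt_K_lipschitz[OF xyu(1) x'] by (simp add: X_def norm_minus_commute)
    have B: "norm (y - (c1 * a) *\<^sub>R grad_y p d G ?z - yx x) \<le> (1 - c1 * a * \<mu> / 2) * e"
      unfolding e_def using c a(1) small by (intro y_step_contraction[OF xyu]) simp_all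
    show ?thesis unfolding eq by (rule norm_triangle_mono[OF norm_triangle_mono[OF B comps(2)] A])
  qed
  have vd: "norm (u' - ux x') \<le> (1 - c2 * a * \<mu> / 2) * v + c2 * a * (K * e) + a * \<epsilon> + K * X"
  proof -
    have eq: "u' - ux x' = (u - (c2 * a) *\<^sub>R (hess_yy p d G ?z u - grad_y p d F ?z) - ux x)
        + (u' - u + a *\<^sub>R c2 *\<^sub>R (hess_yy p d G ?z u - grad_y p d F ?z)) + (ux x - ux x')"
      by (simp add: mult.commute)
    have A: "norm (ux x - ux x') \<le> K * X"
      using u_opt_K_lipschitz[OF xyu(1) x'] by (simp add: X_def norm_minus_commute)
    have B: "norm (u - (c2 * a) *\<^sub>R (hess_yy p d G ?z u - grad_y p d F ?z) - ux x)
        \<le> (1 - c2 * a * \<mu> / 2) * v + c2 * a * (K * e)"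
      unfolding e_def v_def using c a(1) small by (intro u_step_contraction[OF xyu]) simp_all
    show ?thesis unfolding eq by (rule norm_triangle_mono[OF norm_triangle_mono[OF B comps(3)] A])
  qed
  have eb: "\<epsilon> \<le> (4 * K') * \<delta> + (P + e + v) / 16"
  proof -
    have "norm (bilevel_field p d c1 c2 F G (x, y, u)) \<le> K' * (P + e + v)"
      unfolding K'_def P_def e_def v_def using c by (intro bilevel_field_bound xyu) auto
    then have "6 * K' * a * norm (bilevel_field p d c1 c2 F G (x, y, u)) \<le> 6 * K' * a * (K' * (P + e + v))"
      using K'1 a(1) by (intro mult_left_mono) auto
    \<comment> \<open>Here 96 = 6 * 16: the factor of the block error times the 1/16 allowed by
      \<open>lyapunov_decrease\<close>.\<close>
    also have "\<dots> = a * (96 * K'\<^sup>2) * ((P + e + v) / 16)" by (simp add: power2_eq_square)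
    also have "\<dots> \<le> 1 * ((P + e + v) / 16)"
      using aK' by (intro mult_right_mono) (simp_all add: P_def e_def v_def)
    finally show ?thesis by (simp add: \<epsilon>_def)
  qed
  have "h x' + (norm (y' - yx x'))\<^sup>2 + (norm (u' - ux x'))\<^sup>2
      \<le> h x + e\<^sup>2 + v\<^sup>2 - a / 2 * P\<^sup>2 + a * (20 * (4 * K')\<^sup>2 * \<delta>\<^sup>2)"
    by (rule lyapunov_decrease[OF a(1) aK K lower.\<mu>_pos c(1,2) small(1,2) _ _ _ _ _ \<epsilon>0 _ XX hd ed vd eb])
      (simp_all add: P_def e_def v_def X_def)
  \<comment> \<open>With \<open>Q = 4 * K'\<close> the noise coefficient is 20 * 16 = 320, rounded
    up to the square 400.\<close>
  moreover have "a * (20 * (4 * K')\<^sup>2 * \<delta>\<^sup>2) \<le> a * ((20 * K')\<^sup>2 * \<delta>\<^sup>2)"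
    using a(1) by (intro mult_left_mono mult_right_mono) (simp_all add: power_mult_distrib)
  ultimately show ?thesis by (simp add: potential_def P_def e_def v_def)
qed

end

section \<open>Iterates of the algorithm\<close>

text \<open>Every pair of components is required to be a bilevel problem, because single pairs drive
  the steps and each step must keep \<open>u\<close> in the ball. The conditions on
  \<open>c2 * \<eta>\<close> are those of \<open>u_ball_invariant\<close>.\<close>

locale wior_bo_run =
  fixes p d m n R :: nat and f g :: "nat \<Rightarrow> rvec \<times> rvec \<Rightarrow> real"
    and L C\<^sub>f \<mu> L\<^sub>x\<^sub>y L\<^sub>y\<^sub>y K \<eta> c1 c2 \<alpha> C :: real
    and \<xi> \<zeta> :: "nat \<Rightarrow> nat" and x y u :: "nat \<Rightarrow> rvec"
  assumes sizes: "0 < m" "0 < n" "0 < R"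
    and component: "i < m \<Longrightarrow> j < n \<Longrightarrow> bilevel_problem p d (f i) (g j) L C\<^sub>f \<mu> L\<^sub>x\<^sub>y L\<^sub>y\<^sub>y K"
    and indices: "t < R * lcm m n \<Longrightarrow> \<xi> t < m" "t < R * lcm m n \<Longrightarrow> \<zeta> t < n"
    and rates: "0 < \<eta>" "0 < c1" "0 < c2" "c2 * \<eta> * L \<le> 1" "c2 * \<eta> * \<mu> < 1"
    and run: "wior_bo p d m n f g (C\<^sub>f / \<mu>) R \<xi> \<zeta> (\<lambda>t. \<eta>) (\<lambda>t. c1 * \<eta>) (\<lambda>t. c2 * \<eta>) x y u"
    and averages: "averaged_gradient_bounds p d m n f g (R * lcm m n) \<xi> \<zeta> x y \<alpha> C"
begin

abbreviation "T \<equiv> R * lcm m n"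

lemma upper_component: "i < m \<Longrightarrow> upper_function p d (f i) L C\<^sub>f"
  and lower_component: "j < n \<Longrightarrow> lower_function p d (g j) L \<mu> L\<^sub>x\<^sub>y L\<^sub>y\<^sub>y"
  using component[of i 0] component[of 0 j] sizes bilevel_problem.axioms by blast+

sublocale bilevel_problem p d "avg m f" "avg n g" L C\<^sub>f \<mu> L\<^sub>x\<^sub>y L\<^sub>y\<^sub>y K
  by (rule bilevel_problem.intro[OF upper_function_avg[OF upper_component sizes(1)]
        lower_function_avg[OF lower_component sizes(2)]
        bilevel_problem.axioms(3)[OF component[OF sizes(1,2)]]])

text \<open>The induction also carries \<open>u t = w t\<close> for positive \<open>t\<close>: later
  projections meet points already in the ball, so every update is a plain field step.\<close>

lemma
  shows iterates: "t \<le> T \<Longrightarrow> x t \<in> Rn p" "t \<le> T \<Longrightarrow> y t \<in> Rn d" "t \<le> T \<Longrightarrow> u t \<in> Rn d"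
    "t \<le> T \<Longrightarrow> norm (u t) \<le> \<iota>"
    and iterate_step: "t < T \<Longrightarrow> (x (Suc t), y (Suc t), u (Suc t))
      = (x t, y t, u t) - \<eta> *\<^sub>R bilevel_field p d c1 c2 (f (\<xi> t)) (g (\<zeta> t)) (x t, y t, u t)"
proof -
  have start: "x 0 \<in> Rn p" "y 0 \<in> Rn d"
    using run unfolding wior_bo_def Let_def by blast+
  obtain w where w0: "w 0 \<in> Rn d"
    and uw: "\<And>t. t \<le> T \<Longrightarrow> u t = (if t < T \<and> lcm m n dvd t then proj_ball d \<iota> (w t) else w t)"
    and ys: "\<And>t. t < T \<Longrightarrow> y (Suc t) = y t - (c1 * \<eta>) *\<^sub>R grad_y p d (g (\<zeta> t)) (x t, y t)"
    and ws: "\<And>t. t < T \<Longrightarrow> w (Suc t) = u t - (c2 * \<eta>) *\<^sub>R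
        (hess_yy p d (g (\<zeta> t)) (x t, y t) (u t) - grad_y p d (f (\<xi> t)) (x t, y t))"
    and xs: "\<And>t. t < T \<Longrightarrow> x (Suc t) = x t - \<eta> *\<^sub>R
        (grad_x p d (f (\<xi> t)) (x t, y t) - hess_xy p d (g (\<zeta> t)) (x t, y t) (u t))"
    using run unfolding wior_bo_def Let_def by blast
  have T0: "0 < T" using sizes by (simp add: lcm_pos_nat)
  have inv: "t \<le> T \<Longrightarrow> x t \<in> Rn p \<and> y t \<in> Rn d \<and> u t \<in> Rn d \<and> norm (u t) \<le> \<iota> \<and> (0 < t \<longrightarrow> u t = w t)" for t
  proof (induction t)
    case 0
    have "u 0 = proj_ball d \<iota> (w 0)" using uw[of 0] T0 by simp
    then show ?case using start proj_ball_in(1,2)[OF \<iota>_pos w0] by simp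
  next
    case (Suc t)
    then have t: "t < T" "t \<le> T" by auto
    interpret c: bilevel_problem p d "f (\<xi> t)" "g (\<zeta> t)" L C\<^sub>f \<mu> L\<^sub>x\<^sub>y L\<^sub>y\<^sub>y K
      by (rule component[OF indices(1)[OF t(1)] indices(2)[OF t(1)]])
    from Suc.IH[OF t(2)] have IH: "x t \<in> Rn p" "y t \<in> Rn d" "u t \<in> Rn d" "norm (u t) \<le> \<iota>" by auto
    then have z: "(x t, y t) \<in> Rn p \<times> Rn d" by simp
    have xS: "x (Suc t) \<in> Rn p"
      unfolding xs[OF t(1)]
      by (intro subspace_diff[OF subspace_Rn] subspace_scale[OF subspace_Rn] IH c.upper.grad_x_in
          c.lower.hess_xy_in z)
    have yS: "y (Suc t) \<in> Rn d"
      unfolding ys[OF t(1)]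
      by (intro subspace_diff[OF subspace_Rn] subspace_scale[OF subspace_Rn] IH c.lower.grad_y_in z)
    have wS: "w (Suc t) \<in> Rn d"
      unfolding ws[OF t(1)]
      by (intro subspace_diff[OF subspace_Rn] subspace_scale[OF subspace_Rn] IH c.upper.grad_y_in
          c.lower.hess_yy_in z)
    have wn: "norm (w (Suc t)) \<le> \<iota>"
      unfolding ws[OF t(1)] using rates by (intro c.u_ball_invariant IH) auto
    have "u (Suc t) = w (Suc t)" using uw[OF Suc.prems] proj_ball_in(3)[OF \<iota>_pos wS wn] by simp
    then show ?case using xS yS wS wn by simp
  qed
  then show "t \<le> T \<Longrightarrow> x t \<in> Rn p" "t \<le> T \<Longrightarrow> y t \<in> Rn d" "t \<le> T \<Longrightarrow> u t \<in> Rn d"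
    "t \<le> T \<Longrightarrow> norm (u t) \<le> \<iota>" for t
    by blast+
  show "t < T \<Longrightarrow> (x (Suc t), y (Suc t), u (Suc t))
      = (x t, y t, u t) - \<eta> *\<^sub>R bilevel_field p d c1 c2 (f (\<xi> t)) (g (\<zeta> t)) (x t, y t, u t)" for t
    using inv[of "Suc t"] xs[of t] ys[of t] ws[of t] by (simp add: bilevel_field_def mult.commute)
qed

text \<open>At a fixed state the field is linear in the gradients and the Hessian, so its averaging
  error is assembled from theirs. The Hessian error is applied to \<open>(0, u t)\<close> and
  contributes at most \<iota> times the basic bound.\<close>

lemma field_noise:
  assumes s: "0 < s" "t + s \<le> T"
  shows "norm ((1 / real s) *\<^sub>R (\<Sum>\<tau>=t..<t+s. bilevel_field p d c1 c2 (f (\<xi> \<tau>)) (g (\<zeta> \<tau>)) (x t, y t, u t))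
      - bilevel_field p d c1 c2 (avg m f) (avg n g) (x t, y t, u t))
    \<le> K * (1 + c1 + c2) * \<bar>C\<bar> * real s powr (- \<alpha> / 2)"
proof -
  let ?F = "avg m f" and ?G = "avg n g" and ?z = "(x t, y t)" and ?S = "Rn p \<times> Rn d"
  \<comment> \<open>The square root of the assumed bound; the absolute value is there because
    \<open>C\<close> may be negative.\<close>
  define \<beta> where "\<beta> = real s powr (- \<alpha> / 2) * \<bar>C\<bar>"
  have \<beta>0: "0 \<le> \<beta>" by (simp add: \<beta>_def)
  have \<beta>2: "real s powr (- \<alpha>) * C\<^sup>2 = \<beta>\<^sup>2"
  proof -
    have "(real s powr (- \<alpha> / 2))\<^sup>2 = real s powr (- \<alpha>)"
      by (simp only: power2_eq_square powr_add[symmetric]) simp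
    then show ?thesis by (simp add: \<beta>_def power_mult_distrib)
  qed
  have t: "t \<le> T" using s by simp
  have z: "?z \<in> ?S" and ut: "u t \<in> Rn d" "norm (u t) \<le> \<iota>" using iterates[OF t] by simp_all
  define A where "A v = (1 / real s) *\<^sub>R (\<Sum>\<tau>=t..<t+s. v \<tau>)" for v :: "nat \<Rightarrow> rvec \<times> rvec"
  define Ef where "Ef = A (\<lambda>\<tau>. grad p d (f (\<xi> \<tau>)) ?z) - grad p d ?F ?z"
  define Eg where "Eg = A (\<lambda>\<tau>. grad p d (g (\<zeta> \<tau>)) ?z) - grad p d ?G ?z"
  define EH where "EH v = A (\<lambda>\<tau>. hess p d (g (\<zeta> \<tau>)) ?z v) - hess p d ?G ?z v" for v
  have sq: "(norm Ef)\<^sup>2 \<le> \<beta>\<^sup>2" "(norm Eg)\<^sup>2 \<le> \<beta>\<^sup>2" "(onorm_on ?S EH)\<^sup>2 \<le> \<beta>\<^sup>2"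
    using averages s
    unfolding averaged_gradient_bounds_def Let_def \<beta>2[symmetric] Ef_def Eg_def EH_def A_def by blast+
  have blH: "bounded_linear EH"
    unfolding EH_def A_def
  proof (intro bounded_linear_sub bounded_linear_compose[OF bounded_linear_scaleR_right] bounded_linear_sum)
    fix \<tau> assume "\<tau> \<in> {t..<t+s}"
    then have "\<tau> < T" using s by auto
    then show "bounded_linear (hess p d (g (\<zeta> \<tau>)) ?z)"
      by (intro has_derivative_bounded_linear[OF lower_function.hess_derivative[OF lower_component z]] indices)
  next
    show "bounded_linear (hess p d ?G ?z)"
      by (rule has_derivative_bounded_linear[OF lower.hess_derivative[OF z]])
  qed
  have EH\<beta>: "norm (EH (0, u t)) \<le> \<iota> * \<beta>"
  proof -
    have "norm (EH (0, u t)) \<le> onorm_on ?S EH * norm (0 :: rvec, u t)"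
      using ut by (intro onorm_onD blH) simp
    also have "\<dots> \<le> \<beta> * norm (0 :: rvec, u t)"
      by (intro mult_right_mono power2_le_imp_le[OF sq(3) \<beta>0]) simp
    also have "\<dots> \<le> \<beta> * \<iota>" using ut \<beta>0 by (intro mult_left_mono) (simp_all add: norm_Pair)
    finally show ?thesis by (simp only: mult.commute)
  qed
  note E\<beta> = power2_le_imp_le[OF sq(1) \<beta>0] power2_le_imp_le[OF sq(2) \<beta>0] EH\<beta>
  have K\<beta>: "\<beta> + \<iota> * \<beta> \<le> K * \<beta>" "\<beta> \<le> K * \<beta>"
    using mult_right_mono[OF K_ge(2) \<beta>0] mult_right_mono[OF K_bounds(1) \<beta>0] by (simp_all add: distrib_right)
  have eq: "(1 / real s) *\<^sub>R (\<Sum>\<tau>=t..<t+s. bilevel_field p d c1 c2 (f (\<xi> \<tau>)) (g (\<zeta> \<tau>)) (x t, y t, u t))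
      - bilevel_field p d c1 c2 ?F ?G (x t, y t, u t)
    = (fst Ef - fst (EH (0, u t)), c1 *\<^sub>R snd Eg, c2 *\<^sub>R (snd (EH (0, u t)) - snd Ef))"
    by (simp add: prod_eq_iff bilevel_field_def Ef_def Eg_def EH_def A_def grad_x_def grad_y_def
        hess_xy_def hess_yy_def fst_sum snd_sum sum_subtractf scaleR_diff_right
        scaleR_sum_right[symmetric] scaleR_left_commute algebra_simps)
  have 1: "norm (fst Ef - fst (EH (0, u t))) \<le> K * \<beta>"
    using norm_triangle_ineq4[of "fst Ef" "fst (EH (0, u t))"] norm_fst_le_norm[of Ef]
      norm_fst_le_norm[of "EH (0, u t)"] E\<beta> K\<beta> by linarith
  have 2: "norm (c1 *\<^sub>R snd Eg) \<le> c1 * (K * \<beta>)"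
    using norm_snd_le_norm[of Eg] E\<beta> K\<beta> rates(2) by (simp add: mult_left_mono)
  have "norm (snd (EH (0, u t)) - snd Ef) \<le> K * \<beta>"
    using norm_triangle_ineq4[of "snd (EH (0, u t))" "snd Ef"] norm_snd_le_norm[of Ef]
      norm_snd_le_norm[of "EH (0, u t)"] E\<beta> K\<beta> by linarith
  then have 3: "norm (c2 *\<^sub>R (snd (EH (0, u t)) - snd Ef)) \<le> c2 * (K * \<beta>)"
    using rates(3) by (simp add: mult_left_mono)
  show ?thesis
    unfolding eq
    using order_trans[OF norm_triple_le add_mono[OF add_mono[OF 1 2] 3]]
    by (simp add: \<beta>_def algebra_simps)
qed

lemma block_error:
  assumes k: "0 < k" "t + 2 * k \<le> T" and small: "K * (1 + c1 + c2) * (\<eta> * real k) \<le> 1 / 6"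
  defines "w \<equiv> \<lambda>t. (x t, y t, u t)"
  shows "norm (w (t + k) - w t + (\<eta> * real k) *\<^sub>R bilevel_field p d c1 c2 (avg m f) (avg n g) (w t))
    \<le> \<eta> * real k * (4 * (K * (1 + c1 + c2) * \<bar>C\<bar> * real k powr (- \<alpha> / 2))
      + 6 * (K * (1 + c1 + c2)) * (\<eta> * real k)
        * norm (bilevel_field p d c1 c2 (avg m f) (avg n g) (w t)))"
proof (rule without_replacement_block_error[where T = T
      and V = "\<lambda>\<tau>. bilevel_field p d c1 c2 (f (\<xi> \<tau>)) (g (\<zeta> \<tau>))"])
  have K0: "0 \<le> K * (1 + c1 + c2)" using K_bounds(1) rates by simp
  then show "0 \<le> K * (1 + c1 + c2)" "0 \<le> K * (1 + c1 + c2) * \<bar>C\<bar>" by simp_all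
  show "norm (bilevel_field p d c1 c2 (f (\<xi> \<tau>)) (g (\<zeta> \<tau>)) (w i)
      - bilevel_field p d c1 c2 (f (\<xi> \<tau>)) (g (\<zeta> \<tau>)) (w j)) \<le> K * (1 + c1 + c2) * norm (w i - w j)"
    if "\<tau> < T" "i \<le> T" "j \<le> T" for \<tau> i j
    unfolding w_def using rates that
    by (intro bilevel_problem.bilevel_field_lipschitz[OF component] indices iterates) auto
  show "norm (bilevel_field p d c1 c2 (avg m f) (avg n g) (w i)
      - bilevel_field p d c1 c2 (avg m f) (avg n g) (w j)) \<le> K * (1 + c1 + c2) * norm (w i - w j)"
    if "i \<le> T" "j \<le> T" for i j
    unfolding w_def using rates that by (intro bilevel_field_lipschitz iterates) auto
  show "w (Suc \<tau>) = w \<tau> - \<eta> *\<^sub>R bilevel_field p d c1 c2 (f (\<xi> \<tau>)) (g (\<zeta> \<tau>)) (w \<tau>)" if "\<tau> < T" for \<tau>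
    unfolding w_def by (rule iterate_step[OF that])
  show "norm ((1 / real s) *\<^sub>R (\<Sum>\<tau>=i..<i+s. bilevel_field p d c1 c2 (f (\<xi> \<tau>)) (g (\<zeta> \<tau>)) (w i))
      - bilevel_field p d c1 c2 (avg m f) (avg n g) (w i))
    \<le> K * (1 + c1 + c2) * \<bar>C\<bar> * real s powr (- \<alpha> / 2)" if "0 < s" "i + s \<le> T" for i s
    unfolding w_def by (rule field_noise[OF that])
qed (use k small rates in auto)

text \<open>Telescoping over all blocks but the last leaves the potential at the start of the last
  block. Its excess over the infimum is spent on the one gradient that telescoping does not
  cover.\<close>

lemma convergence:
  fixes E k :: nat
  defines "K' \<equiv> K * (1 + c1 + c2)"
  assumes c: "c2 * \<mu> = 400 * K\<^sup>2" "400 * K\<^sup>2 + 12 * (c2 * K\<^sup>2 / \<mu>) \<le> c1 * \<mu>"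
    and a: "\<eta> * real k * (96 * K'\<^sup>2 + (c1 + c2) * (L\<^sup>2 / \<mu> + 2 * \<mu> + 2 * L)) \<le> 1"
    and Ek: "0 < E" "0 < k" "T = E * k" and bdd: "bdd_below (h ` Rn p)"
  shows "(1 / real E) * (\<Sum>e<E. (norm (gradient_on (Rn p) h (x (k * e))))\<^sup>2)
    \<le> 2 * (potential (x 0) (y 0) (u 0) - (INF x \<in> Rn p. h x)) / (real k * real E * \<eta>)
      + 2 * (20 * K')\<^sup>2 * real k powr (- \<alpha>) * C\<^sup>2"
proof -
  define a where "a = \<eta> * real k"
  define \<delta> where "\<delta> = real k powr (- \<alpha> / 2) * \<bar>C\<bar>"
  define B where "B = a * ((20 * K')\<^sup>2 * \<delta>\<^sup>2)"
  define N where "N e = (norm (hypergrad (x (k * e))))\<^sup>2" for e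
  define \<Phi> where "\<Phi> t = potential (x t) (y t) (u t)" for t
  define hinf where "hinf = (INF x \<in> Rn p. h x)"
  have a0: "0 < a" using Ek rates by (simp add: a_def)
  have \<delta>0: "0 \<le> \<delta>" by (simp add: \<delta>_def)
  have B0: "0 \<le> B" using a0 by (simp add: B_def)
  have K: "1 \<le> K" by (rule K_bounds)
  have K'1: "K \<le> K'" "1 \<le> K'"
  proof -
    show "K \<le> K'" unfolding K'_def using mult_left_mono[of 1 "1 + c1 + c2" K] K rates by simp
    then show "1 \<le> K'" using K by simp
  qed
  have aK': "K' * a \<le> 1 / 96"
  proof -
    have "0 \<le> (c1 + c2) * (L\<^sup>2 / \<mu> + 2 * \<mu> + 2 * L)"
      using rates lower.\<mu>_pos pos(1) by simp
    then have "a * (96 * K'\<^sup>2) \<le> a * (96 * K'\<^sup>2 + (c1 + c2) * (L\<^sup>2 / \<mu> + 2 * \<mu> + 2 * L))"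
      using a0 by (intro mult_left_mono) auto
    then have 1: "a * (96 * K'\<^sup>2) \<le> 1" using assms(4) unfolding a_def by linarith
    have "K' \<le> K'\<^sup>2" using mult_left_mono[OF K'1(2), of K'] K'1(2) by (simp add: power2_eq_square)
    then have "a * (96 * K') \<le> a * (96 * K'\<^sup>2)" using a0 by (intro mult_left_mono) auto
    then show ?thesis using 1 by (simp add: mult.commute)
  qed
  have decrease: "\<Phi> (k * Suc e) \<le> \<Phi> (k * e) - a / 2 * N e + B" if "Suc e < E" for e
  proof -
    have "k * (e + 2) \<le> k * E" using that by (intro mult_le_mono2) simp
    then have "k * e + 2 * k \<le> T" unfolding Ek(3) by (simp add: algebra_simps)
    then have kT: "k * e + 2 * k \<le> T" "k * e + k \<le> T" "k * e \<le> T" by linarith+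
    have small: "K * (1 + c1 + c2) * (\<eta> * real k) \<le> 1 / 6"
      using aK' unfolding K'_def a_def by linarith
    have "\<Phi> (k * e + k) \<le> \<Phi> (k * e) - a / 2 * (norm (hypergrad (x (k * e))))\<^sup>2 + a * ((20 * K')\<^sup>2 * \<delta>\<^sup>2)"
      unfolding \<Phi>_def K'_def
    proof (rule potential_decrease[OF c rates(2,3) a0])
      show "a * (96 * (K * (1 + c1 + c2))\<^sup>2 + (c1 + c2) * (L\<^sup>2 / \<mu> + 2 * \<mu> + 2 * L)) \<le> 1"
        using assms(4) unfolding a_def K'_def .
      show "norm ((x (k * e + k), y (k * e + k), u (k * e + k)) - (x (k * e), y (k * e), u (k * e))
          + a *\<^sub>R bilevel_field p d c1 c2 (avg m f) (avg n g) (x (k * e), y (k * e), u (k * e)))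
        \<le> a * (4 * (K * (1 + c1 + c2) * \<delta>) + 6 * (K * (1 + c1 + c2)) * a
          * norm (bilevel_field p d c1 c2 (avg m f) (avg n g) (x (k * e), y (k * e), u (k * e))))"
        using block_error[OF Ek(2) kT(1)] small by (simp only: a_def \<delta>_def mult_ac)
    qed (use iterates kT \<delta>0 in auto)
    then show ?thesis by (simp add: N_def B_def add.commute)
  qed
  have tele: "e < E \<Longrightarrow> a / 2 * (\<Sum>i<e. N i) \<le> \<Phi> 0 - \<Phi> (k * e) + real e * B" for e
  proof (induction e)
    case (Suc e)
    then have "a / 2 * (\<Sum>i<e. N i) \<le> \<Phi> 0 - \<Phi> (k * e) + real e * B" by simp
    then show ?case using decrease[OF Suc.prems] by (simp only: sum.lessThan_Suc distrib_left of_nat_Suc distrib_right)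
  qed simp
  \<comment> \<open>No samples follow the last block, so the block estimate is not available there; its gradient
      is bounded by the remaining suboptimality instead.\<close>
  have last: "a / 2 * N (E - 1) \<le> \<Phi> (k * (E - 1)) - hinf"
  proof -
    have "k * (E - 1) \<le> k * E" by (intro mult_le_mono2) simp
    then have xin: "x (k * (E - 1)) \<in> Rn p" using Ek(3) by (intro iterates) (simp add: mult.commute)
    have gap: "0 \<le> h (x (k * (E - 1))) - hinf"
      unfolding hinf_def using cINF_lower[OF bdd xin] by simp
    \<comment> \<open>The factor \<open>a / 2 * (4 * K)\<close> is at most 1 for the admissible step
      sizes, and the potential dominates \<open>h\<close>.\<close>
    have "a / 2 * N (E - 1) \<le> a / 2 * (4 * K * (h (x (k * (E - 1))) - hinf))"
      unfolding N_def hinf_def using a0 by (intro mult_left_mono hypergrad_bound_by_gap xin bdd) auto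
    also have "\<dots> = (2 * (K * a)) * (h (x (k * (E - 1))) - hinf)" by simp
    also have "\<dots> \<le> 1 * (h (x (k * (E - 1))) - hinf)"
    proof (intro mult_right_mono gap)
      have "K * a \<le> K' * a" using K'1 a0 by (intro mult_right_mono) auto
      then show "2 * (K * a) \<le> 1" using aK' by simp
    qed
    also have "\<dots> \<le> \<Phi> (k * (E - 1)) - hinf" by (simp add: \<Phi>_def potential_def)
    finally show ?thesis .
  qed
  have split: "(\<Sum>i<E. N i) = (\<Sum>i<E - 1. N i) + N (E - 1)"
    using Ek(1) sum.lessThan_Suc[of N "E - 1"] by simp
  have EB: "real (E - 1) * B \<le> real E * B" using B0 by (intro mult_right_mono) auto
  have "a / 2 * (\<Sum>i<E. N i) \<le> \<Phi> 0 - hinf + real E * B"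
    unfolding split distrib_left using tele[of "E - 1"] last EB Ek(1) by simp
  then have bound: "2 / (a * real E) * (a / 2 * (\<Sum>i<E. N i)) \<le> 2 / (a * real E) * (\<Phi> 0 - hinf + real E * B)"
    using a0 by (intro mult_left_mono) auto
  have lhs: "2 / (a * real E) * (a / 2 * (\<Sum>i<E. N i)) = 1 / real E * (\<Sum>i<E. N i)"
    using a0 by simp
  have rhs: "2 / (a * real E) * (\<Phi> 0 - hinf + real E * B)
      = 2 * (\<Phi> 0 - hinf) / (real k * real E * \<eta>) + 2 * ((20 * K')\<^sup>2 * \<delta>\<^sup>2)"
  proof -
    have "2 / (a * real E) * (real E * B) = 2 * ((20 * K')\<^sup>2 * \<delta>\<^sup>2)" using a0 Ek(1) by (simp add: B_def)
    moreover have "2 / (a * real E) * (\<Phi> 0 - hinf) = 2 * (\<Phi> 0 - hinf) / (real k * real E * \<eta>)"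
      by (simp add: a_def mult_ac)
    ultimately show ?thesis by (simp only: distrib_left)
  qed
  have \<delta>2: "\<delta>\<^sup>2 = real k powr (- \<alpha>) * C\<^sup>2"
  proof -
    have "(real k powr (- \<alpha> / 2))\<^sup>2 = real k powr (- \<alpha>)"
      by (simp only: power2_eq_square powr_add[symmetric]) simp
    then show ?thesis by (simp add: \<delta>_def power_mult_distrib)
  qed
  have sums: "(\<Sum>e<E. (norm (gradient_on (Rn p) h (x (k * e))))\<^sup>2) = (\<Sum>e<E. N e)"
  proof (rule sum.cong[OF refl])
    fix e assume "e \<in> {..<E}"
    then have "k * e \<le> k * E" by (intro mult_le_mono2) simp
    then have "x (k * e) \<in> Rn p" using Ek(3) by (intro iterates) (simp add: mult.commute)
    then show "(norm (gradient_on (Rn p) h (x (k * e))))\<^sup>2 = N e"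
      by (simp add: gradient_hyper_obj N_def)
  qed
  show ?thesis
    using bound unfolding lhs rhs \<delta>2 sums by (simp only: \<Phi>_def hinf_def mult.assoc)
qed

end

theorem theorem4p6:
  fixes L \<mu> C\<^sub>f L\<^sub>x\<^sub>y L\<^sub>y\<^sub>y :: real
  assumes "0 < L" "0 < \<mu>" "0 < C\<^sub>f" "0 < L\<^sub>x\<^sub>y" "0 < L\<^sub>y\<^sub>y"
  shows "\<exists>c1 c2 L0 L1 \<phi>\<^sub>y \<phi>\<^sub>u :: real.
    0 < c1 \<and> 0 < c2 \<and> 0 < L0 \<and> 0 < L1 \<and> 0 < \<phi>\<^sub>y \<and> 0 < \<phi>\<^sub>u \<and>
    (\<forall>(p::nat) (d::nat) (m::nat) (n::nat)
       (f :: nat \<Rightarrow> rvec \<times> rvec \<Rightarrow> real) (g :: nat \<Rightarrow> rvec \<times> rvec \<Rightarrow> real) (A::real)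
       (R::nat) (\<xi> :: nat \<Rightarrow> nat) (\<zeta> :: nat \<Rightarrow> nat)
       (x :: nat \<Rightarrow> rvec) (y :: nat \<Rightarrow> rvec) (u :: nat \<Rightarrow> rvec)
       (\<eta>::real) (\<alpha>::real) (C::real) (E::nat) (k::nat).
      let T = R * lcm m n;
          F = avg m f;
          G = avg n g;
          h = hyper_obj d F G;
          h_inf = (INF x \<in> Rn p. h x);
          \<Delta> = h (x 0) - h_inf + \<phi>\<^sub>y * (norm (y 0 - y_opt d G (x 0)))\<^sup>2
                + \<phi>\<^sub>u * (norm (u 0 - u_opt p d F G (x 0)))\<^sup>2
      in
        0 < p \<longrightarrow> 0 < d \<longrightarrow> 0 < m \<longrightarrow> 0 < n \<longrightarrow>
        upper_assms p d m f L C\<^sub>f \<longrightarrow>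
        lower_assms p d n g L \<mu> L\<^sub>x\<^sub>y L\<^sub>y\<^sub>y \<longrightarrow>
        bounded_heterogeneity p d m n f g A \<longrightarrow>
        bdd_below (h ` Rn p) \<longrightarrow>
        (\<forall>t<T. \<xi> t < m \<and> \<zeta> t < n) \<longrightarrow>
        0 < \<eta> \<longrightarrow>
        wior_bo p d m n f g (C\<^sub>f / \<mu>) R \<xi> \<zeta> (\<lambda>t. \<eta>) (\<lambda>t. c1 * \<eta>) (\<lambda>t. c2 * \<eta>) x y u \<longrightarrow>
        averaged_gradient_bounds p d m n f g T \<xi> \<zeta> x y \<alpha> C \<longrightarrow>
        0 < E \<longrightarrow> 0 < k \<longrightarrow> T = E * k \<longrightarrow>
        \<eta> \<le> 1 / (real k * L0) \<longrightarrow>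
        (1 / real E) * (\<Sum>e<E. (norm (gradient_on (Rn p) h (x (k * e))))\<^sup>2)
          \<le> 2 * \<Delta> / (real k * real E * \<eta>) + 2 * L1\<^sup>2 * real k powr (-\<alpha>) * C\<^sup>2)"
proof -
  define \<iota> where "\<iota> = C\<^sub>f / \<mu>"
  define k1 where "k1 = (L + L\<^sub>y\<^sub>y * \<iota>) * (1 + L / \<mu>) / \<mu>"
  define k2 where "k2 = (L + L\<^sub>x\<^sub>y * \<iota>) * (1 + L / \<mu>) + L * k1"
  \<comment> \<open>A sum of positive terms, so that every bound demanded by
    \<open>bilevel_problem\<close> holds at once.\<close>
  define K where "K = (2 * L + L\<^sub>x\<^sub>y * \<iota> + L\<^sub>y\<^sub>y * \<iota>) + (1 + \<iota>) + L / \<mu> + k1 + k2"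
  define c2 where "c2 = 400 * K\<^sup>2 / \<mu>"
  define c1 where "c1 = (400 * K\<^sup>2 + 12 * (c2 * K\<^sup>2 / \<mu>)) / \<mu>"
  define K' where "K' = K * (1 + c1 + c2)"
  define L0 where "L0 = 96 * K'\<^sup>2 + (c1 + c2) * (L\<^sup>2 / \<mu> + 2 * \<mu> + 2 * L)"
  note p0 = assms
  have \<iota>: "0 < \<iota>" "0 < L\<^sub>x\<^sub>y * \<iota>" "0 < L\<^sub>y\<^sub>y * \<iota>" "0 < L / \<mu>" using p0 by (simp_all add: \<iota>_def)
  have k1: "0 < k1" unfolding k1_def using p0 \<iota> by (intro divide_pos_pos mult_pos_pos add_pos_pos) auto
  have k2: "0 < k2" unfolding k2_def using p0 \<iota> k1 by (intro add_pos_pos mult_pos_pos) auto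
  have K: "2 * L + L\<^sub>x\<^sub>y * \<iota> + L\<^sub>y\<^sub>y * \<iota> \<le> K" "1 + \<iota> \<le> K" "L / \<mu> \<le> K" "k1 \<le> K" "k2 \<le> K" "0 < K"
    unfolding K_def using p0 \<iota> k1 k2 by linarith+
  have c2: "0 < c2" "c2 * \<mu> = 400 * K\<^sup>2" using p0 K by (simp_all add: c2_def)
  have c1: "0 < c1" "c1 * \<mu> = 400 * K\<^sup>2 + 12 * (c2 * K\<^sup>2 / \<mu>)"
    using p0 K c2 by (simp_all add: c1_def add_pos_pos)
  have K': "0 < K'" unfolding K'_def using K c1 c2 by (intro mult_pos_pos) auto
  have brk: "0 \<le> L\<^sup>2 / \<mu>" using p0 by simp
  have L0: "0 < L0"
    unfolding L0_def using K' c1 c2 p0 brk by (intro add_pos_nonneg mult_nonneg_nonneg) auto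
  show ?thesis
  \<comment> \<open>\<open>20 * K'\<close> is the noise constant of
    \<open>potential_decrease\<close>, and the two weights are those of
    \<open>potential\<close>.\<close>
  proof (rule exI[of _ c1], rule exI[of _ c2], rule exI[of _ L0], rule exI[of _ "20 * K'"],
      rule exI[of _ 1], rule exI[of _ 1], intro conjI allI, goal_cases)
    case (7 p d m n f g A R \<xi> \<zeta> x y u \<eta> \<alpha> C E k)
    show ?case
      unfolding Let_def
    proof (intro impI)
      assume sizes: "0 < m" "0 < n" and up: "upper_assms p d m f L C\<^sub>f"
        and lo: "lower_assms p d n g L \<mu> L\<^sub>x\<^sub>y L\<^sub>y\<^sub>y"
        and bdd: "bdd_below (hyper_obj d (avg m f) (avg n g) ` Rn p)"
        and ind: "\<forall>t<R * lcm m n. \<xi> t < m \<and> \<zeta> t < n" and \<eta>: "0 < \<eta>"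
        and run: "wior_bo p d m n f g (C\<^sub>f / \<mu>) R \<xi> \<zeta> (\<lambda>t. \<eta>) (\<lambda>t. c1 * \<eta>) (\<lambda>t. c2 * \<eta>) x y u"
        and avgs: "averaged_gradient_bounds p d m n f g (R * lcm m n) \<xi> \<zeta> x y \<alpha> C"
        and Ek: "0 < E" "0 < k" "R * lcm m n = E * k" and step: "\<eta> \<le> 1 / (real k * L0)"
      have a: "\<eta> * real k * L0 \<le> 1"
        using step L0 Ek(2) by (simp add: pos_le_divide_eq mult.assoc)
      \<comment> \<open>The block condition also limits a single step because \<open>k\<close> is at
        least 1; invariance of the ball is a statement about single steps.\<close>
      have \<eta>L0: "\<eta> * L0 \<le> 1"
      proof -
        have "\<eta> * L0 * 1 \<le> \<eta> * L0 * real k" using \<eta> L0 Ek(2) by (intro mult_left_mono) auto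
        then show ?thesis using a by (simp only: mult_ac)
      qed
      have rate: "\<eta> * (c2 * b) \<le> 1" if "0 \<le> b" "b \<le> L\<^sup>2 / \<mu> + 2 * \<mu> + 2 * L" for b
      proof -
        have "c2 * b \<le> (c1 + c2) * (L\<^sup>2 / \<mu> + 2 * \<mu> + 2 * L)"
          using that c1 c2 by (intro mult_mono) auto
        also have "\<dots> \<le> L0" by (simp add: L0_def)
        finally have "\<eta> * (c2 * b) \<le> \<eta> * L0" using \<eta> by (intro mult_left_mono) auto
        then show ?thesis using \<eta>L0 by simp
      qed
      \<comment> \<open>The factor 2 supplies the strict inequality
        \<open>c2 * \<eta> * \<mu> < 1\<close> that invariance of the ball requires.\<close>
      have r1: "\<eta> * (c2 * (2 * L)) \<le> 1" "\<eta> * (c2 * (2 * \<mu>)) \<le> 1"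
        by (rule rate; use p0 brk in linarith)+
      have pr: "0 < \<eta> * (c2 * L)" "0 < \<eta> * (c2 * \<mu>)" by (intro mult_pos_pos \<eta> c2(1) p0)+
      have R: "0 < R" using Ek by (cases R) auto
      interpret wior_bo_run p d m n R f g L C\<^sub>f \<mu> L\<^sub>x\<^sub>y L\<^sub>y\<^sub>y K \<eta> c1 c2 \<alpha> C \<xi> \<zeta> x y u
      proof (rule wior_bo_run.intro)
        show "bilevel_problem p d (f i) (g j) L C\<^sub>f \<mu> L\<^sub>x\<^sub>y L\<^sub>y\<^sub>y K" if "i < m" "j < n" for i j
          by (intro bilevel_problem.intro bilevel_problem_axioms.intro upper_assms_D[OF up that(1)]
              lower_assms_D[OF lo that(2) p0(2)] p0 K[unfolded k2_def k1_def \<iota>_def])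
        show "c2 * \<eta> * L \<le> 1" "c2 * \<eta> * \<mu> < 1" using r1 pr by (simp_all add: mult_ac)
      qed (use sizes R ind \<eta> c1 c2 run avgs in auto)
      have "(1 / real E) * (\<Sum>e<E. (norm (gradient_on (Rn p) h (x (k * e))))\<^sup>2)
        \<le> 2 * (potential (x 0) (y 0) (u 0) - (INF x \<in> Rn p. h x)) / (real k * real E * \<eta>)
          + 2 * (20 * K')\<^sup>2 * real k powr (- \<alpha>) * C\<^sup>2"
        unfolding K'_def
        by (rule convergence[OF c2(2) _ _ Ek bdd]) (use c1(2) a in \<open>simp_all add: L0_def K'_def\<close>)
      then show "(1 / real E) * (\<Sum>e<E. (norm (gradient_on (Rn p)
            (hyper_obj d (avg m f) (avg n g)) (x (k * e))))\<^sup>2)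
        \<le> 2 * (hyper_obj d (avg m f) (avg n g) (x 0) - (INF x \<in> Rn p. hyper_obj d (avg m f) (avg n g) x)
            + 1 * (norm (y 0 - y_opt d (avg n g) (x 0)))\<^sup>2
            + 1 * (norm (u 0 - u_opt p d (avg m f) (avg n g) (x 0)))\<^sup>2) / (real k * real E * \<eta>)
          + 2 * (20 * K')\<^sup>2 * real k powr (- \<alpha>) * C\<^sup>2"
        by (simp add: potential_def algebra_simps)
    qed
  qed (use c1 c2 L0 K' in simp_all)
qed

end
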